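(* Let $X$ be a finite set of variables, $U=\mathbb{Z}[X]$ the polynomial ring, $A$ a free $U$-module and $p$ a prime. Then the torsion subgroups of $L^p(A)\otimes_U\mathbb{Z}$ and $M^p(A)\otimes_U\mathbb{Z}$ are isomorphic, and the homomorphism $\theta_p\otimes 1: M^p(A)\otimes_U\mathbb{Z}\rightarrow L^p(A)\otimes_U\mathbb{Z}$ maps the torsion subgroup of $M^p(A)\otimes_U\mathbb{Z}$ isomorphically onto the torsion subgroup of $L^p(A)\otimes_U\mathbb{Z}$.
   Context: For a free abelian group $A$, $L(A)$ is the free Lie ring on $A$ (free on any $\mathbb{Z}$-basis of $A$), and $L^c(A)$ is its degree $c$ homogeneous component, i.e. the span of all left-normed products $[a_1,\dots,a_c]=[[a_1,\dots,a_{c-1}],a_c]$ with $a_i\in A$. $L(A)''$ is the second derived ideal of $L(A)$, and $M^c(A)=L^c(A)/(L^c(A)\cap L(A)'')$ is the degree $c$ component of the free metabelian Lie ring $L(A)/L(A)''$. If $A$ is a module for $U=\mathbb{Z}[X]$, then $L^c(A)$ and $M^c(A)$ are $U$-modules under the derivation action: for $x\in X$, $[a_1,\dots,a_c]x=\sum_{i=1}^c[a_1,\dots,a_ix,\dots,a_c]$. $\mathbb{Z}$ is regarded as a trivial $U$-module (every $x\in X$ acts as $0$). For $c\ge 2$ the map $\theta_c:M^c(A)\to L^c(A)$ is the ($U$-module) homomorphism given by $$[a_1,\dots,a_c]\mapsto \frac1c\Big(\sum_{\sigma}[a_1,a_{\sigma(2)},\dots,a_{\sigma(c)}]-\sum_{\tau}[a_2,a_{\tau(1)},a_{\tau(3)},\dots,a_{\tau(c)}]\Big),$$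 where $\sigma$ runs over all permutations of $\{2,3,\dots,c\}$ and $\tau$ over all permutations of $\{1,3,\dots,c\}$; the expression in large brackets is divisible by $c$ in $L^c(A)$ (which is torsion-free), so the factor $1/c$ makes sense. *)

theory Defs
  imports
    Complex_Main
    "HOL-Computational_Algebra.Primes"
    "HOL-Library.Poly_Mapping"
    "HOL-Algebra.AbelCoset"
    "HOL-Algebra.Module"
    "HOL-Algebra.Free_Abelian_Groups"
    "HOL-Combinatorics.Permutations"
begin

section \<open>Free Lie rings on abelian groups\<close>

class lie_ring = ab_group_add +
  fixes lie_bracket :: "'a \<Rightarrow> 'a \<Rightarrow> 'a"
  assumes lie_bracket_add_left: "lie_bracket (u + v) w = lie_bracket u w + lie_bracket v w"
    and lie_bracket_add_right: "lie_bracket u (v + w) = lie_bracket u v + lie_bracket u w"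
    and lie_bracket_self: "lie_bracket v v = 0"
    and lie_jacobi: "lie_bracket (lie_bracket u v) w + lie_bracket (lie_bracket v w) u
                      + lie_bracket (lie_bracket w u) v = 0"

datatype 'a lie_term =
    TGen 'a
  | TZero
  | TNeg "'a lie_term"
  | TAdd "'a lie_term" "'a lie_term"
  | TBr "'a lie_term" "'a lie_term"

text \<open>The least congruence on Lie ring terms that makes the quotient a Lie ring and the
  generator map additive.\<close>

inductive lie_eq :: "'a::ab_group_add lie_term \<Rightarrow> 'a lie_term \<Rightarrow> bool" where
  refl: "lie_eq t t"
| sym: "lie_eq s t \<Longrightarrow> lie_eq t s"
| trans: "lie_eq s t \<Longrightarrow> lie_eq t u \<Longrightarrow> lie_eq s u"
| neg_cong: "lie_eq s t \<Longrightarrow> lie_eq (TNeg s) (TNeg t)"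
| add_cong: "lie_eq s s' \<Longrightarrow> lie_eq t t' \<Longrightarrow> lie_eq (TAdd s t) (TAdd s' t')"
| br_cong: "lie_eq s s' \<Longrightarrow> lie_eq t t' \<Longrightarrow> lie_eq (TBr s t) (TBr s' t')"
| add_assoc: "lie_eq (TAdd (TAdd s t) u) (TAdd s (TAdd t u))"
| add_comm: "lie_eq (TAdd s t) (TAdd t s)"
| add_zero: "lie_eq (TAdd TZero t) t"
| add_neg: "lie_eq (TAdd (TNeg t) t) TZero"
| br_add_left: "lie_eq (TBr (TAdd s t) u) (TAdd (TBr s u) (TBr t u))"
| br_add_right: "lie_eq (TBr s (TAdd t u)) (TAdd (TBr s t) (TBr s u))"
| br_self: "lie_eq (TBr t t) TZero"
| jacobi: "lie_eq (TAdd (TAdd (TBr (TBr s t) u) (TBr (TBr t u) s)) (TBr (TBr u s) t)) TZero"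
| gen_add: "lie_eq (TGen (a + b)) (TAdd (TGen a) (TGen b))"

quotient_type (overloaded) 'a free_lie = "'a::ab_group_add lie_term" / lie_eq
  by (intro equivpI reflpI sympI transpI) (blast intro: lie_eq.intros)+

instantiation free_lie :: (ab_group_add) lie_ring
begin

lift_definition zero_free_lie :: "'a free_lie" is TZero .

lift_definition plus_free_lie :: "'a free_lie \<Rightarrow> 'a free_lie \<Rightarrow> 'a free_lie" is TAdd
  by (rule lie_eq.add_cong)

lift_definition uminus_free_lie :: "'a free_lie \<Rightarrow> 'a free_lie" is TNeg
  by (rule lie_eq.neg_cong)

lift_definition minus_free_lie :: "'a free_lie \<Rightarrow> 'a free_lie \<Rightarrow> 'a free_lie"
  is "\<lambda>s t. TAdd s (TNeg t)"
  by (intro lie_eq.add_cong lie_eq.neg_cong)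

lift_definition lie_bracket_free_lie :: "'a free_lie \<Rightarrow> 'a free_lie \<Rightarrow> 'a free_lie" is TBr
  by (rule lie_eq.br_cong)

instance
  by standard (transfer, blast intro: lie_eq.intros)+

end

lift_definition lie_gen :: "'a::ab_group_add \<Rightarrow> 'a free_lie" is TGen .

lemma lie_gen_add: "lie_gen (a + b) = lie_gen a + lie_gen b"
  by transfer (rule lie_eq.gen_add)

lemma lie_bracket_zero [simp]:
  fixes v :: "'a::lie_ring"
  shows "lie_bracket 0 v = 0" "lie_bracket v 0 = 0"
  using lie_bracket_add_left[of 0 0 v] lie_bracket_add_right[of v 0 0] by simp_all

lemma free_lie_induct [case_names gen zero neg add bracket]:
  assumes "\<And>a. P (lie_gen a)" "P 0" "\<And>v. P v \<Longrightarrow> P (- v)"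
    and "\<And>v w. P v \<Longrightarrow> P w \<Longrightarrow> P (v + w)"
    and "\<And>v w. P v \<Longrightarrow> P w \<Longrightarrow> P (lie_bracket v w)"
  shows "P (v :: 'a::ab_group_add free_lie)"
proof -
  have "P (abs_free_lie t)" for t
  proof (induction t)
    case (TGen a) then show ?case using assms(1)[of a] by (simp add: lie_gen.abs_eq)
  next
    case TZero then show ?case using assms(2) by (simp add: zero_free_lie.abs_eq)
  next
    case (TNeg t) then show ?case using assms(3) by (metis uminus_free_lie.abs_eq)
  next
    case (TAdd s t) then show ?case using assms(4) by (metis plus_free_lie.abs_eq)
  next
    case (TBr s t) then show ?case using assms(5) by (metis lie_bracket_free_lie.abs_eq)
  qed
  then show ?thesis by (metis Quotient_abs_rep Quotient_free_lie)
qed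

primrec lie_term_eval :: "('a \<Rightarrow> 'b::lie_ring) \<Rightarrow> 'a lie_term \<Rightarrow> 'b" where
  "lie_term_eval g (TGen a) = g a"
| "lie_term_eval g TZero = 0"
| "lie_term_eval g (TNeg t) = - lie_term_eval g t"
| "lie_term_eval g (TAdd s t) = lie_term_eval g s + lie_term_eval g t"
| "lie_term_eval g (TBr s t) = lie_bracket (lie_term_eval g s) (lie_term_eval g t)"

lemma lie_term_eval_respects:
  assumes "additive g" "lie_eq s t"
  shows "lie_term_eval g s = lie_term_eval g t"
  using assms(2)
proof induction
  case (jacobi s t u)
  then show ?case by (simp add: lie_jacobi)
qed (simp_all add: additive.add[OF assms(1)] lie_bracket_add_left lie_bracket_add_right
    lie_bracket_self algebra_simps)

text \<open>The universal property. When the abelian group is free on a set \<open>B\<close>, additive maps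
  out of it are the same as arbitrary maps out of \<open>B\<close>, so its free Lie ring is the free
  Lie ring on the set \<open>B\<close>.\<close>

theorem free_lie_universal:
  fixes g :: "'a::ab_group_add \<Rightarrow> 'b::lie_ring"
  assumes g: "additive g"
  shows "\<exists>!h :: 'a free_lie \<Rightarrow> 'b. additive h \<and>
           (\<forall>v w. h (lie_bracket v w) = lie_bracket (h v) (h w)) \<and> (\<forall>a. h (lie_gen a) = g a)"
proof (rule ex_ex1I)
  define h where "h v = lie_term_eval g (rep_free_lie v)" for v
  have h: "h (abs_free_lie t) = lie_term_eval g t" for t
    unfolding h_def
    by (rule lie_term_eval_respects[OF g])
      (metis Quotient_free_lie Quotient_rep_abs lie_eq.refl)
  have surj: "\<exists>t. v = abs_free_lie t" for v :: "'a free_lie"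
    by (metis Quotient_abs_rep Quotient_free_lie)
  have "additive h"
  proof
    fix v w show "h (v + w) = h v + h w"
      using surj[of v] surj[of w] by (auto simp: plus_free_lie.abs_eq h)
  qed
  moreover have "h (lie_bracket v w) = lie_bracket (h v) (h w)" for v w
    using surj[of v] surj[of w] by (auto simp: lie_bracket_free_lie.abs_eq h)
  moreover have "h (lie_gen a) = g a" for a
    by (simp add: lie_gen.abs_eq h)
  ultimately show "\<exists>h :: 'a free_lie \<Rightarrow> 'b. additive h \<and>
      (\<forall>v w. h (lie_bracket v w) = lie_bracket (h v) (h w)) \<and> (\<forall>a. h (lie_gen a) = g a)"
    by blast
next
  fix h h' :: "'a free_lie \<Rightarrow> 'b"
  assume h: "additive h \<and>
      (\<forall>v w. h (lie_bracket v w) = lie_bracket (h v) (h w)) \<and> (\<forall>a. h (lie_gen a) = g a)"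
    and h': "additive h' \<and>
      (\<forall>v w. h' (lie_bracket v w) = lie_bracket (h' v) (h' w)) \<and> (\<forall>a. h' (lie_gen a) = g a)"
  show "h = h'"
  proof
    fix v show "h v = h' v"
      using h h'
      by (induction v rule: free_lie_induct) (auto simp: additive.add additive.zero additive.minus)
  qed
qed


section \<open>Homogeneous components and the second derived ideal\<close>

inductive_set additive_span :: "'a::ab_group_add set \<Rightarrow> 'a set" for S where
  zero: "0 \<in> additive_span S"
| base: "v \<in> S \<Longrightarrow> v \<in> additive_span S"
| add: "v \<in> additive_span S \<Longrightarrow> w \<in> additive_span S \<Longrightarrow> v + w \<in> additive_span S"
| neg: "v \<in> additive_span S \<Longrightarrow> - v \<in> additive_span S"

fun left_normed :: "'a::ab_group_add list \<Rightarrow> 'a free_lie" where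
  "left_normed [] = 0"
| "left_normed (a # as) = foldl (\<lambda>v b. lie_bracket v (lie_gen b)) (lie_gen a) as"

definition lie_component :: "nat \<Rightarrow> 'a::ab_group_add free_lie set" where
  "lie_component c = additive_span {left_normed as |as. length as = c}"

definition bracket_span :: "'a::lie_ring set \<Rightarrow> 'a set \<Rightarrow> 'a set" where
  "bracket_span S T = additive_span {lie_bracket v w |v w. v \<in> S \<and> w \<in> T}"

definition second_derived :: "'a::lie_ring set" where
  "second_derived = bracket_span (bracket_span UNIV UNIV) (bracket_span UNIV UNIV)"


section \<open>The polynomial ring and its modules\<close>

type_synonym 'x zpoly = "('x \<Rightarrow>\<^sub>0 nat) \<Rightarrow>\<^sub>0 int"

definition zpoly_ring :: "'x set \<Rightarrow> 'x zpoly ring" where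
  "zpoly_ring X =
    \<lparr>carrier = {f. \<forall>m \<in> Poly_Mapping.keys f. Poly_Mapping.keys m \<subseteq> X},
     mult = (*), one = 1, ring.zero = 0, add = (+)\<rparr>"

definition zvar :: "'x \<Rightarrow> 'x zpoly" where
  "zvar x = Poly_Mapping.single (Poly_Mapping.single x 1) 1"

text \<open>The fields \<open>mult\<close> and \<open>one\<close> of a module record carry no meaning.\<close>

definition ab_module :: "'a::ab_group_add set \<Rightarrow> ('r \<Rightarrow> 'a \<Rightarrow> 'a) \<Rightarrow> ('r, 'a) module" where
  "ab_module V s =
    \<lparr>carrier = V, mult = undefined, one = undefined, ring.zero = 0, add = (+), smult = s\<rparr>"

definition module_basis ::
  "('r, 'k) ring_scheme \<Rightarrow> ('r, 'a, 'm) module_scheme \<Rightarrow> 'a set \<Rightarrow> bool" where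
  "module_basis R M B \<longleftrightarrow> B \<subseteq> carrier M \<and>
    (\<forall>v \<in> carrier M. \<exists>!k. k \<in> B \<rightarrow>\<^sub>E carrier R \<and> finite {b \<in> B. k b \<noteq> \<zero>\<^bsub>R\<^esub>} \<and>
       v = (\<Oplus>\<^bsub>M\<^esub>b \<in> {b \<in> B. k b \<noteq> \<zero>\<^bsub>R\<^esub>}. k b \<odot>\<^bsub>M\<^esub> b))"

definition free_module ::
  "('r, 'k) ring_scheme \<Rightarrow> ('r, 'a, 'm) module_scheme \<Rightarrow> bool" where
  "free_module R M \<longleftrightarrow> module R M \<and> (\<exists>B. module_basis R M B)"

definition quotient_module ::
  "('r, 'a, 'm) module_scheme \<Rightarrow> 'a set \<Rightarrow> ('r, 'a set) module" where
  "quotient_module M N =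
    \<lparr>carrier = a_rcosets\<^bsub>M\<^esub> N, mult = undefined, one = undefined, ring.zero = N, add = set_add M,
     smult = (\<lambda>r C. \<Union>v \<in> C. N +>\<^bsub>M\<^esub> (r \<odot>\<^bsub>M\<^esub> v))\<rparr>"

definition trivial_module :: "('x zpoly, int) module" where
  "trivial_module = ab_module UNIV (\<lambda>f n. Poly_Mapping.lookup f 0 * n)"


section \<open>The derivation action\<close>

primrec lie_term_deriv :: "('a \<Rightarrow> 'a) \<Rightarrow> 'a lie_term \<Rightarrow> 'a lie_term" where
  "lie_term_deriv f (TGen a) = TGen (f a)"
| "lie_term_deriv f TZero = TZero"
| "lie_term_deriv f (TNeg t) = TNeg (lie_term_deriv f t)"
| "lie_term_deriv f (TAdd s t) = TAdd (lie_term_deriv f s) (lie_term_deriv f t)"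
| "lie_term_deriv f (TBr s t) = TAdd (TBr (lie_term_deriv f s) t) (TBr s (lie_term_deriv f t))"

text \<open>For additive \<open>f\<close> this is the derivation extending \<open>f\<close>: the choice of
  representative does not matter, see \<open>lie_deriv_abs\<close>.\<close>

definition lie_deriv :: "('a::ab_group_add \<Rightarrow> 'a) \<Rightarrow> 'a free_lie \<Rightarrow> 'a free_lie" where
  "lie_deriv f v = abs_free_lie (lie_term_deriv f (rep_free_lie v))"

lemma abs_free_lie_simps:
  "abs_free_lie (TGen a) = lie_gen a" "abs_free_lie TZero = 0"
  "abs_free_lie (TNeg t) = - abs_free_lie t"
  "abs_free_lie (TAdd s t) = abs_free_lie s + abs_free_lie t"
  "abs_free_lie (TBr s t) = lie_bracket (abs_free_lie s) (abs_free_lie t)"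
  by (simp_all add: lie_gen.abs_eq zero_free_lie.abs_eq uminus_free_lie.abs_eq
      plus_free_lie.abs_eq lie_bracket_free_lie.abs_eq)

lemma lie_bracket_anticomm: "lie_bracket v w + lie_bracket w v = 0" for v w :: "'a::lie_ring"
  using lie_bracket_self[of "v + w"]
  unfolding lie_bracket_add_left lie_bracket_add_right
  by (simp add: lie_bracket_self add.commute)

lemma lie_term_deriv_respects:
  assumes f: "additive f" and st: "lie_eq s t"
  shows "abs_free_lie (lie_term_deriv f s) = abs_free_lie (lie_term_deriv f t)"
  using st
proof induction
  case (br_cong s s' t t')
  then show ?case
    by (simp add: abs_free_lie_simps) (metis free_lie.abs_eq_iff)
next
  case (br_self t)
  then show ?case by (simp add: abs_free_lie_simps lie_bracket_anticomm)
next
  case (jacobi s t u)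
  let ?a = abs_free_lie and ?d = "\<lambda>t. abs_free_lie (lie_term_deriv f t)"
  have "?d (TAdd (TAdd (TBr (TBr s t) u) (TBr (TBr t u) s)) (TBr (TBr u s) t)) =
      (lie_bracket (lie_bracket (?d s) (?a t)) (?a u) + lie_bracket (lie_bracket (?a t) (?a u)) (?d s)
        + lie_bracket (lie_bracket (?a u) (?d s)) (?a t)) +
      (lie_bracket (lie_bracket (?a s) (?d t)) (?a u) + lie_bracket (lie_bracket (?d t) (?a u)) (?a s)
        + lie_bracket (lie_bracket (?a u) (?a s)) (?d t)) +
      (lie_bracket (lie_bracket (?a s) (?a t)) (?d u) + lie_bracket (lie_bracket (?a t) (?d u)) (?a s)
        + lie_bracket (lie_bracket (?d u) (?a s)) (?a t))"
    by (simp add: abs_free_lie_simps lie_bracket_add_left algebra_simps)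
  also have "\<dots> = 0" by (simp only: lie_jacobi) simp
  finally show ?case by (simp add: abs_free_lie_simps)
qed (simp_all add: abs_free_lie_simps lie_bracket_add_left lie_bracket_add_right
    additive.add[OF f] lie_gen_add algebra_simps)

lemma lie_deriv_abs:
  assumes "additive f"
  shows "lie_deriv f (abs_free_lie t) = abs_free_lie (lie_term_deriv f t)"
  unfolding lie_deriv_def
  by (rule lie_term_deriv_respects[OF assms])
    (metis Quotient_free_lie Quotient_rep_abs lie_eq.refl)

lemma lie_deriv:
  assumes f: "additive f"
  shows "lie_deriv f (lie_gen a) = lie_gen (f a)"
    and "lie_deriv f (v + w) = lie_deriv f v + lie_deriv f w"
    and "lie_deriv f (lie_bracket v w) =
           lie_bracket (lie_deriv f v) w + lie_bracket v (lie_deriv f w)"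
proof -
  have surj: "\<exists>t. v = abs_free_lie t" for v :: "'a free_lie"
    by (metis Quotient_abs_rep Quotient_free_lie)
  obtain s t where "v = abs_free_lie s" "w = abs_free_lie t" using surj by metis
  then show "lie_deriv f (v + w) = lie_deriv f v + lie_deriv f w"
    and "lie_deriv f (lie_bracket v w) =
           lie_bracket (lie_deriv f v) w + lie_bracket v (lie_deriv f w)"
    by (metis lie_deriv_abs[OF f] abs_free_lie_simps(4) lie_term_deriv.simps(4))
      (metis lie_deriv_abs[OF f] abs_free_lie_simps(4,5) lie_term_deriv.simps(5)
        \<open>v = abs_free_lie s\<close> \<open>w = abs_free_lie t\<close>)
  show "lie_deriv f (lie_gen a) = lie_gen (f a)"
    by (metis lie_deriv_abs[OF f] abs_free_lie_simps(1) lie_term_deriv.simps(1))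
qed

lemma left_normed_snoc:
  "as \<noteq> [] \<Longrightarrow> left_normed (as @ [b]) = lie_bracket (left_normed as) (lie_gen b)"
  by (cases as) simp_all

lemma lie_deriv_left_normed:
  assumes f: "additive f"
  shows "lie_deriv f (left_normed as) = (\<Sum>i<length as. left_normed (as[i := f (as ! i)]))"
proof (induction as rule: rev_induct)
  case Nil
  show ?case using lie_deriv(2)[OF f, of 0 0] by simp
next
  case (snoc b as)
  show ?case
  proof (cases "as = []")
    case True
    then show ?thesis by (simp add: lie_deriv(1)[OF f])
  next
    case False
    have br: "lie_bracket (\<Sum>i\<in>I. g i) w = (\<Sum>i\<in>I. lie_bracket (g i) w)"
      if "finite I" for I :: "nat set" and g :: "nat \<Rightarrow> 'a free_lie" and w
      using that by induction (simp_all add: lie_bracket_add_left)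
    have "(\<Sum>i<length as. left_normed ((as @ [b])[i := f ((as @ [b]) ! i)]))
        = (\<Sum>i<length as. lie_bracket (left_normed (as[i := f (as ! i)])) (lie_gen b))"
      using False by (intro sum.cong) (auto simp: nth_append list_update_append left_normed_snoc)
    then show ?thesis
      using False by (simp add: left_normed_snoc lie_deriv[OF f] snoc br)
  qed
qed

definition zscale :: "int \<Rightarrow> 'a::ab_group_add \<Rightarrow> 'a" where
  "zscale k v = (\<Sum>i<nat k. v) - (\<Sum>i<nat (- k). v)"

text \<open>Evaluation of a polynomial at a family \<open>D\<close> of commuting additive operators. It is
  the commutativity that makes the order in which \<^const>\<open>Finite_Set.fold\<close> runs through the
  variables immaterial.\<close>

definition monom_action :: "('x \<Rightarrow> 'v \<Rightarrow> 'v) \<Rightarrow> ('x \<Rightarrow>\<^sub>0 nat) \<Rightarrow> 'v \<Rightarrow> 'v" where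
  "monom_action D m v =
    Finite_Set.fold (\<lambda>x. D x ^^ Poly_Mapping.lookup m x) v (Poly_Mapping.keys m)"

definition zpoly_action :: "('x \<Rightarrow> 'v \<Rightarrow> 'v) \<Rightarrow> 'x zpoly \<Rightarrow> 'v \<Rightarrow> 'v::ab_group_add" where
  "zpoly_action D f v =
    (\<Sum>m \<in> Poly_Mapping.keys f. zscale (Poly_Mapping.lookup f m) (monom_action D m v))"

lemma zpoly_action_zvar: "zpoly_action D (zvar x) v = D x v"
proof -
  interpret comp_fun_commute_on "{x}" "\<lambda>y. D y ^^ Poly_Mapping.lookup (Poly_Mapping.single x 1) y"
    by unfold_locales simp
  have "monom_action D (Poly_Mapping.single x 1) v = D x v"
    by (simp add: monom_action_def fold_insert)
  then show ?thesis
    by (simp add: zpoly_action_def zvar_def zscale_def)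
qed

lemma zpoly_action_const: "zpoly_action D (Poly_Mapping.single 0 k) v = zscale k v"
  by (cases "k = 0") (simp_all add: zpoly_action_def monom_action_def zscale_def)

text \<open>A variable acts on the free Lie ring as the derivation extending its action on the
  generating module, and a polynomial acts as the corresponding polynomial in these
  derivations (so that a product of variables acts as a composite of derivations, which is
  not the derivation extending the action of the product).\<close>

definition lie_module ::
  "('x zpoly \<Rightarrow> 'a \<Rightarrow> 'a) \<Rightarrow> nat \<Rightarrow> ('x zpoly, 'a::ab_group_add free_lie) module" where
  "lie_module s c = ab_module (lie_component c) (zpoly_action (\<lambda>x. lie_deriv (s (zvar x))))"

definition metab_module ::
  "('x zpoly \<Rightarrow> 'a \<Rightarrow> 'a) \<Rightarrow> nat \<Rightarrow> ('x zpoly, 'a::ab_group_add free_lie set) module" where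
  "metab_module s c = quotient_module (lie_module s c) (lie_component c \<inter> second_derived)"

definition metab_class :: "('x zpoly \<Rightarrow> 'a \<Rightarrow> 'a) \<Rightarrow> nat \<Rightarrow> 'a free_lie \<Rightarrow>
    'a::ab_group_add free_lie set" where
  "metab_class s c v = (lie_component c \<inter> second_derived) +>\<^bsub>lie_module s c\<^esub> v"


section \<open>The map from the metabelian to the full component\<close>

text \<open>The entries are indexed from 1.\<close>

definition theta_sum :: "nat \<Rightarrow> (nat \<Rightarrow> 'a::ab_group_add) \<Rightarrow> 'a free_lie" where
  "theta_sum c a =
    (\<Sum>\<sigma> | \<sigma> permutes {2..c}. left_normed (a 1 # map (\<lambda>i. a (\<sigma> i)) [2..<Suc c])) -
    (\<Sum>\<tau> | \<tau> permutes insert 1 {3..c}. left_normed (a 2 # a (\<tau> 1) # map (\<lambda>i. a (\<tau> i)) [3..<Suc c]))"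

text \<open>The division by \<open>c\<close> is expressed by multiplying the value by \<open>c\<close>.\<close>

definition theta ::
  "('x zpoly \<Rightarrow> 'a \<Rightarrow> 'a) \<Rightarrow> nat \<Rightarrow> 'a::ab_group_add free_lie set \<Rightarrow> 'a free_lie" where
  "theta s c = (THE \<phi>. \<phi> \<in> extensional (carrier (metab_module s c)) \<and>
     \<phi> \<in> hom (add_monoid (metab_module s c)) (add_monoid (lie_module s c)) \<and>
     (\<forall>a. zscale (int c) (\<phi> (metab_class s c (left_normed (map a [1..<Suc c])))) = theta_sum c a))"


section \<open>Tensor products and torsion\<close>

definition tensor_relators :: "('r, 'k) ring_scheme \<Rightarrow> ('r, 'a, 'm) module_scheme \<Rightarrow>
    ('r, 'b, 'n) module_scheme \<Rightarrow> ('a \<times> 'b \<Rightarrow>\<^sub>0 int) set" where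
  "tensor_relators R M N =
    {frag_of (v \<oplus>\<^bsub>M\<^esub> v', w) - frag_of (v, w) - frag_of (v', w) |v v' w.
       v \<in> carrier M \<and> v' \<in> carrier M \<and> w \<in> carrier N} \<union>
    {frag_of (v, w \<oplus>\<^bsub>N\<^esub> w') - frag_of (v, w) - frag_of (v, w') |v w w'.
       v \<in> carrier M \<and> w \<in> carrier N \<and> w' \<in> carrier N} \<union>
    {frag_of (r \<odot>\<^bsub>M\<^esub> v, w) - frag_of (v, r \<odot>\<^bsub>N\<^esub> w) |r v w.
       r \<in> carrier R \<and> v \<in> carrier M \<and> w \<in> carrier N}"

definition tensor_kernel :: "('r, 'k) ring_scheme \<Rightarrow> ('r, 'a, 'm) module_scheme \<Rightarrow>
    ('r, 'b, 'n) module_scheme \<Rightarrow> ('a \<times> 'b \<Rightarrow>\<^sub>0 int) set" where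
  "tensor_kernel R M N =
    generate (free_Abelian_group (carrier M \<times> carrier N)) (tensor_relators R M N)"

definition tensor_group :: "('r, 'k) ring_scheme \<Rightarrow> ('r, 'a, 'm) module_scheme \<Rightarrow>
    ('r, 'b, 'n) module_scheme \<Rightarrow> ('a \<times> 'b \<Rightarrow>\<^sub>0 int) set monoid" where
  "tensor_group R M N = free_Abelian_group (carrier M \<times> carrier N) Mod tensor_kernel R M N"

text \<open>The map \<open>f \<otimes> g\<close> into the tensor product of \<open>M'\<close> and \<open>N'\<close>.\<close>

definition tensor_map :: "('r, 'k) ring_scheme \<Rightarrow> ('r, 'c, 'm) module_scheme \<Rightarrow>
    ('r, 'd, 'n) module_scheme \<Rightarrow> ('a \<Rightarrow> 'c) \<Rightarrow> ('b \<Rightarrow> 'd) \<Rightarrow>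
    ('a \<times> 'b \<Rightarrow>\<^sub>0 int) set \<Rightarrow> ('c \<times> 'd \<Rightarrow>\<^sub>0 int) set" where
  "tensor_map R M' N' f g C =
    (\<Union>z \<in> C. tensor_kernel R M' N' #>\<^bsub>free_Abelian_group (carrier M' \<times> carrier N')\<^esub>
       frag_extend (\<lambda>(v, w). frag_of (f v, g w)) z)"

definition torsion_subgroup :: "('a, 'k) monoid_scheme \<Rightarrow> ('a, 'k) monoid_scheme" where
  "torsion_subgroup G =
    G\<lparr>carrier := {x \<in> carrier G. \<exists>n::nat. 0 < n \<and> x [^]\<^bsub>G\<^esub> n = \<one>\<^bsub>G\<^esub>}\<rparr>"

end

theory Submission
  imports Defs "HOL-Combinatorics.Multiset_Permutations" "HOL-Number_Theory.Residues"
begin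

text \<open>
  Write \<open>M\<close> for the metabelian quotient of \<open>L = L\<^sup>p(A)\<close> and \<open>K\<close> for the kernel of the projection from
  \<open>L\<close> to \<open>M\<close>. The coinvariants of a module are its quotient by the images of all variables; they are
  the tensor product with the trivial module \<open>\<int>\<close> (\<open>TK_iff\<close>). Torsion in coinvariants is controlled by
  one principle: the tensor product over \<open>\<int>\<close> of the free module \<open>A\<close> with any module that is free over
  \<open>\<int>\<close> has torsion-free coinvariants (\<open>coinvariants_torsion_free\<close>), so an equivariant map that factors
  through such a tensor product kills torsion.

  Three maps of this kind are used. The right-normed bracketing of words, composed with the embedding
  of \<open>L\<close> into the tensor power, is multiplication by \<open>p\<close> (\<open>dynkin\<close>), so \<open>p\<close> annihilates the torsion for
  \<open>L\<close>. Multiplication by \<open>p\<close> on \<open>M\<close> factors through the tensor product of \<open>A\<close> with a symmetric power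
  (\<open>metab_torsion_exponent\<close>), so \<open>p\<close> annihilates the torsion for \<open>M\<close> as well. Finally, the operator
  \<open>cut i\<close> symmetrises and brackets the last \<open>i\<close> letters of a word and brackets the others onto the
  result.

  For \<open>i = p\<close> that operator, restricted to \<open>L\<close>, is \<open>p\<close> times theta (\<open>lin_cut_emb_left_normed\<close>). Its values
  on \<open>L\<close> are divisible by \<open>p\<close> because they are sums of brackets with the coefficients
  \<open>p choose 1, \<dots>, p choose (p - 1)\<close> (\<open>sym_ad_antisymmetrised\<close>). It vanishes on \<open>K\<close> and is
  \<open>p (p - 2)!\<close> modulo \<open>K\<close>, so theta followed by the projection to \<open>M\<close> is \<open>(p - 2)!\<close>. By Wilson's theorem
  this is the identity on elements of order \<open>p\<close>. Thus theta is injective on the torsion for \<open>M\<close>. It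
  is also onto the torsion for \<open>L\<close>, provided that the projection is injective there: an element and
  theta of its image have the same image.

  It remains to see that \<open>K\<close> contributes no torsion, which is the heart of the proof
  (\<open>mono_span_torsion\<close>). After localisation at \<open>p\<close>, the derived ideal is generated in degrees below \<open>p\<close>
  by the images of the operators \<open>cut i\<close> on the components of degree \<open>i\<close>, and \<open>K\<close> is spanned by Lie
  monomials with at least two factors from these images. If \<open>i\<close> is the largest degree of a factor that
  occurs, \<open>cut i\<close> multiplies a monomial by \<open>i (i - 2)!\<close> times the number of its factors of degree \<open>i\<close>
  (\<open>lin_cut_lie_mono\<close>). On the other hand the operator kills torsion. As these eigenvalues are prime to
  \<open>p\<close> unless they vanish, subtracting them one after the other removes the factors of degree \<open>i\<close>
  from a torsion element, and then \<open>i\<close> can be lowered until nothing is left.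

  The same descent without any variables shows that \<open>K\<close> is torsion free as an abelian group. The
  quotient \<open>M\<close> is torsion free since it is a retract of a free abelian group
  (\<open>pair_split_metab_pairs\<close>). Hence \<open>L\<close> is torsion free (\<open>lie_component_torsion_free\<close>), which is what
  makes theta well defined and unique.
\<close>

section \<open>Integer multiples, additive maps and formal integer combinations\<close>

lemma zscale_succ: "zscale (k + 1) v = zscale k v + v"
proof (cases "k \<ge> 0")
  case True
  then have "nat (k + 1) = Suc (nat k)" "nat (- (k + 1)) = 0" "nat (- k) = 0" by auto
  then show ?thesis by (simp add: zscale_def add.commute)
next
  case False
  then have "nat (- k) = Suc (nat (- (k + 1)))" "nat (k + 1) = 0" "nat k = 0" by auto
  then show ?thesis by (simp add: zscale_def)
qed

lemma zscale_0 [simp]: "zscale 0 v = 0"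
  by (simp add: zscale_def)

lemma zscale_pred: "zscale (k - 1) v = zscale k v - v"
  using zscale_succ[of "k - 1" v] by (simp add: algebra_simps)

interpretation zscale: Modules.module "zscale :: int \<Rightarrow> 'a::ab_group_add \<Rightarrow> 'a"
proof
  fix a b :: int and x y :: 'a
  show dist: "zscale a (x + y) = zscale a x + zscale a y" for a :: int and x y :: 'a
    by (simp add: zscale_def sum.distrib algebra_simps)
  have neg: "zscale (- a) x = - zscale a x" for a :: int and x :: 'a
    by (simp add: zscale_def)
  show add: "zscale (a + b) x = zscale a x + zscale b x" for a b :: int and x :: 'a
  proof (induction b rule: int_induct[of _ 0])
    case (step1 i)
    then show ?case using zscale_succ[of "a + i" x] zscale_succ[of i x] by (simp add: algebra_simps)
  next
    case (step2 i)
    then show ?case using zscale_pred[of "a + i" x] zscale_pred[of i x] by (simp add: add_diff_eq)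
  qed simp
  show one: "zscale 1 x = x" for x :: 'a by (simp add: zscale_def)
  show "zscale a (zscale b x) = zscale (a * b) x"
  proof (induction a rule: int_induct[of _ 0])
    case (step1 i)
    then show ?case by (simp add: zscale_succ distrib_right add one)
  next
    case (step2 i)
    then show ?case using add[of "i * b" "- b" x] by (simp add: zscale_pred left_diff_distrib neg)
  qed simp
qed

lemma zscale_int_mult: "zscale k (m :: int) = k * m"
proof (induction k rule: int_induct[of _ 0])
  case (step1 i) then show ?case by (simp add: zscale_succ distrib_right)
next
  case (step2 i) then show ?case by (simp add: zscale_pred left_diff_distrib)
qed simp

lemma additive_zscale:
  assumes "additive h" shows "h (zscale k v) = zscale k (h v)"
  by (simp add: zscale_def additive.diff[OF assms] additive.sum[OF assms])

lemma additive_compose: "additive f \<Longrightarrow> additive g \<Longrightarrow> additive (\<lambda>v. f (g v))"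
  by (simp add: additive_def)

lemma additive_diff_fun: "additive f \<Longrightarrow> additive g \<Longrightarrow> additive (\<lambda>v. f v - g v)"
  by (simp add: additive_def)

lemma additive_add_fun: "additive f \<Longrightarrow> additive g \<Longrightarrow> additive (\<lambda>v. f v + g v)"
  by (simp add: additive_def)

lemma additive_sum_fun: "(\<And>i. i \<in> I \<Longrightarrow> additive (f i)) \<Longrightarrow> additive (\<lambda>v. \<Sum>i\<in>I. f i v)"
  by (simp add: additive_def sum.distrib)

lemma additive_zscale_fun: "additive f \<Longrightarrow> additive (\<lambda>v. zscale k (f v))"
  by (simp add: additive_def zscale.scale_right_distrib)

definition add_closed :: "'a::ab_group_add set \<Rightarrow> bool" where
  "add_closed S \<longleftrightarrow> 0 \<in> S \<and> (\<forall>v\<in>S. \<forall>w\<in>S. v - w \<in> S)"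

lemma add_closedD:
  assumes "add_closed S"
  shows add_closed_zero: "0 \<in> S"
    and add_closed_diff: "v \<in> S \<Longrightarrow> w \<in> S \<Longrightarrow> v - w \<in> S"
    and add_closed_uminus: "v \<in> S \<Longrightarrow> - v \<in> S"
    and add_closed_add: "v \<in> S \<Longrightarrow> w \<in> S \<Longrightarrow> v + w \<in> S"
proof -
  show "0 \<in> S" and diff: "v \<in> S \<Longrightarrow> w \<in> S \<Longrightarrow> v - w \<in> S" for v w
    using assms by (auto simp: add_closed_def)
  show neg: "v \<in> S \<Longrightarrow> - v \<in> S" for v
    using diff[of 0 v] assms by (auto simp: add_closed_def)
  show "v \<in> S \<Longrightarrow> w \<in> S \<Longrightarrow> v + w \<in> S"
    using diff[of v "- w"] neg[of w] by auto
qed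

lemma add_closed_sum: "add_closed S \<Longrightarrow> (\<And>i. i \<in> I \<Longrightarrow> f i \<in> S) \<Longrightarrow> (\<Sum>i\<in>I. f i) \<in> S"
  by (induction I rule: infinite_finite_induct) (auto simp: add_closed_zero add_closed_add)

lemma add_closed_zscale: "add_closed S \<Longrightarrow> v \<in> S \<Longrightarrow> zscale k v \<in> S"
  unfolding zscale_def by (intro add_closed_diff add_closed_sum)

lemma add_closed_swap: "add_closed S \<Longrightarrow> v - w \<in> S \<Longrightarrow> w \<in> S \<longleftrightarrow> v \<in> S"
  using add_closed_diff[of S v "v - w"] add_closed_add[of S "v - w" w] by auto

text \<open>Congruence modulo a subgroup is handled through membership of differences.\<close>

lemma add_closed_trans: "add_closed S \<Longrightarrow> u - v \<in> S \<Longrightarrow> v - w \<in> S \<Longrightarrow> u - w \<in> S"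
  using add_closed_add[of S "u - v" "v - w"] by simp

lemma add_closed_minus_commute: "add_closed S \<Longrightarrow> u - v \<in> S \<longleftrightarrow> v - u \<in> S"
  using add_closed_uminus[of S "u - v"] add_closed_uminus[of S "v - u"] by auto

lemma add_closed_coprime:
  assumes S: "add_closed S" and "coprime k l" "zscale k v \<in> S" "zscale l v \<in> S"
  shows "v \<in> S"
proof -
  obtain a b where "a * k + b * l = 1"
    using \<open>coprime k l\<close> bezout_int[of k l] by (auto simp: coprime_iff_gcd_eq_1)
  then have "v = zscale a (zscale k v) + zscale b (zscale l v)"
    by (metis zscale.scale_scale zscale.scale_left_distrib zscale.scale_one)
  also have "\<dots> \<in> S"
    by (intro add_closed_add[OF S] add_closed_zscale[OF S] assms)
  finally show ?thesis .
qed

lemma add_closed_span [simp]: "add_closed (additive_span S)"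
  unfolding add_closed_def
  by (metis additive_span.add additive_span.neg additive_span.zero diff_conv_add_uminus)

lemma additive_span_minimal: "S \<subseteq> T \<Longrightarrow> add_closed T \<Longrightarrow> additive_span S \<subseteq> T"
proof
  fix v assume "S \<subseteq> T" "add_closed T" "v \<in> additive_span S"
  from this(3) show "v \<in> T"
    using \<open>S \<subseteq> T\<close> \<open>add_closed T\<close>
    by induction (auto simp: add_closed_zero add_closed_add add_closed_uminus)
qed

lemma additive_span_mono: "S \<subseteq> T \<Longrightarrow> additive_span S \<subseteq> additive_span T"
  by (intro additive_span_minimal) (auto intro: additive_span.base)

lemma add_closed_vimage: "additive h \<Longrightarrow> add_closed S \<Longrightarrow> add_closed {v. h v \<in> S}"
  by (simp add: add_closed_def additive.diff additive.zero)

lemma add_closed_singleton_zero [simp]: "add_closed {0}"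
  by (simp add: add_closed_def)

lemma additive_image_span:
  assumes h: "additive h" and T: "add_closed T" and gen: "\<And>v. v \<in> S \<Longrightarrow> h v \<in> T"
    and v: "v \<in> additive_span S"
  shows "h v \<in> T"
  using additive_span_minimal[of S "{v. h v \<in> T}"] add_closed_vimage[OF h T] gen v by auto

lemma additive_eq_on_span:
  assumes "additive h" "additive g" "\<And>v. v \<in> S \<Longrightarrow> h v = g v" "v \<in> additive_span S"
  shows "h v = g v"
  using additive_image_span[OF additive_diff_fun[OF assms(1,2)] add_closed_singleton_zero _ assms(4)]
    assms(3) by simp

definition set_sum :: "'a::ab_group_add set \<Rightarrow> 'a set \<Rightarrow> 'a set" where
  "set_sum S T = {v + w |v w. v \<in> S \<and> w \<in> T}"

lemma add_closed_set_sum: "add_closed S \<Longrightarrow> add_closed T \<Longrightarrow> add_closed (set_sum S T)"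
proof (unfold add_closed_def, intro conjI ballI)
  assume "0 \<in> S \<and> (\<forall>v\<in>S. \<forall>w\<in>S. v - w \<in> S)" "0 \<in> T \<and> (\<forall>v\<in>T. \<forall>w\<in>T. v - w \<in> T)"
  note * = this
  show "0 \<in> set_sum S T" using * unfolding set_sum_def by force
  fix v w assume "v \<in> set_sum S T" "w \<in> set_sum S T"
  then obtain a b c d where "v = a + b" "w = c + d" "a \<in> S" "c \<in> S" "b \<in> T" "d \<in> T"
    unfolding set_sum_def by blast
  then have "v - w = (a - c) + (b - d)" "a - c \<in> S" "b - d \<in> T" using * by (auto simp: algebra_simps)
  then show "v - w \<in> set_sum S T" unfolding set_sum_def by blast
qed

lemma set_sum_left: "add_closed T \<Longrightarrow> S \<subseteq> set_sum S T"
  using add_closed_zero[of T] unfolding set_sum_def by force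

lemma set_sum_right: "add_closed S \<Longrightarrow> T \<subseteq> set_sum S T"
  using add_closed_zero[of S] unfolding set_sum_def by force

lemma set_sum_minimal: "add_closed R \<Longrightarrow> S \<subseteq> R \<Longrightarrow> T \<subseteq> R \<Longrightarrow> set_sum S T \<subseteq> R"
  unfolding set_sum_def by (auto intro: add_closed_add)

definition lin :: "('k \<Rightarrow> 'v::ab_group_add) \<Rightarrow> ('k \<Rightarrow>\<^sub>0 int) \<Rightarrow> 'v" where
  "lin g f = (\<Sum>k \<in> Poly_Mapping.keys f. zscale (Poly_Mapping.lookup f k) (g k))"

lemma lin_superset:
  "finite S \<Longrightarrow> Poly_Mapping.keys f \<subseteq> S \<Longrightarrow>
    lin g f = (\<Sum>k\<in>S. zscale (Poly_Mapping.lookup f k) (g k))"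
  unfolding lin_def by (rule sum.mono_neutral_left) (auto simp: in_keys_iff)

lemma additive_lin: "additive (lin g)"
proof
  fix f f' :: "'a \<Rightarrow>\<^sub>0 int"
  let ?S = "Poly_Mapping.keys f \<union> Poly_Mapping.keys f'"
  have "Poly_Mapping.keys (f + f') \<subseteq> ?S" by (rule Poly_Mapping.keys_add)
  then show "lin g (f + f') = lin g f + lin g f'"
    by (simp add: lin_superset[of ?S] lookup_add zscale.scale_left_distrib sum.distrib)
qed

lemmas lin_add = additive.add[OF additive_lin]
  and lin_diff = additive.diff[OF additive_lin]
  and lin_uminus = additive.minus[OF additive_lin]
  and lin_zero [simp] = additive.zero[OF additive_lin]
  and lin_sum = additive.sum[OF additive_lin]
  and lin_zscale = additive_zscale[OF additive_lin]

lemma lin_frag_of [simp]: "lin g (frag_of k) = g k"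
  by (simp add: lin_def keys_frag_of)

lemma additive_lin_comp: "additive h \<Longrightarrow> h (lin g f) = lin (\<lambda>k. h (g k)) f"
  by (simp add: lin_def additive.sum additive_zscale)

lemma frag_induct [case_names zero one diff]:
  fixes f :: "'k \<Rightarrow>\<^sub>0 int"
  assumes "P 0" "\<And>k. P (frag_of k)" "\<And>f g. P f \<Longrightarrow> P g \<Longrightarrow> P (f - g)"
  shows "P f"
  using frag_induction[of f UNIV P] assms by blast

lemma additive_frag_eq:
  assumes "additive h" "additive g" "\<And>k. k \<in> Poly_Mapping.keys f \<Longrightarrow> h (frag_of k) = g (frag_of k)"
  shows "h f = g f"
proof -
  have "f = lin frag_of f" for f :: "'a \<Rightarrow>\<^sub>0 int"
    by (induction f rule: frag_induct) (simp_all add: lin_diff)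
  then have "h f = lin (\<lambda>k. h (frag_of k)) f" "g f = lin (\<lambda>k. g (frag_of k)) f"
    using additive_lin_comp[OF assms(1)] additive_lin_comp[OF assms(2)] by metis+
  then show ?thesis using assms(3) by (simp add: lin_def)
qed

lemma lin_self: "lin frag_of f = f"
  by (rule additive_frag_eq[OF additive_lin]) (simp_all add: additive_def)

lemma lin_lin: "lin g (lin b f) = lin (\<lambda>k. lin g (b k)) f"
  by (rule additive_lin_comp[OF additive_lin])

lemma lin_cong: "(\<And>k. k \<in> Poly_Mapping.keys f \<Longrightarrow> g k = h k) \<Longrightarrow> lin g f = lin h f"
  by (simp add: lin_def)

lemma lin_fun_add: "lin (\<lambda>k. g k + h k) f = lin g f + lin h f"
  by (simp add: lin_def zscale.scale_right_distrib sum.distrib)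

lemma lin_fun_diff: "lin (\<lambda>k. g k - h k) f = lin g f - lin h f"
  by (simp add: lin_def zscale.scale_right_diff_distrib sum_subtractf)

lemma lin_fun_zero [simp]: "lin (\<lambda>k. 0) f = 0"
  by (simp add: lin_def)

lemma lin_closed: "add_closed S \<Longrightarrow> (\<And>k. k \<in> Poly_Mapping.keys f \<Longrightarrow> g k \<in> S) \<Longrightarrow> lin g f \<in> S"
  unfolding lin_def by (intro add_closed_sum add_closed_zscale)

lemma lookup_zscale [simp]: "Poly_Mapping.lookup (zscale k f) i = k * Poly_Mapping.lookup f i"
proof -
  have "additive (\<lambda>f :: 'a \<Rightarrow>\<^sub>0 int. Poly_Mapping.lookup f i)"
    by (simp add: additive_def lookup_add)
  from additive_zscale[OF this] show ?thesis by (simp add: zscale_int_mult)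
qed

lemma zscale_frag_eq_0_iff: "zscale k (f :: 'a \<Rightarrow>\<^sub>0 int) = 0 \<longleftrightarrow> k = 0 \<or> f = 0"
  by (auto simp: poly_mapping_eq_iff fun_eq_iff)

lemma additive_frag_closed:
  assumes "additive h" "add_closed S" "\<And>k. k \<in> Poly_Mapping.keys f \<Longrightarrow> h (frag_of k) \<in> S"
  shows "h f \<in> S"
proof -
  have "h f = lin (\<lambda>k. h (frag_of k)) f"
    using additive_lin_comp[OF assms(1), of frag_of f] by (simp add: lin_self)
  then show ?thesis using lin_closed[OF assms(2), of f "\<lambda>k. h (frag_of k)"] assms(3) by simp
qed

definition multiadditive :: "nat \<Rightarrow> ('a::ab_group_add list \<Rightarrow> 'v::ab_group_add) \<Rightarrow> bool" where
  "multiadditive n H \<longleftrightarrow> (\<forall>xs ys. length xs + length ys + 1 = n \<longrightarrow> additive (\<lambda>f. H (xs @ f # ys)))"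

text \<open>Expansion of one argument after the other. With a subgroup in place of zero, the statement
  compares two maps modulo a subgroup.\<close>

lemma multiadditive_closed:
  fixes H :: "('l \<Rightarrow>\<^sub>0 int) list \<Rightarrow> 'v::ab_group_add"
  assumes H: "multiadditive n H" and S: "add_closed S"
    and basis: "\<And>w. length w = n \<Longrightarrow> H (map frag_of w) \<in> S" and "length fs = n"
  shows "H fs \<in> S"
proof -
  have "H (map frag_of w @ gs) \<in> S" if "length w + length gs = n" for w gs
    using that
  proof (induction gs arbitrary: w)
    case (Cons f gs)
    have "additive (\<lambda>f. H (map frag_of w @ f # gs))"
      using H Cons.prems by (auto simp: multiadditive_def)
    moreover have "H (map frag_of w @ frag_of k # gs) \<in> S" for k
      using Cons.IH[of "w @ [k]"] Cons.prems by simp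
    ultimately show ?case using additive_frag_closed[OF _ S, of "\<lambda>f. H (map frag_of w @ f # gs)"] by blast
  qed (use basis in simp)
  from this[of "[]" fs] assms(4) show ?thesis by simp
qed

lemma multiadditive_diff: "multiadditive n F \<Longrightarrow> multiadditive n G \<Longrightarrow> multiadditive n (\<lambda>fs. F fs - G fs)"
  unfolding multiadditive_def by (simp add: additive_diff_fun)

lemma multiadditive_compose: "additive h \<Longrightarrow> multiadditive n F \<Longrightarrow> multiadditive n (\<lambda>fs. h (F fs))"
  unfolding multiadditive_def using additive_compose[of h] by blast

lemma multiadditive_zscale: "multiadditive n F \<Longrightarrow> multiadditive n (\<lambda>fs. zscale k (F fs))"
  unfolding multiadditive_def by (simp add: additive_zscale_fun)

section \<open>The grading of the free Lie ring and its second derived ideal\<close>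

lemma additive_bracket_left: "additive (\<lambda>u. lie_bracket u (v :: 'a::lie_ring))"
  by (simp add: additive_def lie_bracket_add_left)

lemma additive_bracket_right: "additive (lie_bracket (u :: 'a::lie_ring))"
  by (simp add: additive_def lie_bracket_add_right)

lemmas lie_bracket_linear =
  additive.diff[OF additive_bracket_left] additive.diff[OF additive_bracket_right]
  additive.minus[OF additive_bracket_left] additive.minus[OF additive_bracket_right]
  additive.sum[OF additive_bracket_left] additive.sum[OF additive_bracket_right]
  additive_zscale[OF additive_bracket_left] additive_zscale[OF additive_bracket_right]

lemma lie_bracket_minus_commute: "lie_bracket v u = - lie_bracket u (v :: 'a::lie_ring)"
  using lie_bracket_anticomm[of u v] by (simp add: eq_neg_iff_add_eq_0 add.commute)

lemma lie_bracket_bracket_right: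
  "lie_bracket u (lie_bracket v w) =
    lie_bracket (lie_bracket u v) w - lie_bracket (lie_bracket u w) (v :: 'a::lie_ring)"
proof -
  have "lie_bracket u (lie_bracket v w) = - lie_bracket (lie_bracket v w) u"
    by (rule lie_bracket_minus_commute)
  moreover have "lie_bracket (lie_bracket w u) v = - lie_bracket (lie_bracket u w) v"
    by (simp add: lie_bracket_minus_commute[of w u] lie_bracket_linear)
  ultimately show ?thesis
    using lie_jacobi[of u v w] by (simp add: algebra_simps add_eq_0_iff)
qed

lemma lie_bracket_bracket_left:
  "lie_bracket (lie_bracket u v) w =
    lie_bracket (lie_bracket u w) v + lie_bracket u (lie_bracket v (w :: 'a::lie_ring))"
  by (simp add: lie_bracket_bracket_right)

lemma lie_bracket_span:
  assumes R: "add_closed R" and b: "\<And>s t. s \<in> S \<Longrightarrow> t \<in> T \<Longrightarrow> lie_bracket s t \<in> R"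
    and u: "u \<in> additive_span S" and v: "v \<in> additive_span T"
  shows "lie_bracket u (v :: 'a::lie_ring) \<in> R"
  by (rule additive_image_span[OF additive_bracket_left R _ u],
      rule additive_image_span[OF additive_bracket_right R _ v]) (rule b)

lemma left_normed_Cons: "left_normed (a # as) = foldl lie_bracket (lie_gen a) (map lie_gen as)"
  by (simp add: foldl_map)

lemma add_closed_lie_component [simp]: "add_closed (lie_component c)"
  by (simp add: lie_component_def)

lemma left_normed_in_lie_component: "left_normed as \<in> lie_component (length as)"
  unfolding lie_component_def by (rule additive_span.base) auto

lemma lie_component_minimal:
  assumes "add_closed S" "\<And>as. length as = c \<Longrightarrow> left_normed as \<in> S"
  shows "lie_component c \<subseteq> S"
  unfolding lie_component_def by (rule additive_span_minimal) (use assms in auto)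

lemma lie_gen_in_lie_component: "lie_gen a \<in> lie_component (Suc 0)"
  using left_normed_in_lie_component[of "[a]"] by simp

lemma lie_component_0: "lie_component 0 = {0}"
  using lie_component_minimal[of "{0}" 0] add_closed_zero[of "lie_component 0"] by auto

lemma lie_component_bracket_gen:
  assumes "v \<in> lie_component c"
  shows "lie_bracket v (lie_gen b) \<in> lie_component (Suc c)"
proof -
  have "lie_bracket (left_normed as) (lie_gen b) \<in> lie_component (Suc c)" if "length as = c" for as
  proof (cases "as = []")
    case False
    then show ?thesis
      using left_normed_in_lie_component[of "as @ [b]"] that by (simp add: left_normed_snoc)
  qed (simp add: add_closed_zero)
  then show ?thesis
    by (intro additive_image_span[OF additive_bracket_left _ _ assms[unfolded lie_component_def]]) auto
qed

lemma lie_component_bracket: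
  assumes u: "u \<in> lie_component i" and v: "v \<in> lie_component j"
  shows "lie_bracket u v \<in> lie_component (i + j)"
proof -
  have "lie_bracket u (left_normed as) \<in> lie_component (i + length as)"
    if "u \<in> lie_component i" for u :: "'a free_lie" and i as
    using that
  proof (induction as arbitrary: u i rule: rev_induct)
    case Nil
    then show ?case by (simp add: add_closed_zero)
  next
    case (snoc b as)
    show ?case
    proof (cases "as = []")
      case True
      then show ?thesis using lie_component_bracket_gen[OF snoc.prems] by simp
    next
      case False
      have "lie_bracket (lie_bracket u (left_normed as)) (lie_gen b)
          \<in> lie_component (Suc (i + length as))"
        using snoc by (intro lie_component_bracket_gen)
      moreover have "lie_bracket (lie_bracket u (lie_gen b)) (left_normed as)
          \<in> lie_component (Suc i + length as)"
        using snoc.prems by (intro snoc.IH lie_component_bracket_gen)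
      ultimately show ?thesis
        using False by (simp add: left_normed_snoc lie_bracket_bracket_right add_closed_diff)
    qed
  qed
  then show ?thesis
    using u by (intro additive_image_span[OF additive_bracket_right _ _ v[unfolded lie_component_def]]) auto
qed

lemma lie_component_foldl:
  "v \<in> lie_component c \<Longrightarrow> foldl lie_bracket v (map lie_gen as) \<in> lie_component (c + length as)"
proof (induction as arbitrary: v c)
  case (Cons a as)
  then show ?case using lie_component_bracket_gen[of v c a] Cons.IH[of _ "Suc c"] by auto
qed simp

text \<open>This is the intersection of the second derived ideal with the component of degree \<open>d\<close>. The
  equality needs torsion-free components, since the degrees are separated by the Dynkin operator,
  and is proved below for prime degrees.\<close>

definition metab_kernel :: "nat \<Rightarrow> 'a::ab_group_add free_lie set" where
  "metab_kernel d = additive_span {lie_bracket u v |u v i j.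
     u \<in> lie_component i \<and> v \<in> lie_component j \<and> 2 \<le> i \<and> 2 \<le> j \<and> i + j = d}"

lemma add_closed_metab_kernel [simp]: "add_closed (metab_kernel d)"
  by (simp add: metab_kernel_def)

lemma bracket_in_metab_kernel:
  "u \<in> lie_component i \<Longrightarrow> v \<in> lie_component j \<Longrightarrow> 2 \<le> i \<Longrightarrow> 2 \<le> j \<Longrightarrow> i + j = d \<Longrightarrow>
    lie_bracket u v \<in> metab_kernel d"
  unfolding metab_kernel_def by (rule additive_span.base) blast

lemma metab_kernel_minimal:
  assumes "add_closed S"
    "\<And>u v i j. u \<in> lie_component i \<Longrightarrow> v \<in> lie_component j \<Longrightarrow> 2 \<le> i \<Longrightarrow> 2 \<le> j \<Longrightarrow> i + j = d \<Longrightarrow>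
      lie_bracket u v \<in> S"
  shows "metab_kernel d \<subseteq> S"
  unfolding metab_kernel_def by (rule additive_span_minimal) (use assms in auto)

lemma metab_kernel_subset_component: "metab_kernel d \<subseteq> lie_component d"
  by (rule metab_kernel_minimal) (auto intro: lie_component_bracket)

lemma metab_kernel_bracket_gen:
  assumes "v \<in> metab_kernel d"
  shows "lie_bracket v (lie_gen a) \<in> metab_kernel (Suc d)"
proof -
  have "metab_kernel d \<subseteq> {v. lie_bracket v (lie_gen a) \<in> metab_kernel (Suc d)}"
  proof (rule metab_kernel_minimal)
    show "add_closed {v. lie_bracket v (lie_gen a) \<in> metab_kernel (Suc d)}"
      by (rule add_closed_vimage[OF additive_bracket_left]) simp
  next
    fix u v :: "'a free_lie" and i j
    assume *: "u \<in> lie_component i" "v \<in> lie_component j" "2 \<le> i" "2 \<le> j" "i + j = d"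
    have "lie_bracket (lie_bracket u (lie_gen a)) v \<in> metab_kernel (Suc d)"
      by (rule bracket_in_metab_kernel[of _ "Suc i" _ j]) (use * lie_component_bracket_gen in auto)
    moreover have "lie_bracket u (lie_bracket v (lie_gen a)) \<in> metab_kernel (Suc d)"
      by (rule bracket_in_metab_kernel[of _ i _ "Suc j"]) (use * lie_component_bracket_gen in auto)
    ultimately show "lie_bracket u v \<in> {v. lie_bracket v (lie_gen a) \<in> metab_kernel (Suc d)}"
      by (simp add: lie_bracket_bracket_left[of u v] add_closed_add)
  qed
  then show ?thesis using assms by blast
qed

lemma metab_kernel_foldl:
  "v \<in> metab_kernel d \<Longrightarrow> foldl lie_bracket v (map lie_gen as) \<in> metab_kernel (d + length as)"
proof (induction as arbitrary: v d)
  case (Cons a as)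
  then show ?case using metab_kernel_bracket_gen[of v d a] Cons.IH[of _ "Suc d"] by auto
qed simp

lemma additive_foldl_bracket: "additive (\<lambda>v. foldl lie_bracket v (ws :: 'a::lie_ring list))"
proof (induction ws)
  case (Cons w ws)
  from additive_compose[OF this additive_bracket_left] show ?case by simp
qed (simp add: additive_def)

lemma foldl_bracket_move_front:
  assumes "v \<in> lie_component d" "2 \<le> d"
  shows "foldl lie_bracket v (map lie_gen (cs @ c # es)) -
         foldl lie_bracket v (map lie_gen (c # cs @ es)) \<in> metab_kernel (Suc (d + length cs + length es))"
  using assms
proof (induction cs arbitrary: v d)
  case (Cons b cs)
  let ?w = "foldl lie_bracket v (map lie_gen (b # c # cs @ es))"
  have "foldl lie_bracket v (map lie_gen ((b # cs) @ c # es)) - ?w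
      \<in> metab_kernel (Suc (d + length (b # cs) + length es))"
    using Cons.IH[of "lie_bracket v (lie_gen b)" "Suc d"] Cons.prems
    by (simp add: lie_component_bracket_gen)
  moreover have "?w - foldl lie_bracket v (map lie_gen (c # (b # cs) @ es))
      \<in> metab_kernel (Suc (d + length (b # cs) + length es))"
  proof -
    have "lie_bracket v (lie_bracket (lie_gen b) (lie_gen c)) \<in> metab_kernel (d + 2)"
      using Cons.prems lie_component_bracket_gen[OF lie_gen_in_lie_component]
      by (intro bracket_in_metab_kernel[where i = d and j = 2]) (auto simp: numeral_2_eq_2)
    from metab_kernel_foldl[OF this, of "cs @ es"] show ?thesis
      by (simp add: lie_bracket_bracket_right additive.diff[OF additive_foldl_bracket] add.assoc)
  qed
  ultimately show ?case by (rule add_closed_trans[rotated]) simp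
qed (simp add: add_closed_zero)

text \<open>Exchanging two neighbouring elements changes a product that begins with a commutator by the
  bracket of this commutator with that of the two elements.\<close>

lemma foldl_bracket_permute:
  assumes "v \<in> lie_component d" "2 \<le> d" "mset cs = mset cs'"
  shows "foldl lie_bracket v (map lie_gen cs) - foldl lie_bracket v (map lie_gen cs')
          \<in> metab_kernel (d + length cs)"
  using assms
proof (induction cs arbitrary: cs' v d)
  case Nil
  then show ?case by (simp add: add_closed_zero)
next
  case (Cons c cs)
  then have "c \<in> set cs'" by (metis list.set_intros(1) set_mset_mset)
  then obtain ds es where cs': "cs' = ds @ c # es" by (auto simp: in_set_conv_decomp)
  then have m: "mset cs = mset (ds @ es)" using Cons.prems by simp
  then have len: "length cs = length ds + length es" by (metis length_append mset_eq_length)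
  have "foldl lie_bracket v (map lie_gen (c # cs)) - foldl lie_bracket v (map lie_gen (c # ds @ es))
      \<in> metab_kernel (d + length (c # cs))"
    using Cons.IH[OF lie_component_bracket_gen[OF Cons.prems(1), of c] _ m] Cons.prems by simp
  moreover have "foldl lie_bracket v (map lie_gen (c # ds @ es)) - foldl lie_bracket v (map lie_gen cs')
      \<in> metab_kernel (d + length (c # cs))"
    using foldl_bracket_move_front[OF Cons.prems(1,2), of ds c es] len cs'
    by (subst add_closed_minus_commute) (auto simp: add.assoc)
  ultimately show ?case by (rule add_closed_trans[rotated]) simp
qed

lemma span_Union_eq_sum:
  assumes S: "\<And>d :: nat. add_closed (S d)" and v: "v \<in> additive_span (\<Union>d. S d)"
  shows "\<exists>N k. (\<forall>d. k d \<in> S d) \<and> v = (\<Sum>d<N. k d)"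
  using v
proof induction
  case zero
  show ?case by (rule exI[of _ 0], rule exI[of _ "\<lambda>_. 0"]) (simp add: add_closed_zero[OF S])
next
  case (base v)
  then obtain d where "v \<in> S d" by blast
  then show ?case
    by (intro exI[of _ "Suc d"] exI[of _ "\<lambda>e. if e = d then v else 0"])
      (simp add: add_closed_zero[OF S])
next
  case (add v w)
  then obtain N k N' k' where *: "\<forall>d. k d \<in> S d" "v = (\<Sum>d<N. k d)" "\<forall>d. k' d \<in> S d" "w = (\<Sum>d<N'. k' d)"
    by blast
  define l l' where "l d = (if d < N then k d else 0)" and "l' d = (if d < N' then k' d else 0)" for d
  have "v = (\<Sum>d<max N N'. l d)" "w = (\<Sum>d<max N N'. l' d)"
    unfolding * l_def l'_def by (auto intro!: sum.mono_neutral_cong_left split: if_splits)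
  then have "v + w = (\<Sum>d<max N N'. l d + l' d)" by (simp add: sum.distrib)
  moreover have "\<forall>d. l d + l' d \<in> S d"
    using * by (simp add: l_def l'_def add_closed_add[OF S] add_closed_zero[OF S])
  ultimately show ?case by (intro exI[of _ "max N N'"] exI[of _ "\<lambda>d. l d + l' d"]) simp
next
  case (neg v)
  then obtain N k where *: "\<forall>d. k d \<in> S d" "v = (\<Sum>d<N. k d)" by blast
  then show ?case
    by (intro exI[of _ N] exI[of _ "\<lambda>d. - k d"]) (simp add: sum_negf add_closed_uminus[OF S])
qed

lemma free_lie_span_components: "v \<in> additive_span (\<Union>d. lie_component (Suc d))"
proof (induction v rule: free_lie_induct)
  case (gen a)
  show ?case using lie_gen_in_lie_component[of a] by (intro additive_span.base) blast
next
  case (bracket v w)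
  have "lie_bracket s t \<in> additive_span (\<Union>d. lie_component (Suc d))"
    if st: "s \<in> (\<Union>d. lie_component (Suc d))" "t \<in> (\<Union>d. lie_component (Suc d))" for s t :: "'a free_lie"
  proof -
    obtain i j where "s \<in> lie_component (Suc i)" "t \<in> lie_component (Suc j)" using st by blast
    from lie_component_bracket[OF this] show ?thesis
      by (intro additive_span.base) (auto intro!: exI[of _ "Suc (i + j)"])
  qed
  from lie_bracket_span[OF add_closed_span this bracket.IH] show ?case .
qed (auto intro: additive_span.intros)

lemma derived_span_components:
  "bracket_span UNIV UNIV \<subseteq> additive_span (\<Union>d. lie_component (Suc (Suc d)))"
  unfolding bracket_span_def
proof (rule additive_span_minimal, clarify)
  fix v w :: "'a free_lie"
  have "lie_bracket s t \<in> additive_span (\<Union>d. lie_component (Suc (Suc d)))"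
    if st: "s \<in> (\<Union>d. lie_component (Suc d))" "t \<in> (\<Union>d. lie_component (Suc d))" for s t :: "'a free_lie"
  proof -
    obtain i j where "s \<in> lie_component (Suc i)" "t \<in> lie_component (Suc j)" using st by blast
    from lie_component_bracket[OF this] show ?thesis
      by (intro additive_span.base) (auto intro!: exI[of _ "i + j"])
  qed
  from lie_bracket_span[OF add_closed_span this free_lie_span_components free_lie_span_components]
  show "lie_bracket v w \<in> additive_span (\<Union>d. lie_component (Suc (Suc d)))" .
qed simp

lemma component_in_derived:
  fixes u :: "'a::ab_group_add free_lie"
  assumes "u \<in> lie_component c" "2 \<le> c" shows "u \<in> bracket_span UNIV UNIV"
proof -
  have "lie_component c \<subseteq> (bracket_span UNIV UNIV :: 'a free_lie set)"
  proof (rule lie_component_minimal)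
    fix as :: "'a list" assume "length as = c"
    then have as: "as = butlast as @ [last as]" "butlast as \<noteq> []"
      using \<open>2 \<le> c\<close> by (auto simp flip: length_greater_0_conv simp del: length_greater_0_conv)
    then have "left_normed as = lie_bracket (left_normed (butlast as)) (lie_gen (last as))"
      by (metis left_normed_snoc)
    then show "left_normed as \<in> bracket_span UNIV UNIV"
      unfolding bracket_span_def by (intro additive_span.base) blast
  qed (simp add: bracket_span_def)
  then show ?thesis using assms by blast
qed

lemma metab_kernel_subset_second_derived: "metab_kernel d \<subseteq> second_derived"
proof (rule metab_kernel_minimal)
  show "add_closed (second_derived :: 'a free_lie set)" by (simp add: second_derived_def bracket_span_def)
  fix u v :: "'a free_lie" and i j
  assume "u \<in> lie_component i" "v \<in> lie_component j" "2 \<le> i" "2 \<le> j"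
  then have "u \<in> bracket_span UNIV UNIV" "v \<in> bracket_span UNIV UNIV" by (auto intro: component_in_derived)
  then show "lie_bracket u v \<in> second_derived"
    unfolding second_derived_def bracket_span_def[of "bracket_span UNIV UNIV"]
    by (intro additive_span.base) blast
qed

lemma second_derived_eq_sum:
  fixes v :: "'a::ab_group_add free_lie"
  assumes "v \<in> second_derived"
  shows "\<exists>N k. (\<forall>d. k d \<in> metab_kernel d) \<and> v = (\<Sum>d<N. k d)"
proof (rule span_Union_eq_sum)
  have "lie_bracket s t \<in> additive_span (\<Union>d. metab_kernel d)"
    if "s \<in> (\<Union>d. lie_component (Suc (Suc d)))" "t \<in> (\<Union>d. lie_component (Suc (Suc d)))"
    for s t :: "'a free_lie"
  proof -
    obtain i j where "s \<in> lie_component (Suc (Suc i))" "t \<in> lie_component (Suc (Suc j))"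
      using \<open>s \<in> _\<close> \<open>t \<in> _\<close> by blast
    then have "lie_bracket s t \<in> metab_kernel (Suc (Suc i) + Suc (Suc j))"
      by (rule bracket_in_metab_kernel) simp_all
    then show ?thesis by (intro additive_span.base) blast
  qed
  note * = lie_bracket_span[OF add_closed_span this]
  have "second_derived \<subseteq> additive_span (\<Union>d. metab_kernel d :: 'a free_lie set)"
    unfolding second_derived_def bracket_span_def[of "bracket_span UNIV UNIV"]
  proof (rule additive_span_minimal)
    show "{lie_bracket v w |v w. v \<in> bracket_span UNIV UNIV \<and> w \<in> bracket_span UNIV UNIV}
        \<subseteq> additive_span (\<Union>d. metab_kernel d :: 'a free_lie set)"
      by (clarify, intro *) (use derived_span_components in blast)+
  qed simp
  then show "v \<in> additive_span (\<Union>d. metab_kernel d)" using assms by blast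
qed simp

section \<open>Symmetrised brackets and divisibility of theta\<close>

definition sym_ad :: "('i \<Rightarrow> 'v::lie_ring) \<Rightarrow> 'i set \<Rightarrow> 'v \<Rightarrow> 'v" where
  "sym_ad a I v = (\<Sum>is\<in>permutations_of_set I. foldl lie_bracket v (map a is))"

lemma sym_ad_empty [simp]: "sym_ad a {} v = v"
  by (simp add: sym_ad_def)

lemma sym_ad_rec:
  assumes "finite I" "I \<noteq> {}"
  shows "sym_ad a I v = (\<Sum>i\<in>I. sym_ad a (I - {i}) (lie_bracket v (a i)))"
proof -
  have "sym_ad a I v =
      (\<Sum>i\<in>I. \<Sum>is\<in>(#) i ` permutations_of_set (I - {i}). foldl lie_bracket v (map a is))"
    unfolding sym_ad_def permutations_of_set_nonempty[OF assms(2)]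
    by (rule sum.UNION_disjoint) (use assms in auto)
  also have "\<dots> = (\<Sum>i\<in>I. sym_ad a (I - {i}) (lie_bracket v (a i)))"
    unfolding sym_ad_def by (rule sum.cong[OF HOL.refl], subst sum.reindex) (auto simp: inj_on_def)
  finally show ?thesis .
qed

lemma additive_sym_ad: "additive (sym_ad a I)"
proof -
  have "additive (\<lambda>v. sym_ad a I v)"
    unfolding sym_ad_def by (intro additive_sum_fun additive_foldl_bracket)
  then show ?thesis .
qed

lemma sym_ad_cong: "(\<And>i. i \<in> I \<Longrightarrow> a i = b i) \<Longrightarrow> sym_ad a I v = sym_ad b I v"
  unfolding sym_ad_def
  by (intro sum.cong HOL.refl arg_cong[where f = "foldl lie_bracket v"])
    (auto simp: permutations_of_set_def)

lemma sym_ad_reindex: "inj_on f I \<Longrightarrow> sym_ad a (f ` I) v = sym_ad (\<lambda>i. a (f i)) I v"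
proof -
  assume f: "inj_on f I"
  have "inj_on (map f) (permutations_of_set I)"
    using f by (auto simp: inj_on_def permutations_of_set_def map_eq_imp_length_eq
        intro: map_inj_on[of f])
  then show ?thesis
    unfolding sym_ad_def permutations_of_set_image_inj[OF f]
    by (subst sum.reindex) (auto simp: o_def)
qed

lemma sym_ad_lie_component:
  "v \<in> lie_component d \<Longrightarrow> sym_ad (\<lambda>i. lie_gen (a i)) I v \<in> lie_component (d + card I)"
  unfolding sym_ad_def
proof (rule add_closed_sum)
  fix "is" assume v: "v \<in> lie_component d" and "is": "is \<in> permutations_of_set I"
  show "foldl lie_bracket v (map (\<lambda>i. lie_gen (a i)) is) \<in> lie_component (d + card I)"
    using lie_component_foldl[OF v, of "map a is"] length_finite_permutations_of_set[OF "is"]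
    by (simp add: o_def)
qed simp

lemma sym_ad_derivation:
  assumes "additive \<delta>" "\<And>u v. \<delta> (lie_bracket u v) = lie_bracket (\<delta> u) v + lie_bracket u (\<delta> v)" "finite I"
  shows "\<delta> (sym_ad a I v) = sym_ad a I (\<delta> v) + (\<Sum>k\<in>I. sym_ad (a(k := \<delta> (a k))) I v)"
  using assms(3)
proof (induction "card I" arbitrary: I v)
  case 0
  then show ?case by simp
next
  case (Suc n)
  then have "I \<noteq> {}" by auto
  note rec = sym_ad_rec[OF Suc.prems this]
  let ?a = "\<lambda>k. a(k := \<delta> (a k))"
  have IH: "\<delta> (sym_ad a (I - {i}) w) =
      sym_ad a (I - {i}) (\<delta> w) + (\<Sum>k\<in>I - {i}. sym_ad (?a k) (I - {i}) w)" if "i \<in> I" for i w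
    using Suc.hyps(1)[of "I - {i}" w] Suc.hyps(2) Suc.prems that by simp
  have "\<delta> (sym_ad a I v) = (\<Sum>i\<in>I. sym_ad a (I - {i}) (lie_bracket (\<delta> v) (a i))
      + (sym_ad a (I - {i}) (lie_bracket v (\<delta> (a i)))
         + (\<Sum>k\<in>I - {i}. sym_ad (?a k) (I - {i}) (lie_bracket v (a i)))))"
    unfolding rec additive.sum[OF assms(1)]
    by (rule sum.cong) (simp_all add: IH assms(2) additive.add[OF additive_sym_ad] add.assoc)
  also have "\<dots> = sym_ad a I (\<delta> v) + (\<Sum>i\<in>I. sym_ad a (I - {i}) (lie_bracket v (\<delta> (a i)))
         + (\<Sum>k\<in>I - {i}. sym_ad (?a k) (I - {i}) (lie_bracket v (a i))))"
    by (simp only: rec sum.distrib)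
  also have "(\<Sum>i\<in>I. sym_ad a (I - {i}) (lie_bracket v (\<delta> (a i)))
         + (\<Sum>k\<in>I - {i}. sym_ad (?a k) (I - {i}) (lie_bracket v (a i)))) =
      (\<Sum>i\<in>I. \<Sum>k\<in>I. sym_ad (?a k) (I - {i}) (lie_bracket v (?a k i)))"
  proof (rule sum.cong[OF HOL.refl])
    fix i assume "i \<in> I"
    have "(\<Sum>k\<in>I. sym_ad (?a k) (I - {i}) (lie_bracket v (?a k i))) =
        sym_ad (?a i) (I - {i}) (lie_bracket v (?a i i)) +
        (\<Sum>k\<in>I - {i}. sym_ad (?a k) (I - {i}) (lie_bracket v (?a k i)))"
      by (rule sum.remove) (use Suc.prems \<open>i \<in> I\<close> in auto)
    also have "sym_ad (?a i) (I - {i}) = sym_ad a (I - {i})"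
      by (intro ext sym_ad_cong) auto
    also have "(\<Sum>k\<in>I - {i}. sym_ad (?a k) (I - {i}) (lie_bracket v (?a k i))) =
        (\<Sum>k\<in>I - {i}. sym_ad (?a k) (I - {i}) (lie_bracket v (a i)))"
      by (intro sum.cong) auto
    finally show "sym_ad a (I - {i}) (lie_bracket v (\<delta> (a i)))
         + (\<Sum>k\<in>I - {i}. sym_ad (?a k) (I - {i}) (lie_bracket v (a i))) =
        (\<Sum>k\<in>I. sym_ad (?a k) (I - {i}) (lie_bracket v (?a k i)))"
      unfolding fun_upd_same by (rule HOL.sym)
  qed
  also have "\<dots> = (\<Sum>k\<in>I. sym_ad (?a k) I v)"
    by (subst sum.swap) (simp only: rec)
  finally show ?case .
qed

lemma additive_sym_ad_arg:
  assumes "finite I" "k \<in> I"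
  shows "additive (\<lambda>x. sym_ad (a(k := x)) I v)"
  using assms
proof (induction "card I" arbitrary: I v)
  case (Suc n)
  then have "I \<noteq> {}" by auto
  show ?case unfolding sym_ad_rec[OF Suc.prems(1) \<open>I \<noteq> {}\<close>]
  proof (rule additive_sum_fun)
    fix i assume "i \<in> I"
    show "additive (\<lambda>x. sym_ad (a(k := x)) (I - {i}) (lie_bracket v ((a(k := x)) i)))"
    proof (cases "i = k")
      case True
      have "sym_ad (a(k := x)) (I - {i}) = sym_ad a (I - {i})" for x
        by (intro ext sym_ad_cong) (auto simp: True)
      then show ?thesis
        using additive_compose[OF additive_sym_ad additive_bracket_right] by (simp add: True)
    next
      case False
      then show ?thesis
        using Suc.hyps(1)[of "I - {i}"] Suc.hyps(2) Suc.prems \<open>i \<in> I\<close> by simp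
    qed
  qed
qed simp

lemma sum_subsets_insert:
  assumes "finite I"
  shows "(\<Sum>i\<in>I. \<Sum>S\<in>Pow (I - {i}). F i S) = (\<Sum>S\<in>Pow I. \<Sum>i\<in>S. F i (S - {i}))"
proof -
  have "(\<Sum>i\<in>I. \<Sum>S\<in>Pow (I - {i}). F i S) = (\<Sum>(i, S)\<in>Sigma I (\<lambda>i. Pow (I - {i})). F i S)"
    using assms by (intro sum.Sigma) auto
  also have "\<dots> = (\<Sum>(S, i)\<in>Sigma (Pow I) (\<lambda>S. S). F i (S - {i}))"
  proof -
    have "S - {i} = S" if "S \<subseteq> I - {i}" for i S using that by auto
    then show ?thesis
      by (intro sum.reindex_bij_witness[of _ "\<lambda>(S, i). (i, S - {i})" "\<lambda>(i, S). (insert i S, i)"]) auto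
  qed
  also have "\<dots> = (\<Sum>S\<in>Pow I. \<Sum>i\<in>S. F i (S - {i}))"
    using assms finite_subset by (intro sum.Sigma[symmetric]) auto
  finally show ?thesis .
qed

lemma sum_subsets_swap:
  assumes "finite I"
  shows "(\<Sum>i\<in>I. \<Sum>S\<in>Pow (I - {i}). F i S) = (\<Sum>S\<in>Pow I. \<Sum>i\<in>I - S. F i S)"
proof -
  have "(\<Sum>i\<in>I. \<Sum>S\<in>Pow (I - {i}). F i S) = (\<Sum>(i, S)\<in>Sigma I (\<lambda>i. Pow (I - {i})). F i S)"
    using assms by (intro sum.Sigma) auto
  also have "\<dots> = (\<Sum>(S, i)\<in>Sigma (Pow I) (\<lambda>S. I - S). F i S)"
    by (rule sum.reindex_bij_witness[of _ "\<lambda>(S, i). (i, S)" "\<lambda>(i, S). (S, i)"]) auto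
  also have "\<dots> = (\<Sum>S\<in>Pow I. \<Sum>i\<in>I - S. F i S)"
    using assms by (intro sum.Sigma[symmetric]) auto
  finally show ?thesis .
qed

text \<open>In an induction along the words of a symmetrised product, the first letter \<open>i\<close> is bracketed
  onto one of the two factors. Summing over \<open>i\<close> turns that factor into a symmetrised one again.\<close>

lemma sum_sym_ad_left:
  assumes I: "finite I"
  shows "(\<Sum>i\<in>I. \<Sum>S\<in>Pow (I - {i}). zscale (c (card S))
           (lie_bracket (sym_ad a S (lie_bracket x (a i))) (sym_ad a (I - {i} - S) y))) =
    (\<Sum>S\<in>Pow I. zscale (if S = {} then 0 else c (card S - 1))
           (lie_bracket (sym_ad a S x) (sym_ad a (I - S) y)))"
  unfolding sum_subsets_insert[OF I]
proof (rule sum.cong[OF HOL.refl])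
  fix S assume "S \<in> Pow I"
  then have S: "finite S" "S \<subseteq> I" using I finite_subset by auto
  have *: "zscale (c (card (S - {i}))) (lie_bracket (sym_ad a (S - {i}) (lie_bracket x (a i)))
            (sym_ad a (I - {i} - (S - {i})) y)) =
        zscale (c (card S - 1)) (lie_bracket (sym_ad a (S - {i}) (lie_bracket x (a i))) (sym_ad a (I - S) y))"
    if "i \<in> S" for i
  proof -
    have "I - {i} - (S - {i}) = I - S" "card (S - {i}) = card S - 1" using that S by auto
    then show ?thesis by simp
  qed
  show "(\<Sum>i\<in>S. zscale (c (card (S - {i}))) (lie_bracket (sym_ad a (S - {i}) (lie_bracket x (a i)))
            (sym_ad a (I - {i} - (S - {i})) y))) =
        zscale (if S = {} then 0 else c (card S - 1)) (lie_bracket (sym_ad a S x) (sym_ad a (I - S) y))"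
  proof (cases "S = {}")
    case False
    then have "lie_bracket (sym_ad a S x) (sym_ad a (I - S) y) =
        (\<Sum>i\<in>S. lie_bracket (sym_ad a (S - {i}) (lie_bracket x (a i))) (sym_ad a (I - S) y))"
      by (simp add: sym_ad_rec[OF S(1)] lie_bracket_linear)
    moreover have "(\<Sum>i\<in>S. zscale (c (card (S - {i}))) (lie_bracket (sym_ad a (S - {i}) (lie_bracket x (a i)))
            (sym_ad a (I - {i} - (S - {i})) y))) = (\<Sum>i\<in>S. zscale (c (card S - 1))
            (lie_bracket (sym_ad a (S - {i}) (lie_bracket x (a i))) (sym_ad a (I - S) y)))"
      by (rule sum.cong[OF HOL.refl], rule *)
    ultimately show ?thesis using False by (simp add: zscale.scale_sum_right)
  qed simp
qed

lemma sum_sym_ad_right: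
  assumes I: "finite I"
  shows "(\<Sum>i\<in>I. \<Sum>S\<in>Pow (I - {i}). zscale (c (card S))
           (lie_bracket (sym_ad a S x) (sym_ad a (I - {i} - S) (lie_bracket y (a i))))) =
    (\<Sum>S\<in>Pow I. zscale (if S = I then 0 else c (card S))
           (lie_bracket (sym_ad a S x) (sym_ad a (I - S) y)))"
  unfolding sum_subsets_swap[OF I]
proof (rule sum.cong[OF HOL.refl])
  fix S assume "S \<in> Pow I"
  show "(\<Sum>i\<in>I - S. zscale (c (card S))
           (lie_bracket (sym_ad a S x) (sym_ad a (I - {i} - S) (lie_bracket y (a i))))) =
        zscale (if S = I then 0 else c (card S)) (lie_bracket (sym_ad a S x) (sym_ad a (I - S) y))"
  proof (cases "S = I")
    case False
    then have ne: "I - S \<noteq> {}" using \<open>S \<in> Pow I\<close> by auto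
    have "I - S - {i} = I - {i} - S" for i by auto
    then have "lie_bracket (sym_ad a S x) (sym_ad a (I - S) y) =
        (\<Sum>i\<in>I - S. lie_bracket (sym_ad a S x) (sym_ad a (I - {i} - S) (lie_bracket y (a i))))"
      using I by (simp add: sym_ad_rec[OF _ ne] lie_bracket_linear)
    then show ?thesis using False by (simp add: zscale.scale_sum_right)
  qed simp
qed

text \<open>Each word distributes its letters over the two factors. A given pair of orderings of the two
  parts arises from as many words as it has shuffles, whence the binomial coefficient.\<close>

lemma sym_ad_bracket:
  assumes "finite I"
  shows "sym_ad a I (lie_bracket x y) = (\<Sum>S\<in>Pow I. zscale (int (card I choose card S))
           (lie_bracket (sym_ad a S x) (sym_ad a (I - S) y)))"
  using assms
proof (induction "card I" arbitrary: I x y)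
  case 0
  then show ?case by simp
next
  case (Suc n)
  then have ne: "I \<noteq> {}" by auto
  let ?P = "\<lambda>I S x y. lie_bracket (sym_ad a S x) (sym_ad a (I - S) y)"
  have "sym_ad a I (lie_bracket x y) =
      (\<Sum>i\<in>I. sym_ad a (I - {i}) (lie_bracket (lie_bracket x (a i)) y) +
             sym_ad a (I - {i}) (lie_bracket x (lie_bracket y (a i))))"
    unfolding sym_ad_rec[OF Suc.prems ne]
    by (simp add: lie_bracket_bracket_left[of x y] additive.add[OF additive_sym_ad])
  also have "\<dots> = (\<Sum>i\<in>I. (\<Sum>S\<in>Pow (I - {i}). zscale (int (n choose card S)) (?P (I - {i}) S (lie_bracket x (a i)) y)) +
            (\<Sum>S\<in>Pow (I - {i}). zscale (int (n choose card S)) (?P (I - {i}) S x (lie_bracket y (a i)))))"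
  proof (rule sum.cong[OF HOL.refl])
    fix i assume "i \<in> I"
    then have "n = card (I - {i})" using Suc.hyps(2) Suc.prems by simp
    from Suc.hyps(1)[OF this] this Suc.prems
    show "sym_ad a (I - {i}) (lie_bracket (lie_bracket x (a i)) y) +
             sym_ad a (I - {i}) (lie_bracket x (lie_bracket y (a i))) =
          (\<Sum>S\<in>Pow (I - {i}). zscale (int (n choose card S)) (?P (I - {i}) S (lie_bracket x (a i)) y)) +
          (\<Sum>S\<in>Pow (I - {i}). zscale (int (n choose card S)) (?P (I - {i}) S x (lie_bracket y (a i))))"
      by simp
  qed
  also have "\<dots> = (\<Sum>S\<in>Pow I. zscale (if S = {} then 0 else int (n choose (card S - 1))) (?P I S x y)) +
      (\<Sum>S\<in>Pow I. zscale (if S = I then 0 else int (n choose card S)) (?P I S x y))"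
    unfolding sum.distrib
    using sum_sym_ad_left[OF Suc.prems, where c = "\<lambda>k. int (n choose k)"]
      sum_sym_ad_right[OF Suc.prems, where c = "\<lambda>k. int (n choose k)"] by (rule arg_cong2[where f = "(+)"])
  also have "\<dots> = (\<Sum>S\<in>Pow I. zscale (int (card I choose card S)) (?P I S x y))"
    unfolding sum.distrib[symmetric]
  proof (rule sum.cong[OF HOL.refl])
    fix S assume "S \<in> Pow I"
    then have S: "finite S" "card S \<le> card I" "card S = card I \<longleftrightarrow> S = I"
      using Suc.prems finite_subset[of S I] card_mono[of I S] card_subset_eq[of I S] by auto
    have "(if S = {} then 0 else int (n choose (card S - 1))) + (if S = I then 0 else int (n choose card S))
        = int (card I choose card S)"
    proof (cases "card S")
      case 0
      then show ?thesis using S ne by simp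
    next
      case (Suc k)
      then have "S \<noteq> {}" by auto
      moreover have "S = I \<Longrightarrow> n choose card S = 0"
        using \<open>Suc n = card I\<close> by (intro binomial_eq_0) simp
      moreover have "card I choose card S = (n choose k) + (n choose card S)"
        unfolding Suc \<open>Suc n = card I\<close>[symmetric] by (rule binomial_Suc_Suc)
      ultimately show ?thesis using Suc by auto
    qed
    then show "zscale (if S = {} then 0 else int (n choose (card S - 1))) (?P I S x y) +
        zscale (if S = I then 0 else int (n choose card S)) (?P I S x y) =
        zscale (int (card I choose card S)) (?P I S x y)"
      by (simp flip: zscale.scale_left_distrib)
  qed
  finally show ?case .
qed

text \<open>Pascal's rule combines the words that begin with \<open>y\<close>, whose remaining letters distribute over a
  bracket with \<open>a y\<close>, with those that begin with another letter.\<close>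

lemma sym_ad_insert:
  assumes "finite I" "y \<notin> I"
  shows "sym_ad a (insert y I) x = (\<Sum>S\<in>Pow I. zscale (int (Suc (card I) choose card S))
           (lie_bracket (sym_ad a S x) (sym_ad a (I - S) (a y))))"
  using assms
proof (induction "card I" arbitrary: I x)
  case 0
  then show ?case by (simp add: sym_ad_rec)
next
  case (Suc n)
  let ?P = "\<lambda>I S x. lie_bracket (sym_ad a S x) (sym_ad a (I - S) (a y))"
  have "insert y I - {i} = insert y (I - {i})" if "i \<in> I" for i using that Suc.prems by auto
  then have "sym_ad a (insert y I) x = sym_ad a I (lie_bracket x (a y)) +
      (\<Sum>i\<in>I. sym_ad a (insert y (I - {i})) (lie_bracket x (a i)))"
    using Suc.prems by (subst sym_ad_rec) auto
  also have "sym_ad a I (lie_bracket x (a y)) =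
      (\<Sum>S\<in>Pow I. zscale (int (card I choose card S)) (?P I S x))"
    by (rule sym_ad_bracket) (rule Suc.prems)
  also have "(\<Sum>i\<in>I. sym_ad a (insert y (I - {i})) (lie_bracket x (a i))) =
      (\<Sum>i\<in>I. \<Sum>S\<in>Pow (I - {i}). zscale (int (card I choose card S)) (?P (I - {i}) S (lie_bracket x (a i))))"
  proof (rule sum.cong[OF HOL.refl])
    fix i assume "i \<in> I"
    then have "n = card (I - {i})" "Suc (card (I - {i})) = card I" using Suc.hyps(2) Suc.prems by simp_all
    then show "sym_ad a (insert y (I - {i})) (lie_bracket x (a i)) =
        (\<Sum>S\<in>Pow (I - {i}). zscale (int (card I choose card S)) (?P (I - {i}) S (lie_bracket x (a i))))"
      using Suc.hyps(1)[of "I - {i}"] Suc.prems by simp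
  qed
  also have "\<dots> = (\<Sum>S\<in>Pow I. zscale (if S = {} then 0 else int (card I choose (card S - 1))) (?P I S x))"
    by (rule sum_sym_ad_left) (rule Suc.prems)
  also have "(\<Sum>S\<in>Pow I. zscale (int (card I choose card S)) (?P I S x)) + \<dots> =
      (\<Sum>S\<in>Pow I. zscale (int (Suc (card I) choose card S)) (?P I S x))"
    unfolding sum.distrib[symmetric]
  proof (rule sum.cong[OF HOL.refl])
    fix S assume "S \<in> Pow I"
    then have S: "finite S" using Suc.prems finite_subset by auto
    have "int (card I choose card S) + (if S = {} then 0 else int (card I choose (card S - 1)))
        = int (Suc (card I) choose card S)"
      using S by (cases "card S") auto
    then show "zscale (int (card I choose card S)) (?P I S x) +
        zscale (if S = {} then 0 else int (card I choose (card S - 1))) (?P I S x) =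
        zscale (int (Suc (card I) choose card S)) (?P I S x)"
      by (simp flip: zscale.scale_left_distrib)
  qed
  finally show ?case .
qed

text \<open>Antisymmetry of the bracket turns the second sum into the first with complementary subsets,
  and Pascal's rule adds the coefficients up. For prime \<open>card I + 2\<close> all of them are divisible
  by that prime.\<close>

lemma sym_ad_antisymmetrised:
  assumes I: "finite I" "x \<notin> I" "y \<notin> I"
  shows "sym_ad a (insert y I) (a x) - sym_ad a (insert x I) (a y) =
    (\<Sum>S\<in>Pow I. zscale (int ((card I + 2) choose (card S + 1)))
       (lie_bracket (sym_ad a S (a x)) (sym_ad a (I - S) (a y))))"
proof -
  let ?P = "\<lambda>S. lie_bracket (sym_ad a S (a x)) (sym_ad a (I - S) (a y))"
  have "(\<Sum>S\<in>Pow I. zscale (int (Suc (card I) choose card S))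
           (lie_bracket (sym_ad a S (a y)) (sym_ad a (I - S) (a x)))) =
        (\<Sum>S\<in>Pow I. zscale (int (Suc (card I) choose card (I - S)))
           (lie_bracket (sym_ad a (I - S) (a y)) (sym_ad a S (a x))))"
    by (rule sum.reindex_bij_witness[of _ "\<lambda>S. I - S" "\<lambda>S. I - S"]) (auto simp: double_diff)
  also have "\<dots> = (\<Sum>S\<in>Pow I. - zscale (int (Suc (card I) choose (card S + 1))) (?P S))"
  proof (rule sum.cong[OF HOL.refl])
    fix S assume "S \<in> Pow I"
    then have S: "finite S" "card S \<le> card I" "card (I - S) = card I - card S"
      using I finite_subset[of S I] card_mono[of I S] card_Diff_subset[of S I] by auto
    have "Suc (card I) choose card (I - S) = Suc (card I) choose (card S + 1)"
      using S by (subst binomial_symmetric) auto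
    moreover have "lie_bracket (sym_ad a (I - S) (a y)) (sym_ad a S (a x)) = - ?P S"
      by (rule lie_bracket_minus_commute)
    ultimately show "zscale (int (Suc (card I) choose card (I - S)))
           (lie_bracket (sym_ad a (I - S) (a y)) (sym_ad a S (a x))) =
        - zscale (int (Suc (card I) choose (card S + 1))) (?P S)"
      by simp
  qed
  finally show ?thesis
    using I by (simp add: sym_ad_insert sum_negf flip: sum.distrib zscale.scale_left_distrib)
qed

lemma sum_permutes_eq_sum_permutations:
  assumes "distinct xs" "set xs = S"
  shows "(\<Sum>\<sigma> | \<sigma> permutes S. f (map \<sigma> xs)) = (\<Sum>ys\<in>permutations_of_set S. f ys)"
proof (rule sum.reindex_bij_betw)
  have fin: "finite S" using assms by auto
  have inj: "inj_on (\<lambda>\<sigma>. map \<sigma> xs) {\<sigma>. \<sigma> permutes S}"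
  proof (rule inj_onI, clarsimp)
    fix \<sigma> \<tau> assume *: "\<sigma> permutes S" "\<tau> permutes S" "\<forall>x\<in>set xs. \<sigma> x = \<tau> x"
    then show "\<sigma> = \<tau>" by (metis assms(2) ext permutes_not_in)
  qed
  have sub: "(\<lambda>\<sigma>. map \<sigma> xs) ` {\<sigma>. \<sigma> permutes S} \<subseteq> permutations_of_set S"
  proof (clarify, rule permutations_of_setI)
    fix \<sigma> assume "\<sigma> permutes S"
    then show "set (map \<sigma> xs) = S" "distinct (map \<sigma> xs)"
      using assms by (simp_all add: permutes_image distinct_map permutes_inj_on)
  qed
  have "card ((\<lambda>\<sigma>. map \<sigma> xs) ` {\<sigma>. \<sigma> permutes S}) = card (permutations_of_set S)"
    using fin by (simp add: card_image[OF inj] card_permutations)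
  then show "bij_betw (\<lambda>\<sigma>. map \<sigma> xs) {\<sigma>. \<sigma> permutes S} (permutations_of_set S)"
    unfolding bij_betw_def using inj card_subset_eq[OF _ sub] by simp
qed

lemma theta_sum_eq_sym_ad:
  assumes "2 \<le> c"
  shows "theta_sum c a = sym_ad (\<lambda>i. lie_gen (a i)) (insert 2 {3..c}) (lie_gen (a 1))
                       - sym_ad (\<lambda>i. lie_gen (a i)) (insert 1 {3..c}) (lie_gen (a 2))"
proof -
  have "left_normed (b # map a is) = foldl lie_bracket (lie_gen b) (map (\<lambda>i. lie_gen (a i)) is)" for b "is"
    by (simp add: left_normed_Cons o_def del: left_normed.simps)
  moreover have "(\<Sum>\<sigma> | \<sigma> permutes {2..c}. left_normed (a 1 # map (\<lambda>i. a (\<sigma> i)) [2..<Suc c])) =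
     (\<Sum>is\<in>permutations_of_set {2..c}. left_normed (a 1 # map a is))"
    using sum_permutes_eq_sum_permutations[of "[2..<Suc c]" "{2..c}" "\<lambda>is. left_normed (a 1 # map a is)"]
    by (simp add: o_def atLeastLessThanSuc_atLeastAtMost del: left_normed.simps upt_Suc)
  moreover have "(\<Sum>\<tau> | \<tau> permutes insert 1 {3..c}. left_normed (a 2 # a (\<tau> 1) # map (\<lambda>i. a (\<tau> i)) [3..<Suc c])) =
     (\<Sum>is\<in>permutations_of_set (insert 1 {3..c}). left_normed (a 2 # map a is))"
    using sum_permutes_eq_sum_permutations[of "1 # [3..<Suc c]" "insert 1 {3..c}" "\<lambda>is. left_normed (a 2 # map a is)"]
    by (simp add: o_def atLeastLessThanSuc_atLeastAtMost del: left_normed.simps upt_Suc)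
  moreover have "{2..c} = insert 2 {3..c}" using assms by auto
  ultimately show ?thesis unfolding theta_sum_def sym_ad_def by simp
qed

section \<open>Coinvariants of a free module tensored with a module\<close>

type_synonym ('x, 'b) letter = "('x \<Rightarrow>\<^sub>0 nat) \<times> 'b"

definition shift :: "'x \<Rightarrow> ('x, 'b) letter \<Rightarrow> ('x, 'b) letter" where
  "shift x l = (fst l + Poly_Mapping.single x 1, snd l)"

text \<open>A letter \<open>(m, b)\<close> stands for the product of the monomial \<open>m\<close> and the basis element \<open>b\<close>,
  and a pair of a letter and an element \<open>w\<close> for their tensor product, on which a variable
  acts as a derivation.\<close>

definition pair_deriv :: "('x \<Rightarrow> 'w \<Rightarrow> 'w \<Rightarrow>\<^sub>0 int) \<Rightarrow> 'x \<Rightarrow> ('x, 'b) letter \<times> 'w \<Rightarrow>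
    ('x, 'b) letter \<times> 'w \<Rightarrow>\<^sub>0 int" where
  "pair_deriv d x p = frag_of (shift x (fst p), snd p) + lin (\<lambda>w. frag_of (fst p, w)) (d x (snd p))"

text \<open>The antipode of the polynomial ring applied to a monomial: each variable acts by the negative
  of its derivation.\<close>

primrec neg_action :: "('x \<Rightarrow> 'w \<Rightarrow> 'w \<Rightarrow>\<^sub>0 int) \<Rightarrow> 'x list \<Rightarrow> ('x \<Rightarrow>\<^sub>0 nat) \<Rightarrow> ('w \<Rightarrow>\<^sub>0 int) \<Rightarrow> 'w \<Rightarrow>\<^sub>0 int" where
  "neg_action d [] m f = f"
| "neg_action d (x # xs) m f =
     neg_action d xs m (((\<lambda>f. - lin (d x) f) ^^ Poly_Mapping.lookup m x) f)"

lemma additive_neg_lin: "additive (\<lambda>f. - lin g f)"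
  by (simp add: additive_def lin_add)

lemma additive_funpow: "additive (h :: 'a::ab_group_add \<Rightarrow> 'a) \<Longrightarrow> additive (h ^^ n)"
  by (induction n) (simp_all add: additive_def)

lemma additive_neg_action: "additive (neg_action d xs m)"
proof (induction xs)
  case (Cons x xs)
  have "additive (\<lambda>f. neg_action d xs m (((\<lambda>f. - lin (d x) f) ^^ Poly_Mapping.lookup m x) f))"
    by (rule additive_compose[OF Cons additive_funpow[OF additive_neg_lin]])
  then show ?case by (simp add: additive_def)
qed (simp add: additive_def)

lemma neg_action_add_single:
  assumes comm: "\<And>y z f. y \<in> X \<Longrightarrow> z \<in> X \<Longrightarrow> lin (d y) (lin (d z) f) = lin (d z) (lin (d y) f)"
    and "x \<in> set xs" "distinct xs" "set xs \<subseteq> X"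
  shows "neg_action d xs (m + Poly_Mapping.single x 1) f = neg_action d xs m (- lin (d x) f)"
  using assms(2-)
proof (induction xs arbitrary: f)
  case (Cons y ys)
  let ?E = "\<lambda>x f. - lin (d x) f"
  show ?case
  proof (cases "y = x")
    case True
    have "neg_action d zs (m + Poly_Mapping.single x 1) g = neg_action d zs m g" if "x \<notin> set zs" for zs g
      using that by (induction zs arbitrary: g) (auto simp: lookup_add lookup_single)
    then show ?thesis
      using Cons.prems True by (simp add: lookup_add lookup_single funpow_swap1[of "?E x"])
  next
    case False
    have E: "?E x (?E y g) = ?E y (?E x g)" for g
      using Cons.prems comm[of x y g] by (auto simp: lin_uminus)
    have "?E x ((?E y ^^ n) f) = (?E y ^^ n) (?E x f)" for n
    proof (induction n)
      case (Suc n)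
      then show ?case using E[of "(?E y ^^ n) f"] by simp
    qed simp
    then show ?thesis
      using Cons False by (simp add: lookup_add lookup_single)
  qed
qed simp

lemma neg_action_trivial:
  "(\<And>x. x \<in> set xs \<Longrightarrow> Poly_Mapping.lookup m x = 0) \<Longrightarrow> neg_action d xs m f = f"
  by (induction xs) auto

text \<open>Monomials may involve variables outside \<open>X\<close>; these stay with the letter in the normal form
  below.\<close>

definition drop_vars :: "'x set \<Rightarrow> ('x \<Rightarrow>\<^sub>0 nat) \<Rightarrow> 'x \<Rightarrow>\<^sub>0 nat" where
  "drop_vars X m = Poly_Mapping.mapp (\<lambda>x n. if x \<in> X then 0 else n) m"

lemma lookup_drop_vars:
  "Poly_Mapping.lookup (drop_vars X m) x = (if x \<in> X then 0 else Poly_Mapping.lookup m x)"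
  by (simp add: drop_vars_def lookup_mapp when_def in_keys_iff)

definition pair_coinv :: "('x \<Rightarrow> 'w \<Rightarrow> 'w \<Rightarrow>\<^sub>0 int) \<Rightarrow> 'x set \<Rightarrow> (('x, 'b) letter \<times> 'w \<Rightarrow>\<^sub>0 int) set" where
  "pair_coinv d X = additive_span {lin (pair_deriv d x) f |x f. x \<in> X}"

text \<open>The tensor product of a free module with a module that is free over \<open>\<int>\<close> is again free, on
  \<open>b \<otimes> w\<close>, where \<open>b\<close> and \<open>w\<close> run through a module basis and a \<open>\<int>\<close>-basis of the factors:
  modulo the image of the variables, a variable can be moved from the left to the right factor at
  the cost of a sign. The normal form \<open>b \<otimes> w\<close> is \<open>\<kappa>\<close> below, and since it takes values in
  a free abelian group, the coinvariants are torsion free.\<close>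

theorem coinvariants_torsion_free:
  fixes d :: "'x \<Rightarrow> 'w \<Rightarrow> 'w \<Rightarrow>\<^sub>0 int" and f :: "('x, 'b) letter \<times> 'w \<Rightarrow>\<^sub>0 int"
  assumes X: "finite X"
    and comm: "\<And>y z f. y \<in> X \<Longrightarrow> z \<in> X \<Longrightarrow> lin (d y) (lin (d z) f) = lin (d z) (lin (d y) f)"
    and n: "n \<noteq> 0" and f: "zscale n f \<in> pair_coinv d X"
  shows "f \<in> pair_coinv d X"
proof -
  obtain xs where xs: "set xs = X" "distinct xs" using finite_distinct_list[OF X] by blast
  define \<iota> :: "('x, 'b) letter \<Rightarrow> ('w \<Rightarrow>\<^sub>0 int) \<Rightarrow> _" where "\<iota> l = lin (\<lambda>w. frag_of (l, w))" for l
  have \<iota>_additive: "additive (\<iota> l)" for l unfolding \<iota>_def by (rule additive_lin)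
  define \<kappa> where "\<kappa> p = \<iota> (drop_vars X (fst (fst p)), snd (fst p))
      (neg_action d xs (fst (fst p)) (frag_of (snd p)))" for p :: "('x, 'b) letter \<times> 'w"
  have \<kappa>\<iota>: "lin \<kappa> (\<iota> (m, b) g) = \<iota> (drop_vars X m, b) (neg_action d xs m g)" for m b g
  proof (rule additive_frag_eq[where f = g])
    show "additive (\<lambda>g. lin \<kappa> (\<iota> (m, b) g))"
      by (rule additive_compose[OF additive_lin \<iota>_additive])
    show "additive (\<lambda>g. \<iota> (drop_vars X m, b) (neg_action d xs m g))"
      by (rule additive_compose[OF \<iota>_additive additive_neg_action])
  qed (simp add: \<iota>_def \<kappa>_def)
  have step: "neg_action d xs (m + Poly_Mapping.single x 1) g = neg_action d xs m (- lin (d x) g)"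
    "drop_vars X (m + Poly_Mapping.single x 1) = drop_vars X m" if "x \<in> X" for x m g
  proof -
    show "neg_action d xs (m + Poly_Mapping.single x 1) g = neg_action d xs m (- lin (d x) g)"
      by (rule neg_action_add_single[of X]) (use comm xs that in auto)
    show "drop_vars X (m + Poly_Mapping.single x 1) = drop_vars X m"
      using that by (auto simp: poly_mapping_eq_iff fun_eq_iff lookup_drop_vars lookup_add lookup_single when_def)
  qed
  have deriv_\<iota>: "lin (pair_deriv d x) (\<iota> (m, b) g) =
      \<iota> (m + Poly_Mapping.single x 1, b) g + \<iota> (m, b) (lin (d x) g)" for x m b g
  proof (rule additive_frag_eq[where f = g])
    show "additive (\<lambda>g. lin (pair_deriv d x) (\<iota> (m, b) g))"
      by (rule additive_compose[OF additive_lin \<iota>_additive])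
    show "additive (\<lambda>g. \<iota> (m + Poly_Mapping.single x 1, b) g + \<iota> (m, b) (lin (d x) g))"
      by (intro additive_add_fun \<iota>_additive additive_compose[OF \<iota>_additive additive_lin])
  qed (simp add: \<iota>_def pair_deriv_def shift_def)
  have kill: "lin \<kappa> (lin (pair_deriv d x) g) = 0" if "x \<in> X" for x g
  proof (rule additive_frag_eq[where g = "\<lambda>_. 0" and f = g])
    show "additive (\<lambda>g. lin \<kappa> (lin (pair_deriv d x) g))"
      by (rule additive_compose[OF additive_lin additive_lin])
    fix p :: "('x, 'b) letter \<times> 'w"
    obtain m b w where p: "p = ((m, b), w)" by (metis prod.exhaust)
    have "lin (pair_deriv d x) (frag_of p) = lin (pair_deriv d x) (\<iota> (m, b) (frag_of w))"
      by (simp add: p \<iota>_def)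
    also have "lin \<kappa> \<dots> = 0"
      by (simp add: deriv_\<iota> lin_add \<kappa>\<iota> step[OF that] additive.minus[OF additive_neg_action]
          additive.minus[OF \<iota>_additive] del: One_nat_def)
    finally show "lin \<kappa> (lin (pair_deriv d x) (frag_of p)) = 0" .
  qed (simp add: additive_def)
  have closed: "add_closed (pair_coinv d X)" by (simp add: pair_coinv_def)
  have normal: "\<iota> (m, b) g - \<iota> (drop_vars X m, b) (neg_action d xs m g) \<in> pair_coinv d X" for m b g
  proof (induction "\<Sum>x\<in>X. Poly_Mapping.lookup m x" arbitrary: m g)
    case 0
    then have "\<forall>x\<in>X. Poly_Mapping.lookup m x = 0" using X by simp
    then have "drop_vars X m = m" "neg_action d xs m g = g"
      using neg_action_trivial[of xs m d g] xs
      by (auto simp: poly_mapping_eq_iff fun_eq_iff lookup_drop_vars)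
    then show ?case using add_closed_zero[OF closed] by simp
  next
    case (Suc k)
    then obtain x where x: "x \<in> X" "Poly_Mapping.lookup m x \<noteq> 0"
      by (metis sum.neutral nat.distinct(1))
    define m' where "m' = m - Poly_Mapping.single x 1"
    have m: "m = m' + Poly_Mapping.single x 1"
      using x by (auto simp: m'_def poly_mapping_eq_iff fun_eq_iff lookup_add lookup_minus lookup_single when_def)
    have "(\<Sum>y\<in>X. Poly_Mapping.lookup m y) = (\<Sum>y\<in>X. Poly_Mapping.lookup m' y) + 1"
      using X x by (simp add: m lookup_add lookup_single sum.distrib when_def)
    then have "\<iota> (m', b) (- lin (d x) g) - \<iota> (drop_vars X m', b) (neg_action d xs m' (- lin (d x) g))
        \<in> pair_coinv d X"
      using Suc.hyps by (intro Suc.hyps(1)) simp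
    moreover have "\<iota> (m, b) g - \<iota> (m', b) (- lin (d x) g) \<in> pair_coinv d X"
    proof -
      have "lin (pair_deriv d x) (\<iota> (m', b) g) \<in> pair_coinv d X"
        unfolding pair_coinv_def by (rule additive_span.base) (use x in blast)
      then show ?thesis by (simp add: deriv_\<iota> m additive.minus[OF \<iota>_additive])
    qed
    ultimately show ?case
      using add_closed_trans[OF closed] by (simp add: m step[OF x(1)] del: One_nat_def)
  qed
  have "f - lin \<kappa> f \<in> pair_coinv d X"
  proof (rule additive_frag_closed[OF _ closed, where f = f])
    show "additive (\<lambda>f. f - lin \<kappa> f)"
      by (rule additive_diff_fun) (simp_all add: additive_lin, simp add: additive_def)
    fix p :: "('x, 'b) letter \<times> 'w"
    show "frag_of p - lin \<kappa> (frag_of p) \<in> pair_coinv d X"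
      using normal[of "fst (fst p)" "snd (fst p)" "frag_of (snd p)"] by (simp add: \<kappa>_def \<iota>_def)
  qed
  moreover have "lin \<kappa> f = 0"
  proof -
    have "lin \<kappa> (zscale n f) = 0"
      using additive_image_span[OF additive_lin add_closed_singleton_zero _ f[unfolded pair_coinv_def], of \<kappa>]
        kill by blast
    then show ?thesis using n by (simp add: lin_zscale zscale_frag_eq_0_iff)
  qed
  ultimately show ?thesis by simp
qed

primrec word_deriv :: "'x \<Rightarrow> ('x, 'b) letter list \<Rightarrow> ('x, 'b) letter list \<Rightarrow>\<^sub>0 int" where
  "word_deriv x [] = 0"
| "word_deriv x (l # w) = frag_of (shift x l # w) + lin (\<lambda>w'. frag_of (l # w')) (word_deriv x w)"

definition mset_deriv :: "'x \<Rightarrow> ('x, 'b) letter multiset \<Rightarrow> ('x, 'b) letter multiset \<Rightarrow>\<^sub>0 int" where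
  "mset_deriv x M = (\<Sum>l\<in>#M. frag_of (add_mset (shift x l) (M - {#l#})))"

lemma shift_commute: "shift x (shift y l) = shift y (shift x l)"
  by (simp add: shift_def ac_simps)

lemma keys_word_deriv: "v \<in> Poly_Mapping.keys (word_deriv x w) \<Longrightarrow> length v = length w"
proof -
  have closed: "add_closed {f. Poly_Mapping.keys f \<subseteq> S}" for S :: "'k set"
    by (auto simp: add_closed_def dest: subsetD[OF keys_diff])
  have "word_deriv x w \<in> {f. Poly_Mapping.keys f \<subseteq> {v. length v = length w}}"
  proof (induction w)
    case (Cons l w)
    have "lin (\<lambda>w'. frag_of (l # w')) (word_deriv x w) \<in> {f. Poly_Mapping.keys f \<subseteq> {v. length v = length (l # w)}}"
      by (rule lin_closed[OF closed]) (use Cons in \<open>auto simp: keys_frag_of\<close>)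
    then show ?case
      unfolding word_deriv.simps by (intro add_closed_add[OF closed]) (simp_all add: keys_frag_of)
  qed simp
  then show "v \<in> Poly_Mapping.keys (word_deriv x w) \<Longrightarrow> length v = length w" by blast
qed

lemma lin_word_deriv_Cons:
  "lin (word_deriv x) (lin (\<lambda>w. frag_of (l # w)) f) =
    lin (\<lambda>w. frag_of (shift x l # w)) f + lin (\<lambda>w. frag_of (l # w)) (lin (word_deriv x) f)"
  by (simp add: lin_lin lin_fun_add)

lemma word_deriv_commute:
  fixes f :: "('x, 'b) letter list \<Rightarrow>\<^sub>0 int"
  shows "lin (word_deriv x) (lin (word_deriv y) f) = lin (word_deriv y) (lin (word_deriv x) f)"
proof -
  have "lin (word_deriv x) (word_deriv y w) = lin (word_deriv y) (word_deriv x w)"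
    for w :: "('x, 'b) letter list"
  proof (induction w)
    case (Cons l w)
    then show ?case
      by (simp add: lin_add lin_word_deriv_Cons shift_commute[of x y l] algebra_simps)
  qed simp
  then show ?thesis by (simp add: lin_lin)
qed

lemma additive_sum_mset: "additive h \<Longrightarrow> h (\<Sum>k\<in>#N. F k) = (\<Sum>k\<in>#N. h (F k))"
  by (induction N) (simp_all add: additive.add additive.zero)

lemmas lin_sum_mset = additive_sum_mset[OF additive_lin]

lemma mset_deriv_add: "mset_deriv x (add_mset l M) =
    frag_of (add_mset (shift x l) M) + lin (\<lambda>N. frag_of (add_mset l N)) (mset_deriv x M)"
proof -
  have "(\<Sum>k\<in>#M. frag_of (add_mset (shift x k) (add_mset l M - {#k#}))) =
      (\<Sum>k\<in>#M. frag_of (add_mset l (add_mset (shift x k) (M - {#k#}))))"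
    by (intro arg_cong[where f = sum_mset] image_mset_cong) (auto simp: add_mset_commute)
  also have "\<dots> = lin (\<lambda>N. frag_of (add_mset l N)) (mset_deriv x M)"
    by (simp add: mset_deriv_def lin_sum_mset)
  finally show ?thesis by (simp add: mset_deriv_def)
qed

lemma lin_mset_word_deriv: "lin (\<lambda>w'. frag_of (mset w')) (word_deriv x w) = mset_deriv x (mset w)"
proof (induction w)
  case (Cons l w)
  have "lin (\<lambda>w'. frag_of (add_mset l (mset w'))) (word_deriv x w) =
      lin (\<lambda>N. frag_of (add_mset l N)) (lin (\<lambda>w'. frag_of (mset w')) (word_deriv x w))"
    by (simp add: lin_lin)
  then show ?case by (simp add: mset_deriv_add lin_add lin_lin Cons)
qed (simp add: mset_deriv_def)

lemma mset_deriv_commute: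
  fixes f :: "('x, 'b) letter multiset \<Rightarrow>\<^sub>0 int"
  shows "lin (mset_deriv x) (lin (mset_deriv y) f) = lin (mset_deriv y) (lin (mset_deriv x) f)"
proof -
  have *: "lin (mset_deriv x) (lin (\<lambda>w. frag_of (mset w)) g) = lin (\<lambda>w. frag_of (mset w)) (lin (word_deriv x) g)"
    for x and g :: "('x, 'b) letter list \<Rightarrow>\<^sub>0 int"
    by (simp add: lin_lin lin_mset_word_deriv)
  have "lin (mset_deriv x) (mset_deriv y M) = lin (mset_deriv y) (mset_deriv x M)"
    for M :: "('x, 'b) letter multiset"
  proof -
    obtain w where "M = mset w" by (metis ex_mset)
    then show ?thesis
      using word_deriv_commute[of x y "frag_of w"] by (simp add: lin_mset_word_deriv[symmetric] *)
  qed
  then show ?thesis by (simp add: lin_lin)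
qed

section \<open>The tensor ring and operators from it to the free Lie ring\<close>

text \<open>Integer combinations of words multiply by concatenation: the tensor ring of the free abelian
  group on the letters.\<close>

instantiation list :: (type) monoid_add
begin
definition "0 = ([] :: 'a list)"
definition "u + w = u @ (w :: 'a list)"
instance by standard (simp_all add: zero_list_def plus_list_def)
end

instantiation poly_mapping :: (monoid_add, ring_1) lie_ring
begin
definition "lie_bracket f g = f * g - g * (f :: 'a \<Rightarrow>\<^sub>0 'b)"
instance by standard (simp_all add: lie_bracket_poly_mapping_def algebra_simps)
end

lemma frag_of_times_frag_of [simp]: "frag_of u * frag_of w = frag_of (u @ w)"
  by (simp add: mult_single plus_list_def)

lemma frag_of_Nil: "frag_of [] = 1"
  by (metis zero_list_def single_one)

lemma additive_times_right: "additive (\<lambda>f. (g :: 'a::ring) * f)"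
  by (simp add: additive_def distrib_left)

lemma frag_of_single_times: "frag_of [l] * f = lin (\<lambda>w. frag_of (l # w)) f"
  using additive_lin_comp[OF additive_times_right, of "frag_of [l]" frag_of f] by (simp add: lin_self)

lemma additive_frag_eq2:
  fixes F G :: "('k \<Rightarrow>\<^sub>0 int) \<Rightarrow> ('m \<Rightarrow>\<^sub>0 int) \<Rightarrow> 'v::ab_group_add"
  assumes F: "\<And>g. additive (\<lambda>f. F f g)" "\<And>f. additive (F f)"
    and G: "\<And>g. additive (\<lambda>f. G f g)" "\<And>f. additive (G f)"
    and "\<And>k m. k \<in> Poly_Mapping.keys f \<Longrightarrow> m \<in> Poly_Mapping.keys g \<Longrightarrow>
           F (frag_of k) (frag_of m) = G (frag_of k) (frag_of m)"
  shows "F f g = G f g"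
proof (rule additive_frag_eq[where f = f and h = "\<lambda>f. F f g" and g = "\<lambda>f. G f g"])
  fix k assume "k \<in> Poly_Mapping.keys f"
  then show "F (frag_of k) g = G (frag_of k) g"
    by (intro additive_frag_eq[where f = g and h = "F (frag_of k)"] F G assms(5))
qed (rule F G)+

definition words_of_length :: "nat \<Rightarrow> ('l list \<Rightarrow>\<^sub>0 int) set" where
  "words_of_length n = {f. \<forall>w\<in>Poly_Mapping.keys f. length w = n}"

lemma add_closed_words_of_length [simp]: "add_closed (words_of_length n)"
  by (auto simp: add_closed_def words_of_length_def dest: subsetD[OF keys_diff])

lemma frag_of_in_words_of_length [simp]: "frag_of w \<in> words_of_length n \<longleftrightarrow> length w = n"
  by (simp add: words_of_length_def keys_frag_of)

lemma words_of_length_times: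
  "f \<in> words_of_length m \<Longrightarrow> g \<in> words_of_length n \<Longrightarrow> f * g \<in> words_of_length (m + n)"
  using keys_mult[of f g] unfolding words_of_length_def by (fastforce simp: plus_list_def)

lemma lin_words_of_length_cong:
  "f \<in> words_of_length n \<Longrightarrow> (\<And>w. length w = n \<Longrightarrow> g w = h w) \<Longrightarrow> lin g f = lin h f"
  by (rule lin_cong) (auto simp: words_of_length_def)

lemma word_deriv_append:
  "word_deriv x (u @ w) = word_deriv x u * frag_of w + frag_of u * word_deriv x w"
proof (induction u)
  case Nil
  show ?case by (simp add: frag_of_Nil)
next
  case (Cons l u)
  have "frag_of (l # u) * f = frag_of [l] * (frag_of u * f)" for f
    by (simp flip: mult.assoc)
  then show ?case
    using Cons by (simp add: distrib_left distrib_right mult.assoc flip: frag_of_single_times)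
qed

lemma lin_word_deriv_times:
  "lin (word_deriv x) (f * g) = lin (word_deriv x) f * g + f * lin (word_deriv x) g"
  by (rule additive_frag_eq2[of "\<lambda>f g. lin (word_deriv x) (f * g)"
        "\<lambda>f g. lin (word_deriv x) f * g + f * lin (word_deriv x) g"])
    (simp_all add: additive_def distrib_left distrib_right lin_add word_deriv_append)

lemma word_deriv_eq_sum:
  "word_deriv x w = (\<Sum>j<length w. frag_of (w[j := shift x (w ! j)]))"
proof (induction w)
  case (Cons l w)
  then show ?case by (simp add: sum.lessThan_Suc_shift lin_sum del: sum.lessThan_Suc)
qed simp

text \<open>The data that the proof uses of a free module: every element is the value of a formal sum of
  letters, chosen additively and equivariantly. In the intended case \<open>coord\<close> maps to the formal
  sums of products of a monomial in \<open>X\<close> with a basis element, and \<open>e\<close> vanishes on all other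
  letters.\<close>

locale lie_coordinates =
  fixes X :: "'x set" and act :: "'x \<Rightarrow> 'a::ab_group_add \<Rightarrow> 'a"
    and coord :: "'a \<Rightarrow> ('x, 'b) letter \<Rightarrow>\<^sub>0 int" and e :: "('x, 'b) letter \<Rightarrow> 'a"
  assumes finite_X: "finite X"
    and act_additive: "x \<in> X \<Longrightarrow> additive (act x)"
    and coord_additive: "additive coord"
    and e_coord: "lin e (coord a) = a"
    and coord_act: "x \<in> X \<Longrightarrow> coord (act x a) = lin (\<lambda>l. frag_of (shift x l)) (coord a)"
    and e_shift: "x \<in> X \<Longrightarrow> e (shift x l) = act x (e l)"
begin

abbreviation le :: "('x, 'b) letter \<Rightarrow> 'a free_lie" where "le l \<equiv> lie_gen (e l)"

abbreviation gen_word :: "'a \<Rightarrow> ('x, 'b) letter list \<Rightarrow>\<^sub>0 int" where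
  "gen_word a \<equiv> lin (\<lambda>l. frag_of [l]) (coord a)"

definition emb :: "'a free_lie \<Rightarrow> ('x, 'b) letter list \<Rightarrow>\<^sub>0 int" where
  "emb = (THE h. additive h \<and> (\<forall>v w. h (lie_bracket v w) = lie_bracket (h v) (h w)) \<and>
            (\<forall>a. h (lie_gen a) = gen_word a))"

lemma additive_emb: "additive emb"
  and emb_bracket: "emb (lie_bracket v w) = emb v * emb w - emb w * emb v"
  and emb_gen: "emb (lie_gen a) = gen_word a"
proof -
  have "additive gen_word" by (rule additive_compose[OF additive_lin coord_additive])
  from theI'[OF free_lie_universal[OF this]]
  show "additive emb" "emb (lie_bracket v w) = emb v * emb w - emb w * emb v"
    "emb (lie_gen a) = gen_word a"
    unfolding emb_def lie_bracket_poly_mapping_def by auto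
qed

lemma lin_le_coord: "lin le (coord a) = lie_gen a"
proof -
  have "additive (lie_gen :: 'a \<Rightarrow> _)" by (simp add: additive_def lie_gen_add)
  from additive_lin_comp[OF this, of e "coord a"] show ?thesis by (simp add: e_coord)
qed

lemma gen_word_in_words: "gen_word a \<in> words_of_length (Suc 0)"
  by (rule lin_closed) simp_all

lemma emb_in_words: "v \<in> lie_component d \<Longrightarrow> 0 < d \<Longrightarrow> emb v \<in> words_of_length d"
proof -
  assume d: "0 < d" and v: "v \<in> lie_component d"
  have ln: "as \<noteq> [] \<Longrightarrow> emb (left_normed as) \<in> words_of_length (length as)" for as
  proof (induction as rule: rev_induct)
    case (snoc a as)
    show ?case
    proof (cases "as = []")
      case True
      then show ?thesis using gen_word_in_words[of a] by (simp add: emb_gen)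
    next
      case False
      then show ?thesis
        using words_of_length_times[OF snoc.IH gen_word_in_words[of a]]
          words_of_length_times[OF gen_word_in_words[of a] snoc.IH]
        by (simp add: left_normed_snoc emb_bracket emb_gen add_closed_diff)
    qed
  qed simp
  show ?thesis
    by (rule additive_image_span[OF additive_emb _ _ v[unfolded lie_component_def]])
      (use d ln in auto)
qed

lemma additive_lie_deriv: "x \<in> X \<Longrightarrow> additive (lie_deriv (act x))"
  by (simp add: additive_def lie_deriv(2)[OF act_additive])

lemma lie_deriv_bracket: "x \<in> X \<Longrightarrow> lie_deriv (act x) (lie_bracket u v) =
    lie_bracket (lie_deriv (act x) u) v + lie_bracket u (lie_deriv (act x) v)"
  by (simp add: lie_deriv(3)[OF act_additive])

lemma lie_deriv_le: "x \<in> X \<Longrightarrow> lie_deriv (act x) (le l) = le (shift x l)"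
  by (simp add: lie_deriv(1)[OF act_additive] e_shift)

lemma lie_deriv_lie_component:
  "x \<in> X \<Longrightarrow> v \<in> lie_component d \<Longrightarrow> lie_deriv (act x) v \<in> lie_component d"
proof -
  assume x: "x \<in> X" and v: "v \<in> lie_component d"
  have "lie_deriv (act x) (left_normed as) \<in> lie_component (length as)" for as
    unfolding lie_deriv_left_normed[OF act_additive[OF x]]
    by (rule add_closed_sum) (auto intro: left_normed_in_lie_component[of "list_update as _ _", simplified])
  then show ?thesis
    by (intro additive_image_span[OF additive_lie_deriv[OF x] _ _ v[unfolded lie_component_def]]) auto
qed

lemma emb_lie_deriv: "x \<in> X \<Longrightarrow> emb (lie_deriv (act x) v) = lin (word_deriv x) (emb v)"
proof (induction v rule: free_lie_induct)
  case (gen a)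
  then show ?case
    by (simp add: lie_deriv(1)[OF act_additive] emb_gen coord_act lin_lin)
next
  case (bracket v w)
  then show ?case
    by (simp add: lie_deriv_bracket additive.add[OF additive_emb] emb_bracket lin_diff
        lin_word_deriv_times algebra_simps)
qed (simp_all add: additive.add[OF additive_emb] additive.minus[OF additive_emb] lin_add lin_uminus
    additive.add[OF additive_lie_deriv] additive.minus[OF additive_lie_deriv]
    additive.zero[OF additive_emb] additive.zero[OF additive_lie_deriv])

definition ad_word :: "('x, 'b) letter list \<Rightarrow> 'a free_lie \<Rightarrow> 'a free_lie" where
  "ad_word w v = foldr (\<lambda>l. lie_bracket (le l)) w v"

definition ad_words :: "(('x, 'b) letter list \<Rightarrow>\<^sub>0 int) \<Rightarrow> 'a free_lie \<Rightarrow> 'a free_lie" where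
  "ad_words f v = lin (\<lambda>w. ad_word w v) f"

lemma additive_ad_word: "additive (ad_word w)"
proof (induction w)
  case (Cons l w)
  from additive_compose[OF additive_bracket_right this] show ?case by (simp add: ad_word_def)
qed (simp add: ad_word_def additive_def)

lemma additive_ad_words_left: "additive (\<lambda>f. ad_words f v)"
  unfolding ad_words_def by (rule additive_lin)

lemma additive_ad_words: "additive (ad_words f)"
  unfolding ad_words_def additive_def
  by (simp add: additive.add[OF additive_ad_word] lin_fun_add)

lemma ad_words_times: "ad_words (f * g) v = ad_words f (ad_words g v)"
  by (rule additive_frag_eq2[of "\<lambda>f g. ad_words (f * g) v" "\<lambda>f g. ad_words f (ad_words g v)"])
    (simp_all add: additive_def distrib_left distrib_right ad_words_def lin_add ad_word_def
      additive.add[OF additive_ad_word, unfolded ad_word_def] lin_fun_add)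

lemma ad_words_emb: "ad_words (emb u) v = lie_bracket u v"
proof (induction u arbitrary: v rule: free_lie_induct)
  case (gen a)
  have "ad_words (emb (lie_gen a)) v = lin (\<lambda>l. lie_bracket (le l) v) (coord a)"
    by (simp add: emb_gen ad_words_def lin_lin ad_word_def)
  also have "\<dots> = lie_bracket (lin le (coord a)) v"
    by (simp add: additive_lin_comp[OF additive_bracket_left])
  finally show ?case by (simp add: lin_le_coord)
next
  case (bracket u w)
  then show ?case
    by (simp add: emb_bracket additive.diff[OF additive_ad_words_left] ad_words_times
        lie_bracket_bracket_right) (metis add_diff_cancel_right' lie_bracket_bracket_left
        lie_bracket_bracket_right lie_bracket_linear lie_bracket_minus_commute)
qed (simp_all add: additive.zero[OF additive_emb] additive.minus[OF additive_emb]
    additive.add[OF additive_emb] additive.zero[OF additive_ad_words_left]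
    additive.minus[OF additive_ad_words_left] additive.add[OF additive_ad_words_left]
    lie_bracket_linear lie_bracket_add_left)

definition sym_word :: "('x, 'b) letter \<Rightarrow> ('x, 'b) letter list \<Rightarrow> 'a free_lie" where
  "sym_word l w = sym_ad (\<lambda>j. le (w ! j)) {..<length w} (le l)"

text \<open>The operator that symmetrises and brackets the last \<open>i\<close> letters, and brackets the preceding
  ones onto the result from the left. For \<open>i = 1\<close> it is the right-normed bracketing.\<close>

primrec cut :: "nat \<Rightarrow> ('x, 'b) letter list \<Rightarrow> 'a free_lie" where
  "cut i [] = 0"
| "cut i (l # w) = (if Suc (length w) < i then 0 else if Suc (length w) = i then sym_word l w
                    else lie_bracket (le l) (cut i w))"

lemma cut_short: "length w < i \<Longrightarrow> cut i w = 0"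
  by (cases w) auto

lemma cut_append: "i \<le> length w \<Longrightarrow> w \<noteq> [] \<Longrightarrow> cut i (u @ w) = ad_word u (cut i w)"
  by (induction u) (auto simp: ad_word_def)

lemma sym_word_in_lie_component: "sym_word l w \<in> lie_component (Suc (length w))"
  unfolding sym_word_def
  using sym_ad_lie_component[OF lie_gen_in_lie_component[of "e l"], of "\<lambda>j. e (w ! j)" "{..<length w}"]
  by simp

lemma cut_in_lie_component: "cut i w \<in> lie_component (length w)"
proof (induction w)
  case (Cons l w)
  then show ?case
    using sym_word_in_lie_component[of l w] lie_component_bracket[OF lie_gen_in_lie_component[of "e l"]]
    by (auto simp: add_closed_zero)
qed (simp add: add_closed_zero)

lemma lin_cut_in_lie_component: "f \<in> words_of_length d \<Longrightarrow> lin (cut i) f \<in> lie_component d"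
  by (rule lin_closed) (use cut_in_lie_component in \<open>auto simp: words_of_length_def\<close>)

lemma lin_cut_times:
  assumes "g \<in> words_of_length d" "i \<le> d" "0 < d"
  shows "lin (cut i) (f * g) = ad_words f (lin (cut i) g)"
proof (rule additive_frag_eq2[of "\<lambda>f g. lin (cut i) (f * g)" "\<lambda>f g. ad_words f (lin (cut i) g)"])
  fix u w assume "w \<in> Poly_Mapping.keys g"
  then have "i \<le> length w" "w \<noteq> []" using assms by (auto simp: words_of_length_def)
  then show "lin (cut i) (frag_of u * frag_of w) = ad_words (frag_of u) (lin (cut i) (frag_of w))"
    by (simp add: cut_append ad_words_def)
qed (simp_all add: additive_def distrib_left distrib_right lin_add
      additive.add[OF additive_ad_words_left] additive.add[OF additive_ad_words])

lemma sym_word_mset: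
  assumes "mset u = mset w" shows "sym_word l u = sym_word l w"
proof -
  obtain \<pi> where \<pi>: "\<pi> permutes {..<length w}" "permute_list \<pi> w = u"
    using mset_eq_permutation[OF assms] .
  have len: "length u = length w" using assms mset_eq_length by blast
  have "sym_word l w = sym_ad (\<lambda>j. le (w ! j)) (\<pi> ` {..<length w}) (le l)"
    by (simp add: sym_word_def permutes_image[OF \<pi>(1)])
  also have "\<dots> = sym_ad (\<lambda>j. le (w ! \<pi> j)) {..<length w} (le l)"
    by (rule sym_ad_reindex[OF permutes_inj_on[OF \<pi>(1)]])
  also have "\<dots> = sym_word l u"
    unfolding sym_word_def len using \<pi> by (intro sym_ad_cong) (auto simp: permute_list_nth)
  finally show ?thesis by simp
qed

lemma cut_append_mset:
  assumes "mset w = mset w'" "length w < i"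
  shows "cut i (u @ w) = cut i (u @ w')"
proof (induction u)
  case Nil
  then show ?case using assms mset_eq_length[OF assms(1)] by (simp add: cut_short)
next
  case (Cons l u)
  have "mset (u @ w) = mset (u @ w')" "length w = length w'"
    using assms mset_eq_length by auto
  then show ?case using Cons by (simp add: sym_word_mset[of "u @ w" "u @ w'"])
qed

text \<open>The words in the expansion of a commutator cancel in pairs that consist of the same letters.\<close>

lemma lin_mset_emb:
  fixes g :: "('x, 'b) letter list \<Rightarrow> 'v::ab_group_add"
  assumes g: "\<And>u w. length u = d \<Longrightarrow> mset u = mset w \<Longrightarrow> g u = g w"
    and v: "v \<in> lie_component d" and d: "2 \<le> d"
  shows "lin g (emb v) = 0"
proof -
  have "lin g (emb (left_normed as)) = 0" if as: "length as = d" for as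
  proof -
    define bs b where "bs = butlast as" and "b = last as"
    have as': "as = bs @ [b]" "bs \<noteq> []" "length bs = d - 1"
      using as d by (auto simp: bs_def b_def simp flip: length_greater_0_conv)
    then have words: "emb (left_normed bs) \<in> words_of_length (d - 1)" "gen_word b \<in> words_of_length 1"
      using emb_in_words[OF left_normed_in_lie_component, of bs] gen_word_in_words d by auto
    have "lin g (emb (left_normed bs) * gen_word b) = lin g (gen_word b * emb (left_normed bs))"
    proof (rule additive_frag_eq2[of "\<lambda>f h. lin g (f * h)" "\<lambda>f h. lin g (h * f)"])
      fix u w assume "u \<in> Poly_Mapping.keys (emb (left_normed bs))" "w \<in> Poly_Mapping.keys (gen_word b)"
      then have "length (u @ w) = d" using words d by (auto simp: words_of_length_def)
      then show "lin g (frag_of u * frag_of w) = lin g (frag_of w * frag_of u)"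
        by (simp add: g[of "u @ w" "w @ u"])
    qed (simp_all add: additive_def distrib_left distrib_right lin_add)
    then show ?thesis
      using as' by (simp add: left_normed_snoc emb_bracket emb_gen lin_diff)
  qed
  then show ?thesis
    using additive_image_span[OF additive_compose[OF additive_lin additive_emb] add_closed_singleton_zero
        _ v[unfolded lie_component_def], of g] by blast
qed

lemma lin_cut_times_commutator:
  assumes v: "v \<in> lie_component d" "2 \<le> d" "d < i"
  shows "lin (cut i) (f * emb v) = 0"
proof (rule additive_frag_eq[where g = "\<lambda>_. 0" and h = "\<lambda>f. lin (cut i) (f * emb v)" and f = f])
  fix u
  have "lin (cut i) (frag_of u * g) = lin (\<lambda>w. cut i (u @ w)) g" for g
    using additive_lin_comp[OF additive_times_right, of "frag_of u" frag_of g] by (simp add: lin_self lin_lin)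
  moreover have "lin (\<lambda>w. cut i (u @ w)) (emb v) = 0"
    by (rule lin_mset_emb[OF _ v(1,2)]) (use v in \<open>auto intro: cut_append_mset\<close>)
  ultimately show "lin (cut i) (frag_of u * emb v) = 0" by simp
qed (simp_all add: additive_def distrib_right lin_add)

text \<open>In each of the two products of which the bracket is the difference, the operator sees the right
  factor only: it annihilates a commutator that is too short and brackets the left factor onto the
  value of a long one.\<close>

lemma lin_cut_emb_bracket:
  assumes u: "u \<in> lie_component a" "i \<le> a \<or> 2 \<le> a" "0 < a" and v: "v \<in> lie_component b" "i \<le> b \<or> 2 \<le> b" "0 < b"
  shows "lin (cut i) (emb (lie_bracket u v)) =
    (if i \<le> b then lie_bracket u (lin (cut i) (emb v)) else 0) -
    (if i \<le> a then lie_bracket v (lin (cut i) (emb u)) else 0)"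
proof -
  have *: "lin (cut i) (emb u * emb v) = (if i \<le> b then lie_bracket u (lin (cut i) (emb v)) else 0)"
    if v: "v \<in> lie_component b" "i \<le> b \<or> 2 \<le> b" "0 < b" for u v b
    using lin_cut_times[OF emb_in_words[OF v(1,3)] _ v(3)] lin_cut_times_commutator[OF v(1)] that
    by (auto simp: ad_words_emb)
  show ?thesis unfolding emb_bracket lin_diff *[OF u] *[OF v] ..
qed

text \<open>The Dynkin-Specht-Wever identity.\<close>

lemma dynkin:
  assumes "v \<in> lie_component d" shows "lin (cut (Suc 0)) (emb v) = zscale (int d) v"
proof -
  have "lin (cut (Suc 0)) (emb (left_normed as)) = zscale (int (length as)) (left_normed as)" for as
  proof (induction as rule: rev_induct)
    case Nil
    then show ?case by (simp add: additive.zero[OF additive_emb])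
  next
    case (snoc b as)
    have gen: "lin (cut (Suc 0)) (emb (lie_gen b)) = lie_gen b"
      by (simp add: emb_gen lin_lin sym_word_def lin_le_coord)
    show ?case
    proof (cases "as = []")
      case True
      then show ?thesis by (simp add: gen)
    next
      case False
      have "lin (cut (Suc 0)) (emb (lie_bracket (left_normed as) (lie_gen b))) =
          lie_bracket (left_normed as) (lie_gen b) - lie_bracket (lie_gen b) (zscale (int (length as)) (left_normed as))"
        using lin_cut_emb_bracket[OF left_normed_in_lie_component[of as] _ _ lie_gen_in_lie_component[of b],
            of "Suc 0"] False
        by (simp add: gen snoc Suc_le_eq)
      also have "\<dots> = zscale (1 + int (length as)) (lie_bracket (left_normed as) (lie_gen b))"
        unfolding lie_bracket_minus_commute[of "lie_gen b"]
        by (simp add: lie_bracket_linear zscale.scale_left_distrib)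
      finally show ?thesis using False by (simp add: left_normed_snoc)
    qed
  qed
  then show ?thesis
    by (intro additive_eq_on_span[OF additive_compose[OF additive_lin additive_emb] _ _
          assms[unfolded lie_component_def], where g = "zscale (int d)"])
      (auto simp: additive_def zscale.scale_right_distrib)
qed

lemma sym_word_deriv:
  assumes x: "x \<in> X"
  shows "lie_deriv (act x) (sym_word l w) = sym_word (shift x l) w + lin (sym_word l) (word_deriv x w)"
proof -
  have "lie_deriv (act x) (sym_word l w) = sym_word (shift x l) w +
      (\<Sum>k<length w. sym_ad ((\<lambda>j. le (w ! j))(k := lie_deriv (act x) (le (w ! k)))) {..<length w} (le l))"
    unfolding sym_word_def
    by (subst sym_ad_derivation[where \<delta> = "lie_deriv (act x)"])
      (simp_all add: additive_lie_deriv x lie_deriv_bracket lie_deriv_le)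
  also have "(\<Sum>k<length w. sym_ad ((\<lambda>j. le (w ! j))(k := lie_deriv (act x) (le (w ! k)))) {..<length w} (le l)) =
      (\<Sum>k<length w. sym_word l (w[k := shift x (w ! k)]))"
    unfolding sym_word_def length_list_update
    by (intro sum.cong sym_ad_cong) (auto simp: nth_list_update lie_deriv_le[OF x])
  finally show ?thesis by (simp add: word_deriv_eq_sum lin_sum)
qed

lemma lin_cut_word_deriv: "x \<in> X \<Longrightarrow> lin (cut i) (word_deriv x w) = lie_deriv (act x) (cut i w)"
proof (induction w)
  case Nil
  then show ?case by (simp add: additive.zero[OF additive_lie_deriv])
next
  case (Cons l w)
  have "length v = length w" if "v \<in> Poly_Mapping.keys (word_deriv x w)" for v
    using that by (rule keys_word_deriv)
  then have "lin (\<lambda>v. cut i (l # v)) (word_deriv x w) =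
      lin (\<lambda>v. if Suc (length w) < i then 0 else if Suc (length w) = i then sym_word l v
                    else lie_bracket (le l) (cut i v)) (word_deriv x w)"
    by (intro lin_cong) auto
  also have "\<dots> = (if Suc (length w) < i then 0 else if Suc (length w) = i then lin (sym_word l) (word_deriv x w)
                    else lie_bracket (le l) (lin (cut i) (word_deriv x w)))"
    by (simp add: additive_lin_comp[OF additive_bracket_right])
  finally have *: "lin (cut i) (word_deriv x (l # w)) = cut i (shift x l # w) +
      (if Suc (length w) < i then 0 else if Suc (length w) = i then lin (sym_word l) (word_deriv x w)
       else lie_bracket (le l) (lin (cut i) (word_deriv x w)))"
    by (simp add: lin_add lin_lin del: cut.simps)
  show ?case
    using Cons.IH[OF Cons.prems] Cons.prems unfolding *
    by (auto simp: sym_word_deriv lie_deriv_bracket lie_deriv_le additive.zero[OF additive_lie_deriv])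
qed

definition deriv_span :: "nat \<Rightarrow> 'a free_lie set" where
  "deriv_span d = additive_span {lie_deriv (act x) v |x v. x \<in> X \<and> v \<in> lie_component d}"

lemma add_closed_deriv_span [simp]: "add_closed (deriv_span d)"
  by (simp add: deriv_span_def)

lemma lie_deriv_in_deriv_span: "x \<in> X \<Longrightarrow> v \<in> lie_component d \<Longrightarrow> lie_deriv (act x) v \<in> deriv_span d"
  unfolding deriv_span_def by (rule additive_span.base) blast

text \<open>Torsion dies on the way through the torsion-free coinvariants of a tensor product with a free
  module. The element \<open>k\<close> and the subgroup \<open>R\<close> allow for a quotient of the Lie component and for a
  map \<open>\<phi>\<close> that is equivariant only modulo a subgroup.\<close>

lemma torsion_through_pairs:
  fixes d :: "'x \<Rightarrow> 'w \<Rightarrow> 'w \<Rightarrow>\<^sub>0 int" and \<psi> :: "'a free_lie \<Rightarrow> ('x, 'b) letter \<times> 'w \<Rightarrow>\<^sub>0 int"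
  assumes comm: "\<And>y z f. lin (d y) (lin (d z) f) = lin (d z) (lin (d y) f)"
    and \<psi>: "additive \<psi>" "\<And>x v. x \<in> X \<Longrightarrow> v \<in> lie_component c \<Longrightarrow> \<psi> (lie_deriv (act x) v) = lin (pair_deriv d x) (\<psi> v)"
    and R: "add_closed R"
    and \<phi>: "\<And>x q. x \<in> X \<Longrightarrow> lin \<phi> (pair_deriv d x q) \<in> R"
    and v: "zscale n v - k \<in> deriv_span c" "n \<noteq> 0" "\<psi> k = 0"
  shows "lin \<phi> (\<psi> v) \<in> R"
proof -
  have "\<psi> u \<in> pair_coinv d X" if "u \<in> deriv_span c" for u
  proof (rule additive_image_span[OF \<psi>(1) _ _ that[unfolded deriv_span_def]])
    fix w assume "w \<in> {lie_deriv (act x) v |x v. x \<in> X \<and> v \<in> lie_component c}"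
    then obtain x v where "w = lie_deriv (act x) v" "x \<in> X" "v \<in> lie_component c" by blast
    then show "\<psi> w \<in> pair_coinv d X"
      unfolding pair_coinv_def by (intro additive_span.base) (auto simp: \<psi>(2))
  qed (simp add: pair_coinv_def)
  from this[OF v(1)] have "zscale n (\<psi> v) \<in> pair_coinv d X"
    by (simp add: additive.diff[OF \<psi>(1)] additive_zscale[OF \<psi>(1)] v(3))
  then have "\<psi> v \<in> pair_coinv d X"
    by (rule coinvariants_torsion_free[OF finite_X comm v(2)])
  moreover have "lin \<phi> (lin (pair_deriv d x) f) \<in> R" if "x \<in> X" for x f
    unfolding lin_lin by (rule lin_closed[OF R]) (rule \<phi>[OF that])
  ultimately show ?thesis
    using additive_image_span[OF additive_lin R, of "{lin (pair_deriv d x) f |x f. x \<in> X}" \<phi> "\<psi> v"]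
    by (auto simp: pair_coinv_def)
qed

definition split_word :: "('x, 'b) letter list \<Rightarrow>
    ('x, 'b) letter \<times> ('x, 'b) letter list \<Rightarrow>\<^sub>0 int" where
  "split_word w = (case w of [] \<Rightarrow> 0 | l # w' \<Rightarrow> frag_of (l, w'))"

lemma split_word_deriv: "lin split_word (word_deriv x w) = lin (pair_deriv word_deriv x) (split_word w)"
  by (cases w) (simp_all add: split_word_def pair_deriv_def lin_add lin_lin)

text \<open>A word is the tensor product of its first letter, which belongs to the free module, and the
  remaining word. The restriction to words of length \<open>d\<close> keeps the values in the component.\<close>

lemma cut_torsion:
  assumes v: "v \<in> lie_component d" "zscale n v \<in> deriv_span d" "n \<noteq> 0" and d: "0 < d"
  shows "lin (cut i) (emb v) \<in> deriv_span d"
proof -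
  define \<phi> where "\<phi> q = (if Suc (length (snd q)) = d then cut i (fst q # snd q) else 0)"
    for q :: "('x, 'b) letter \<times> ('x, 'b) letter list"
  have "lin \<phi> (lin split_word (emb v)) \<in> deriv_span d"
  proof (rule torsion_through_pairs[where d = word_deriv and n = n and k = 0 and c = d])
    show "additive (\<lambda>v. lin split_word (emb v))" by (rule additive_compose[OF additive_lin additive_emb])
    show "lin split_word (emb (lie_deriv (act x) v)) = lin (pair_deriv word_deriv x) (lin split_word (emb v))"
      if "x \<in> X" for x v
      using that by (simp add: emb_lie_deriv lin_lin split_word_deriv)
    show "lin \<phi> (pair_deriv word_deriv x q) \<in> deriv_span d" if x: "x \<in> X" for x q
    proof -
      obtain l w where q: "q = (l, w)" by (cases q)
      have "lin \<phi> (pair_deriv word_deriv x q) =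
          \<phi> (shift x l, w) + lin (\<lambda>w'. \<phi> (l, w')) (word_deriv x w)"
        by (simp add: q pair_deriv_def lin_add lin_lin)
      also have "lin (\<lambda>w'. \<phi> (l, w')) (word_deriv x w) =
          lin (\<lambda>w'. if Suc (length w) = d then cut i (l # w') else 0) (word_deriv x w)"
        by (rule lin_cong) (auto simp: \<phi>_def dest: keys_word_deriv)
      finally have "lin \<phi> (pair_deriv word_deriv x q) =
          (if Suc (length w) = d then lin (cut i) (word_deriv x (l # w)) else 0)"
        by (simp add: lin_add lin_lin del: cut.simps) (simp add: \<phi>_def del: cut.simps)
      then show ?thesis
        using cut_in_lie_component[of i "l # w"]
        by (auto simp: lin_cut_word_deriv[OF x] add_closed_zero
            simp del: word_deriv.simps cut.simps intro!: lie_deriv_in_deriv_span[OF x])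
    qed
  qed (use v in \<open>simp_all add: word_deriv_commute additive.zero[OF additive_emb]\<close>)
  also have "lin \<phi> (lin split_word (emb v)) = lin (cut i) (emb v)"
    unfolding lin_lin
    by (rule lin_words_of_length_cong[OF emb_in_words[OF v(1) d]])
      (use d in \<open>auto simp: \<phi>_def split_word_def split: list.split simp del: cut.simps\<close>)
  finally show ?thesis .
qed

end

section \<open>The free metabelian component\<close>

lemma multiadditive_foldl:
  assumes B: "\<And>f. additive (B f)" "\<And>f'. additive (\<lambda>f. B f f')"
    and g: "\<And>f. additive (\<lambda>v. g v f)" "\<And>v. additive (g v)" and n: "2 \<le> n"
  shows "multiadditive n (\<lambda>fs. foldl g (B (fs ! 0) (fs ! 1)) (drop 2 fs))"
  unfolding multiadditive_def
proof (intro allI impI)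
  fix xs ys :: "'a list" assume len: "length xs + length ys + 1 = n"
  have fold: "additive (\<lambda>v. foldl g v zs)" for zs
  proof (induction zs)
    case (Cons z zs)
    from additive_compose[OF this g(1)] show ?case by simp
  qed (simp add: additive_def)
  consider "xs = []" | x where "xs = [x]" | x x' xs' where "xs = x # x' # xs'"
    by (metis list.exhaust)
  then show "additive (\<lambda>f. foldl g (B ((xs @ f # ys) ! 0) ((xs @ f # ys) ! 1)) (drop 2 (xs @ f # ys)))"
  proof cases
    case 1
    then obtain y ys' where "ys = y # ys'" using len n by (cases ys) auto
    then show ?thesis using additive_compose[OF fold B(2)] 1 by simp
  next
    case 2
    then show ?thesis using additive_compose[OF fold B(1)] by simp
  next
    case 3
    then show ?thesis using additive_compose[OF fold g(2)] by simp
  qed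
qed

lemma add_closed_sum_mset: "add_closed S \<Longrightarrow> (\<And>i. i \<in># M \<Longrightarrow> f i \<in> S) \<Longrightarrow> (\<Sum>i\<in>#M. f i) \<in> S"
  by (induction M) (auto simp: add_closed_zero add_closed_add)

lemma sum_mset_diff: "(\<Sum>i\<in>#M. f i - g i) = (\<Sum>i\<in>#M. f i) - (\<Sum>i\<in>#M. (g i :: 'v::ab_group_add))"
  by (induction M) (simp_all add: algebra_simps)

lemma sum_mset_const_zscale: "(\<Sum>i\<in>#M. v) = zscale (int (size M)) (v :: 'v::ab_group_add)"
  by (induction M) (simp_all add: zscale.scale_left_distrib)

lemma sum_mset_remove_swap:
  "(\<Sum>b\<in>#M. \<Sum>c\<in>#M - {#b#}. g b c) = (\<Sum>c\<in>#M. \<Sum>b\<in>#M - {#c#}. (g b c :: 'v::ab_group_add))"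
proof (induction M)
  case (add a M)
  have "(\<Sum>b\<in>#M. \<Sum>c\<in>#add_mset a M - {#b#}. g b c) =
      (\<Sum>b\<in>#M. g b a + (\<Sum>c\<in>#M - {#b#}. g b c))" for g :: "'a \<Rightarrow> 'a \<Rightarrow> 'v"
    by (intro arg_cong[where f = sum_mset] image_mset_cong) auto
  from this[of g] this[of "\<lambda>b c. g c b"] add show ?case
    by (simp add: sum_mset.distrib algebra_simps)
qed simp

context lie_coordinates
begin

lemma metab_kernel_lie_deriv: "x \<in> X \<Longrightarrow> v \<in> metab_kernel d \<Longrightarrow> lie_deriv (act x) v \<in> metab_kernel d"
proof -
  assume x: "x \<in> X" and v: "v \<in> metab_kernel d"
  have "metab_kernel d \<subseteq> {v. lie_deriv (act x) v \<in> metab_kernel d}"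
  proof (rule metab_kernel_minimal)
    show "add_closed {v. lie_deriv (act x) v \<in> metab_kernel d}"
      by (rule add_closed_vimage[OF additive_lie_deriv[OF x]]) simp
    fix u v :: "'a free_lie" and i j
    assume "u \<in> lie_component i" "v \<in> lie_component j" "2 \<le> i" "2 \<le> j" "i + j = d"
    then show "lie_bracket u v \<in> {v. lie_deriv (act x) v \<in> metab_kernel d}"
      using lie_deriv_lie_component[OF x]
      by (auto simp: lie_deriv_bracket[OF x] intro!: add_closed_add bracket_in_metab_kernel[of _ i _ j])
  qed
  then show ?thesis using v by blast
qed

text \<open>The image of a word in the tensor product of the free abelian group on the letters with its
  symmetric power. It detects the free metabelian Lie ring.\<close>

definition metab_word :: "('x, 'b) letter list \<Rightarrow>
    ('x, 'b) letter \<times> ('x, 'b) letter multiset \<Rightarrow>\<^sub>0 int" where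
  "metab_word w = (case w of [] \<Rightarrow> 0 | l # w' \<Rightarrow> frag_of (l, mset w'))"

definition metab_pairs :: "'a free_lie \<Rightarrow>
    ('x, 'b) letter \<times> ('x, 'b) letter multiset \<Rightarrow>\<^sub>0 int" where
  "metab_pairs v = lin metab_word (emb v)"

lemma additive_metab_pairs: "additive metab_pairs"
  unfolding metab_pairs_def by (rule additive_compose[OF additive_lin additive_emb, unfolded o_def])

lemma metab_word_deriv: "lin metab_word (word_deriv x w) = lin (pair_deriv mset_deriv x) (metab_word w)"
proof (cases w)
  case (Cons l w')
  have "lin (\<lambda>v. frag_of (l, mset v)) (word_deriv x w') = lin (\<lambda>N. frag_of (l, N)) (mset_deriv x (mset w'))"
    by (simp add: lin_lin flip: lin_mset_word_deriv)
  then show ?thesis by (simp add: Cons metab_word_def pair_deriv_def lin_add lin_lin)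
qed (simp add: metab_word_def)

lemma metab_pairs_lie_deriv:
  "x \<in> X \<Longrightarrow> metab_pairs (lie_deriv (act x) v) = lin (pair_deriv mset_deriv x) (metab_pairs v)"
  by (simp add: metab_pairs_def emb_lie_deriv lin_lin metab_word_deriv)

lemma metab_pairs_times_commutator:
  assumes v: "v \<in> lie_component d" "2 \<le> d" and f: "f \<in> words_of_length c" "0 < c"
  shows "lin metab_word (f * emb v) = 0"
proof (rule additive_frag_eq[where g = "\<lambda>_. 0" and h = "\<lambda>f. lin metab_word (f * emb v)" and f = f])
  fix u assume "u \<in> Poly_Mapping.keys f"
  then obtain l u' where u: "u = l # u'" using f by (cases u) (auto simp: words_of_length_def)
  have "lin metab_word (frag_of u * g) = lin (\<lambda>w. metab_word (u @ w)) g" for g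
    using additive_lin_comp[OF additive_times_right, of "frag_of u" frag_of g] by (simp add: lin_self lin_lin)
  moreover have "lin (\<lambda>w. metab_word (u @ w)) (emb v) = 0"
    by (rule lin_mset_emb[OF _ v]) (simp add: u metab_word_def)
  ultimately show "lin metab_word (frag_of u * emb v) = 0" by simp
qed (simp_all add: additive_def distrib_right lin_add)

lemma metab_pairs_metab_kernel:
  assumes "v \<in> metab_kernel d" shows "metab_pairs v = 0"
proof -
  have "metab_kernel d \<subseteq> {v. metab_pairs v \<in> {0}}"
  proof (rule metab_kernel_minimal)
    show "add_closed {v. metab_pairs v \<in> {0}}"
      by (rule add_closed_vimage[OF additive_metab_pairs]) simp
    fix u v :: "'a free_lie" and i j
    assume "u \<in> lie_component i" "v \<in> lie_component j" "2 \<le> i" "2 \<le> j"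
    then show "lie_bracket u v \<in> {v. metab_pairs v \<in> {0}}"
      using metab_pairs_times_commutator[of u i "emb v" j] metab_pairs_times_commutator[of v j "emb u" i]
        emb_in_words[of u i] emb_in_words[of v j]
      by (simp add: metab_pairs_def emb_bracket lin_diff)
  qed
  then show ?thesis using assms by blast
qed

definition pair_times where
  "pair_times P f = lin (\<lambda>p. lin (\<lambda>l. frag_of (fst p, add_mset l (snd p))) f) P"

definition pair_bracket where
  "pair_bracket f g = lin (\<lambda>k. lin (\<lambda>l. frag_of (k, {#l#}) - frag_of (l, {#k#})) g) f"

definition pairs_of_list where
  "pairs_of_list fs = foldl pair_times (pair_bracket (fs ! 0) (fs ! 1)) (drop 2 fs)"

definition left_normed_list :: "(('x, 'b) letter \<Rightarrow>\<^sub>0 int) list \<Rightarrow> 'a free_lie" where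
  "left_normed_list fs =
     foldl (\<lambda>v f. lie_bracket v (lin le f)) (lie_bracket (lin le (fs ! 0)) (lin le (fs ! 1))) (drop 2 fs)"

lemma additive_lin_fun: "(\<And>k. additive (g k)) \<Longrightarrow> additive (\<lambda>f. lin (\<lambda>k. g k f) h)"
  by (simp add: additive_def lin_fun_add)

lemma multiadditive_pairs_of_list: "2 \<le> n \<Longrightarrow> multiadditive n pairs_of_list"
  unfolding pairs_of_list_def
  by (rule multiadditive_foldl)
    (simp_all add: pair_times_def pair_bracket_def additive_lin additive_lin_fun)

lemma multiadditive_left_normed_list: "2 \<le> n \<Longrightarrow> multiadditive n left_normed_list"
  unfolding left_normed_list_def
  by (rule multiadditive_foldl) (simp_all add: additive_def lin_add lie_bracket_add_left lie_bracket_add_right)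

lemma left_normed_eq_list:
  "2 \<le> length as \<Longrightarrow> left_normed as = left_normed_list (map coord as)"
proof -
  assume "2 \<le> length as"
  then obtain a b cs where as: "as = a # b # cs" by (cases as; cases "tl as") auto
  show ?thesis by (simp add: as left_normed_list_def foldl_map lin_le_coord)
qed

lemma metab_pairs_bracket_gen:
  assumes "v \<in> lie_component d" "2 \<le> d"
  shows "metab_pairs (lie_bracket v (lie_gen b)) = pair_times (metab_pairs v) (coord b)"
proof -
  have "lin metab_word (gen_word b * emb v) = 0"
    using metab_pairs_times_commutator[OF assms gen_word_in_words] by simp
  moreover have "lin metab_word (f * gen_word b) = pair_times (lin metab_word f) (coord b)"
    if f: "f \<in> words_of_length d" for f
  proof (rule additive_frag_eq2[of "\<lambda>f h. lin metab_word (f * lin (\<lambda>l. frag_of [l]) h)"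
        "\<lambda>f h. pair_times (lin metab_word f) h"])
    fix u l assume "u \<in> Poly_Mapping.keys f"
    then obtain k u' where "u = k # u'" using f assms by (cases u) (auto simp: words_of_length_def)
    then show "lin metab_word (frag_of u * lin (\<lambda>l. frag_of [l]) (frag_of l)) =
        pair_times (lin metab_word (frag_of u)) (frag_of l)"
      by (simp add: metab_word_def pair_times_def)
  qed (simp_all add: additive_def distrib_left distrib_right lin_add pair_times_def lin_fun_add)
  ultimately show ?thesis
    using emb_in_words[OF assms(1)] assms(2)
    by (simp add: metab_pairs_def emb_bracket emb_gen lin_diff)
qed

lemma metab_pairs_left_normed:
  "2 \<le> length as \<Longrightarrow> metab_pairs (left_normed as) = pairs_of_list (map coord as)"
proof (induction as rule: rev_induct)
  case (snoc b as)
  show ?case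
  proof (cases "length as = 1")
    case True
    then obtain a where as: "as = [a]" by (cases as) auto
    have "lin metab_word (gen_word a * gen_word b - gen_word b * gen_word a) = pair_bracket (coord a) (coord b)"
    proof (rule additive_frag_eq2[of "\<lambda>f h. lin metab_word (lin (\<lambda>l. frag_of [l]) f * lin (\<lambda>l. frag_of [l]) h -
        lin (\<lambda>l. frag_of [l]) h * lin (\<lambda>l. frag_of [l]) f)" pair_bracket])
      show "additive (pair_bracket f)" for f by (simp add: additive_def pair_bracket_def lin_add lin_fun_add)
    qed (simp_all add: additive_def distrib_left distrib_right lin_add pair_bracket_def metab_word_def
          lin_diff lin_fun_add)
    then show ?thesis
      by (simp add: as metab_pairs_def emb_bracket emb_gen pairs_of_list_def)
  next
    case False
    then have len: "2 \<le> length as" using snoc.prems by simp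
    then have "as \<noteq> []" by auto
    have "metab_pairs (left_normed (as @ [b])) = pair_times (metab_pairs (left_normed as)) (coord b)"
      unfolding left_normed_snoc[OF \<open>as \<noteq> []\<close>]
      by (rule metab_pairs_bracket_gen[OF left_normed_in_lie_component len])
    then show ?thesis using len \<open>as \<noteq> []\<close> by (simp add: snoc.IH pairs_of_list_def nth_append)
  qed
qed simp

lemma pairs_of_letters:
  "pairs_of_list (map frag_of (k # l # w)) =
    frag_of (k, add_mset l (mset w)) - frag_of (l, add_mset k (mset w))"
proof -
  have "foldl pair_times (frag_of (k, M) - frag_of (l, N)) (map frag_of w) =
      frag_of (k, mset w + M) - frag_of (l, mset w + N)" for M N
  proof (induction w arbitrary: M N)
    case (Cons j w)
    have "pair_times (frag_of (k, M) - frag_of (l, N)) (frag_of j) =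
        frag_of (k, add_mset j M) - frag_of (l, add_mset j N)"
      by (simp add: pair_times_def lin_diff)
    then show ?case using Cons[of "add_mset j M" "add_mset j N"] by simp
  qed simp
  then show ?thesis by (simp add: pairs_of_list_def pair_bracket_def)
qed

definition word_bracket :: "('x, 'b) letter \<Rightarrow> ('x, 'b) letter \<Rightarrow>
    ('x, 'b) letter list \<Rightarrow> 'a free_lie" where
  "word_bracket k l w = foldl lie_bracket (lie_bracket (le k) (le l)) (map le w)"

text \<open>Left-normed products with the entries from the third on in an arbitrary but fixed order: modulo
  the second derived ideal the order does not matter.\<close>

definition mset_bracket :: "('x, 'b) letter \<Rightarrow> ('x, 'b) letter \<Rightarrow>
    ('x, 'b) letter multiset \<Rightarrow> 'a free_lie" where
  "mset_bracket k l M = word_bracket k l (SOME w. mset w = M)"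

lemma left_normed_letters: "left_normed_list (map frag_of (k # l # w)) = word_bracket k l w"
  by (simp add: left_normed_list_def word_bracket_def foldl_map)

lemma bracket_le_in_component: "lie_bracket (le k) (le l) \<in> lie_component 2"
  using lie_component_bracket_gen[OF lie_gen_in_lie_component[of "e k"], of "e l"] by (simp add: numeral_2_eq_2)

lemma word_bracket_in_component: "word_bracket k l w \<in> lie_component (2 + length w)"
  using lie_component_foldl[OF bracket_le_in_component, of k l "map e w"] by (simp add: word_bracket_def o_def)

lemma word_bracket_permute:
  assumes "mset w = mset w'"
  shows "word_bracket k l w - word_bracket k l w' \<in> metab_kernel (2 + length w)"
  using foldl_bracket_permute[OF bracket_le_in_component, of "map e w" "map e w'" k l] assms
  by (simp add: word_bracket_def o_def)

lemma mset_bracket_cong: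
  "word_bracket k l w - mset_bracket k l (mset w) \<in> metab_kernel (2 + length w)"
  unfolding mset_bracket_def by (rule word_bracket_permute) (metis (mono_tags, lifting) someI)

lemma mset_bracket_in_component: "mset_bracket k l M \<in> lie_component (2 + size M)"
proof -
  have "mset (SOME w. mset w = M) = M" by (metis (mono_tags, lifting) someI ex_mset)
  then have "length (SOME w. mset w = M) = size M" by (metis size_mset)
  then show ?thesis
    unfolding mset_bracket_def
    using word_bracket_in_component[of k l "SOME w. mset w = M"] by simp
qed

lemma mset_bracket_swap: "mset_bracket l k M = - mset_bracket k l M"
  unfolding mset_bracket_def word_bracket_def lie_bracket_minus_commute[of "le l" "le k"]
  by (simp add: additive.minus[OF additive_foldl_bracket])

text \<open>The Jacobi identity, with \<open>b\<close> moved into the third place of the last product.\<close>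

lemma mset_bracket_jacobi:
  assumes "b \<in># M"
  shows "mset_bracket k b (add_mset l (M - {#b#})) - mset_bracket l b (add_mset k (M - {#b#}))
           - mset_bracket k l M \<in> metab_kernel (2 + size M)"
proof -
  obtain w where w: "mset w = M - {#b#}" by (metis ex_mset)
  have M: "M = mset (b # w)" using assms w by simp
  have len: "size M = Suc (length w)" by (simp add: M)
  have eq: "word_bracket k b (l # w) - word_bracket l b (k # w) = word_bracket k l (b # w)"
  proof -
    have "lie_bracket (lie_bracket (le k) (le b)) (le l) - lie_bracket (lie_bracket (le l) (le b)) (le k) =
        lie_bracket (lie_bracket (le k) (le l)) (le b)"
      using lie_bracket_bracket_left[of "le k" "le l" "le b"] lie_bracket_minus_commute[of "le k" "lie_bracket (le l) (le b)"]
      by simp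
    then show ?thesis
      by (simp add: word_bracket_def additive.diff[OF additive_foldl_bracket, symmetric])
  qed
  have "word_bracket k b (l # w) - mset_bracket k b (add_mset l (M - {#b#})) \<in> metab_kernel (2 + size M)"
    "word_bracket l b (k # w) - mset_bracket l b (add_mset k (M - {#b#})) \<in> metab_kernel (2 + size M)"
    "word_bracket k l (b # w) - mset_bracket k l M \<in> metab_kernel (2 + size M)"
    using mset_bracket_cong[of k b "l # w"] mset_bracket_cong[of l b "k # w"] mset_bracket_cong[of k l "b # w"]
    using assms by (simp_all add: w len)
  then have "(word_bracket k l (b # w) - mset_bracket k l M)
      - ((word_bracket k b (l # w) - mset_bracket k b (add_mset l (M - {#b#})))
      - (word_bracket l b (k # w) - mset_bracket l b (add_mset k (M - {#b#})))) \<in> metab_kernel (2 + size M)"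
    using add_closed_diff[OF add_closed_metab_kernel[of "2 + size M"]] by blast
  then show ?thesis
    unfolding eq[symmetric] by (simp add: algebra_simps)
qed

text \<open>Two maps back from the tensor product to the free Lie ring. Composed with \<^const>\<open>metab_pairs\<close>,
  the first is multiplication by the degree, and the second is the identity, always
  modulo the second derived ideal. The first is equivariant modulo that ideal, the second is not: it
  depends on the choice of a distinguished element of each multiset of letters.\<close>

definition pair_ret :: "('x, 'b) letter \<times> ('x, 'b) letter multiset \<Rightarrow> 'a free_lie" where
  "pair_ret q = (\<Sum>b\<in>#snd q. mset_bracket (fst q) b (snd q - {#b#}))"

definition pair_split :: "('x, 'b) letter \<times> ('x, 'b) letter multiset \<Rightarrow> 'a free_lie" where
  "pair_split q = (let m = SOME m. m \<in># add_mset (fst q) (snd q)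
     in if m = fst q then 0 else mset_bracket (fst q) m (snd q - {#m#}))"

text \<open>Both sides are additive in each entry of a left-normed product, so it suffices to compare them
  on letters, where only two words survive in the tensor product.\<close>

lemma metab_pairs_congruence:
  assumes letters: "\<And>k l w. length w + 2 = d \<Longrightarrow>
      \<phi> (k, add_mset l (mset w)) - \<phi> (l, add_mset k (mset w)) - zscale n (word_bracket k l w) \<in> metab_kernel d"
    and v: "v \<in> lie_component d" "2 \<le> d"
  shows "lin \<phi> (metab_pairs v) - zscale n v \<in> metab_kernel d"
proof -
  have "lin \<phi> (metab_pairs (left_normed as)) - zscale n (left_normed as) \<in> metab_kernel d"
    if as: "length as = d" for as
  proof -
    have "lin \<phi> (pairs_of_list fs) - zscale n (left_normed_list fs) \<in> metab_kernel d"
      if fs: "length fs = d" for fs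
    proof (rule multiadditive_closed[of d "\<lambda>fs. lin \<phi> (pairs_of_list fs) - zscale n (left_normed_list fs)"])
      show "multiadditive d (\<lambda>fs. lin \<phi> (pairs_of_list fs) - zscale n (left_normed_list fs))"
        using v by (intro multiadditive_diff multiadditive_compose[OF additive_lin] multiadditive_zscale
            multiadditive_pairs_of_list multiadditive_left_normed_list)
      fix w :: "('x, 'b) letter list" assume "length w = d"
      then obtain k l u where w: "w = k # l # u" "length u + 2 = d"
        using v(2) by (cases w; cases "tl w") auto
      show "lin \<phi> (pairs_of_list (map frag_of w)) - zscale n (left_normed_list (map frag_of w)) \<in> metab_kernel d"
        unfolding w(1) pairs_of_letters left_normed_letters lin_diff lin_frag_of by (rule letters[OF w(2)])
    qed (simp_all add: fs)
    from this[of "map coord as"] show ?thesis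
      using as v(2) by (simp add: metab_pairs_left_normed flip: left_normed_eq_list)
  qed
  moreover have "additive (\<lambda>v. lin \<phi> (metab_pairs v) - zscale n v)"
    by (intro additive_diff_fun additive_compose[OF additive_lin additive_metab_pairs])
      (simp add: additive_def zscale.scale_right_distrib)
  ultimately show ?thesis
    by (intro additive_image_span[of "\<lambda>v. lin \<phi> (metab_pairs v) - zscale n v", OF _ _ _ v(1)[unfolded lie_component_def]]) auto
qed

lemma pair_ret_metab_pairs:
  assumes "v \<in> lie_component d" "2 \<le> d"
  shows "lin pair_ret (metab_pairs v) - zscale (int d) v \<in> metab_kernel d"
proof (rule metab_pairs_congruence[OF _ assms])
  fix k l :: "('x, 'b) letter" and w :: "('x, 'b) letter list"
  assume w: "length w + 2 = d"
  let ?M = "mset w" and ?K = "metab_kernel d :: 'a free_lie set"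
  have ret: "pair_ret (k, add_mset l M) =
      mset_bracket k l M + (\<Sum>b\<in>#M. mset_bracket k b (add_mset l (M - {#b#})))" for k l M
    unfolding pair_ret_def
    by (auto intro!: arg_cong[where f = sum_mset] image_mset_cong)
  have "(\<Sum>b\<in>#?M. mset_bracket k b (add_mset l (?M - {#b#})) - mset_bracket l b (add_mset k (?M - {#b#}))
      - mset_bracket k l ?M) \<in> ?K"
    using mset_bracket_jacobi[of _ ?M k l] w by (intro add_closed_sum_mset) (simp_all add: add.commute)
  moreover have "word_bracket k l w - mset_bracket k l ?M \<in> ?K"
    using mset_bracket_cong[of k l w] w by (simp add: add.commute)
  then have "zscale (int d) (mset_bracket k l ?M) - zscale (int d) (word_bracket k l w) \<in> ?K"
    by (subst add_closed_minus_commute)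
      (auto simp: add_closed_zscale simp flip: zscale.scale_right_diff_distrib)
  moreover have "pair_ret (k, add_mset l ?M) - pair_ret (l, add_mset k ?M) =
      (\<Sum>b\<in>#?M. mset_bracket k b (add_mset l (?M - {#b#})) - mset_bracket l b (add_mset k (?M - {#b#}))
        - mset_bracket k l ?M) + zscale (int d) (mset_bracket k l ?M)"
  proof -
    have "zscale (int d) v = zscale (int (length w)) v + (v + v)" for v :: "'a free_lie"
      using zscale.scale_left_distrib[of "int (length w)" "1 + 1" v] zscale.scale_left_distrib[of 1 1 v]
      by (simp add: add.commute flip: w)
    then show ?thesis
      by (simp add: ret sum_mset_diff sum_mset_const_zscale mset_bracket_swap[of l k])
  qed
  ultimately show "pair_ret (k, add_mset l ?M) - pair_ret (l, add_mset k ?M)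
      - zscale (int d) (word_bracket k l w) \<in> ?K"
    using add_closed_add[of ?K] by (metis (no_types, lifting) add_closed_metab_kernel add_diff_eq)
qed

lemma pair_split_metab_pairs:
  assumes "v \<in> lie_component d" "2 \<le> d"
  shows "lin pair_split (metab_pairs v) - v \<in> metab_kernel d"
proof -
  have "lin pair_split (metab_pairs v) - zscale 1 v \<in> metab_kernel d"
  proof (rule metab_pairs_congruence[OF _ assms])
    fix k l :: "('x, 'b) letter" and w :: "('x, 'b) letter list"
  assume w: "length w + 2 = d"
    let ?M = "mset w" and ?K = "metab_kernel d :: 'a free_lie set"
    define m where "m = (SOME m. m \<in># add_mset k (add_mset l ?M))"
    have m: "m \<in># add_mset k (add_mset l ?M)" unfolding m_def by (rule someI[of _ k]) simp
    have split: "pair_split (k, add_mset l ?M) = (if m = k then 0 else mset_bracket k m (add_mset l ?M - {#m#}))"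
      "pair_split (l, add_mset k ?M) = (if m = l then 0 else mset_bracket l m (add_mset k ?M - {#m#}))"
      by (simp_all add: pair_split_def m_def Let_def add_mset_commute[of l k])
    have "pair_split (k, add_mset l ?M) - pair_split (l, add_mset k ?M) - mset_bracket k l ?M \<in> ?K"
    proof (cases "k = l")
      case True
      then have "mset_bracket k l ?M = 0"
        using additive.zero[OF additive_foldl_bracket]
        by (simp add: mset_bracket_def word_bracket_def lie_bracket_self)
      then show ?thesis using True by (simp add: add_closed_zero)
    next
      case False
      consider "m = k" | "m = l" | "m \<noteq> k" "m \<noteq> l" "m \<in># ?M" using m by auto
      then show ?thesis
      proof cases
        case 3
        then have "add_mset l ?M - {#m#} = add_mset l (?M - {#m#})" "add_mset k ?M - {#m#} = add_mset k (?M - {#m#})"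
          by auto
        then show ?thesis
          using mset_bracket_jacobi[OF 3(3), of k l] 3 w by (simp add: split add.commute)
      qed (use False in \<open>simp_all add: split mset_bracket_swap[of l k] add_closed_zero\<close>)
    qed
    moreover have "mset_bracket k l ?M - word_bracket k l w \<in> ?K"
      using mset_bracket_cong[of k l w] w by (subst add_closed_minus_commute) (simp_all add: add.commute)
    ultimately show "pair_split (k, add_mset l ?M) - pair_split (l, add_mset k ?M)
      - zscale 1 (word_bracket k l w) \<in> ?K"
      using add_closed_trans[of ?K "pair_split (k, add_mset l ?M) - pair_split (l, add_mset k ?M)"] by simp
  qed
  then show ?thesis by simp
qed

text \<open>Modulo the second derived ideal, \<^const>\<open>pair_split\<close> recovers an element from its image in a
  free abelian group.\<close>

lemma metab_torsion_free:
  fixes v :: "'a free_lie"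
  assumes v: "v \<in> lie_component d" "2 \<le> d" and n: "zscale n v \<in> metab_kernel d" "n \<noteq> 0"
  shows "v \<in> metab_kernel d"
proof -
  have "zscale n (metab_pairs v) = 0"
    using metab_pairs_metab_kernel[OF n(1)] by (simp add: additive_zscale[OF additive_metab_pairs])
  then have "metab_pairs v = 0" using n(2) by (simp add: zscale_frag_eq_0_iff)
  then have "- v \<in> metab_kernel d" using pair_split_metab_pairs[OF v] by simp
  then show ?thesis using add_closed_uminus[of "metab_kernel d" "- v"] by simp
qed

text \<open>After the first two letters, all \<open>(d - 2)!\<close> orders of the remaining ones give the same product
  modulo the second derived ideal.\<close>

lemma cut_eq_pair_ret:
  assumes "length w = d" "2 \<le> d"
  shows "cut d w - zscale (fact (d - 2)) (lin pair_ret (metab_word w)) \<in> metab_kernel d"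
proof -
  obtain l u where w: "w = l # u" using assms by (cases w) auto
  let ?K = "metab_kernel d :: 'a free_lie set"
  define n where "n = length u"
  have n: "d = Suc n" "n \<noteq> 0" using assms by (auto simp: w n_def)
  let ?J = "\<lambda>i. {..<n} - {i}"
  have J: "sym_ad (\<lambda>j. le (u ! j)) (?J i) (lie_bracket (le l) (le (u ! i)))
      - zscale (fact (d - 2)) (mset_bracket l (u ! i) (mset u - {#u ! i#})) \<in> ?K" if i: "i < n" for i
  proof -
    have "foldl lie_bracket (lie_bracket (le l) (le (u ! i))) (map (\<lambda>j. le (u ! j)) is)
        - mset_bracket l (u ! i) (mset u - {#u ! i#}) \<in> ?K" if "is": "is \<in> permutations_of_set (?J i)" for "is"
    proof -
      have "mset is = mset_set (?J i)" using "is" by (metis mset_set_set permutations_of_setD)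
      then have "mset (map ((!) u) is) = image_mset ((!) u) (mset_set {..<n} - {#i#})"
        using i by (simp add: mset_set_Diff)
      also have "\<dots> = image_mset ((!) u) (mset_set {..<n}) - {#u ! i#}"
        using i by (subst image_mset_Diff) auto
      also have "image_mset ((!) u) (mset_set {..<n}) = mset u"
        by (metis n_def map_nth mset_map mset_set_upto_eq_mset_upto atLeast0LessThan)
      finally have m: "mset (map ((!) u) is) = mset u - {#u ! i#}" .
      have "length is = n - 1" using length_finite_permutations_of_set[OF "is"] i by simp
      then show ?thesis
        using mset_bracket_cong[of l "u ! i" "map ((!) u) is"] n
        by (simp add: m word_bracket_def o_def del: mset_map)
    qed
    then have "(\<Sum>is\<in>permutations_of_set (?J i). foldl lie_bracket (lie_bracket (le l) (le (u ! i)))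
        (map (\<lambda>j. le (u ! j)) is) - mset_bracket l (u ! i) (mset u - {#u ! i#})) \<in> ?K"
      by (intro add_closed_sum) auto
    moreover have "(\<Sum>is\<in>permutations_of_set (?J i). v) = zscale (fact (d - 2)) v" for v :: "'a free_lie"
    proof -
      have "(\<Sum>is\<in>S. v) = zscale (int (card S)) v" if "finite S" for S :: "nat list set"
        using that by induction (simp_all add: zscale.scale_left_distrib)
      from this[of "permutations_of_set (?J i)"] show ?thesis using i n by simp
    qed
    ultimately show ?thesis by (simp add: sym_ad_def sum_subtractf)
  qed
  have "cut d w = (\<Sum>i<n. sym_ad (\<lambda>j. le (u ! j)) (?J i) (lie_bracket (le l) (le (u ! i))))"
  proof -
    have "{..<n} \<noteq> {}" using n by auto
    from sym_ad_rec[OF _ this] show ?thesis using n by (simp add: w sym_word_def flip: n_def)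
  qed
  moreover have "lin pair_ret (metab_word w) = (\<Sum>i<n. mset_bracket l (u ! i) (mset u - {#u ! i#}))"
  proof -
    have "(\<Sum>b\<in>#mset u. f b) = (\<Sum>i<n. f (u ! i))" for f :: "_ \<Rightarrow> 'a free_lie"
      by (metis (no_types, lifting) n_def atLeast0LessThan length_map mset_map nth_map sum.cong
          sum_list_sum_nth sum_mset_sum_list lessThan_iff)
    then show ?thesis by (simp add: w metab_word_def pair_ret_def)
  qed
  ultimately have "cut d w - zscale (fact (d - 2)) (lin pair_ret (metab_word w)) =
      (\<Sum>i<n. sym_ad (\<lambda>j. le (u ! j)) (?J i) (lie_bracket (le l) (le (u ! i)))
         - zscale (fact (d - 2)) (mset_bracket l (u ! i) (mset u - {#u ! i#})))"
    by (simp add: sum_subtractf zscale.scale_sum_right)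
  also have "\<dots> \<in> ?K" by (intro add_closed_sum) (use J in auto)
  finally show ?thesis .
qed

lemma cut_emb_congruence:
  assumes v: "v \<in> lie_component d" "2 \<le> d"
  shows "lin (cut d) (emb v) - zscale (fact (d - 2) * int d) v \<in> metab_kernel d"
proof -
  have "lin (\<lambda>w. cut d w - zscale (fact (d - 2)) (lin pair_ret (metab_word w))) (emb v) \<in> metab_kernel d"
    by (rule lin_closed) (use cut_eq_pair_ret[OF _ v(2)] emb_in_words[OF v(1)] v(2) in \<open>auto simp: words_of_length_def\<close>)
  moreover have "lin (\<lambda>w. zscale (fact (d - 2)) (lin pair_ret (metab_word w))) (emb v) =
      zscale (fact (d - 2)) (lin pair_ret (metab_pairs v))"
    unfolding metab_pairs_def lin_lin
    by (rule additive_lin_comp[symmetric]) (simp add: additive_def zscale.scale_right_distrib)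
  ultimately have "lin (cut d) (emb v) - zscale (fact (d - 2)) (lin pair_ret (metab_pairs v)) \<in> metab_kernel d"
    by (simp add: lin_fun_diff)
  moreover have "zscale (fact (d - 2)) (lin pair_ret (metab_pairs v)) - zscale (fact (d - 2) * int d) v \<in> metab_kernel d"
    using add_closed_zscale[OF _ pair_ret_metab_pairs[OF v], of "fact (d - 2)"]
    by (simp add: zscale.scale_right_diff_distrib)
  ultimately show ?thesis by (rule add_closed_trans[rotated]) simp
qed

text \<open>The symmetrised bracket of a word depends only on the first letter and on the multiset of the
  others, and so on the image of the word under \<^const>\<open>metab_word\<close>.\<close>

lemma cut_emb_metab_kernel:
  assumes "v \<in> metab_kernel d" "2 \<le> d" shows "lin (cut d) (emb v) = 0"
proof -
  define \<phi> where "\<phi> q = sym_word (fst q) (SOME w. mset w = snd q)"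
    for q :: "('x, 'b) letter \<times> ('x, 'b) letter multiset"
  have "v \<in> lie_component d" using assms metab_kernel_subset_component by blast
  then have "lin (cut d) (emb v) = lin (\<lambda>w. lin \<phi> (metab_word w)) (emb v)"
  proof (rule lin_words_of_length_cong[OF emb_in_words])
    fix w :: "('x, 'b) letter list" assume "length w = d"
    then obtain l u where w: "w = l # u" "d = Suc (length u)" using assms(2) by (cases w) auto
    have "sym_word l (SOME u'. mset u' = mset u) = sym_word l u"
      by (rule sym_word_mset) (metis (mono_tags, lifting) someI)
    then show "cut d w = lin \<phi> (metab_word w)" by (simp add: w metab_word_def \<phi>_def)
  qed (use assms in simp)
  also have "\<dots> = lin \<phi> (metab_pairs v)" by (simp add: metab_pairs_def lin_lin)
  finally show ?thesis by (simp add: metab_pairs_metab_kernel[OF assms(1)])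
qed

lemma mset_bracket_deriv:
  assumes x: "x \<in> X"
  shows "lie_deriv (act x) (mset_bracket k l M) -
    (mset_bracket (shift x k) l M + mset_bracket k (shift x l) M + lin (mset_bracket k l) (mset_deriv x M))
      \<in> metab_kernel (2 + size M)"
proof -
  obtain w where w: "mset w = M" by (metis ex_mset)
  then have len: "length w = size M" by auto
  let ?K = "metab_kernel (2 + size M) :: 'a free_lie set"
  have fold: "lie_deriv (act x) (foldl lie_bracket v (map le w)) =
      foldl lie_bracket (lie_deriv (act x) v) (map le w) + lin (\<lambda>w'. foldl lie_bracket v (map le w')) (word_deriv x w)" for v w
  proof (induction w arbitrary: v)
    case (Cons j w)
    show ?case
      by (simp add: Cons lie_deriv_bracket[OF x] lie_deriv_le[OF x] lin_add lin_lin
          additive.add[OF additive_foldl_bracket])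
  qed simp
  have 0: "lie_deriv (act x) (word_bracket k l w) = word_bracket (shift x k) l w + word_bracket k (shift x l) w
      + lin (word_bracket k l) (word_deriv x w)"
    unfolding word_bracket_def fold
    by (simp add: lie_deriv_bracket[OF x] lie_deriv_le[OF x] additive.add[OF additive_foldl_bracket])
  have 1: "word_bracket k l w - mset_bracket k l M \<in> ?K" for k l
    using mset_bracket_cong[of k l w] by (simp add: w len)
  have "lin (\<lambda>w'. word_bracket k l w' - mset_bracket k l (mset w')) (word_deriv x w) \<in> ?K"
  proof (rule lin_closed)
    fix w' assume "w' \<in> Poly_Mapping.keys (word_deriv x w)"
    then have "length w' = size M" using keys_word_deriv len by metis
    then show "word_bracket k l w' - mset_bracket k l (mset w') \<in> ?K" using mset_bracket_cong[of k l w'] by simp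
  qed simp
  moreover have "lin (\<lambda>w'. mset_bracket k l (mset w')) (word_deriv x w) = lin (mset_bracket k l) (mset_deriv x M)"
    unfolding w[symmetric] lin_mset_word_deriv[symmetric] by (simp add: lin_lin)
  ultimately have 2: "lin (word_bracket k l) (word_deriv x w) - lin (mset_bracket k l) (mset_deriv x M) \<in> ?K"
    by (simp add: lin_fun_diff)
  have 3: "lie_deriv (act x) (word_bracket k l w) - lie_deriv (act x) (mset_bracket k l M) \<in> ?K"
    using metab_kernel_lie_deriv[OF x 1] by (simp add: additive.diff[OF additive_lie_deriv[OF x]])
  have "((word_bracket (shift x k) l w - mset_bracket (shift x k) l M) +
      (word_bracket k (shift x l) w - mset_bracket k (shift x l) M) +
      (lin (word_bracket k l) (word_deriv x w) - lin (mset_bracket k l) (mset_deriv x M)))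
      - (lie_deriv (act x) (word_bracket k l w) - lie_deriv (act x) (mset_bracket k l M)) \<in> ?K"
    by (intro add_closed_diff[OF _ add_closed_add[OF _ add_closed_add]] 1 2 3) simp_all
  then show ?thesis unfolding 0 by (simp add: algebra_simps)
qed

lemma pair_ret_deriv:
  assumes x: "x \<in> X"
  shows "lin pair_ret (pair_deriv mset_deriv x (l, M)) - lie_deriv (act x) (pair_ret (l, M))
    \<in> metab_kernel (Suc (size M))"
proof -
  let ?K = "metab_kernel (Suc (size M)) :: 'a free_lie set"
  let ?D = "lie_deriv (act x)"
  have "(\<Sum>b\<in>#M. ?D (mset_bracket l b (M - {#b#})) - (mset_bracket (shift x l) b (M - {#b#})
      + mset_bracket l (shift x b) (M - {#b#}) + lin (mset_bracket l b) (mset_deriv x (M - {#b#})))) \<in> ?K"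
  proof (rule add_closed_sum_mset)
    fix b assume "b \<in># M"
    then have "2 + size (M - {#b#}) = Suc (size M)"
      by (metis add_2_eq_Suc insert_DiffM size_add_mset)
    then show "?D (mset_bracket l b (M - {#b#})) - (mset_bracket (shift x l) b (M - {#b#})
      + mset_bracket l (shift x b) (M - {#b#}) + lin (mset_bracket l b) (mset_deriv x (M - {#b#}))) \<in> ?K"
      using mset_bracket_deriv[OF x, of l b "M - {#b#}"] by simp
  qed simp
  moreover have "lin (\<lambda>N. pair_ret (l, N)) (mset_deriv x M) =
      (\<Sum>b\<in>#M. mset_bracket l (shift x b) (M - {#b#}) + lin (mset_bracket l b) (mset_deriv x (M - {#b#})))"
  proof -
    have ret: "pair_ret (l, add_mset (shift x c) (M - {#c#})) = mset_bracket l (shift x c) (M - {#c#})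
        + (\<Sum>b\<in>#M - {#c#}. mset_bracket l b (add_mset (shift x c) (M - {#b#} - {#c#})))" for c
    proof -
      have "(\<Sum>b\<in>#M - {#c#}. mset_bracket l b (add_mset (shift x c) (M - {#c#}) - {#b#})) =
          (\<Sum>b\<in>#M - {#c#}. mset_bracket l b (add_mset (shift x c) (M - {#b#} - {#c#})))"
        by (intro arg_cong[where f = sum_mset] image_mset_cong) (auto simp: add_mset_commute)
      then show ?thesis by (simp add: pair_ret_def)
    qed
    have "lin (\<lambda>N. pair_ret (l, N)) (mset_deriv x M) =
        (\<Sum>c\<in>#M. pair_ret (l, add_mset (shift x c) (M - {#c#})))"
      by (simp add: mset_deriv_def lin_sum_mset)
    also have "\<dots> = (\<Sum>c\<in>#M. mset_bracket l (shift x c) (M - {#c#})) +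
        (\<Sum>c\<in>#M. \<Sum>b\<in>#M - {#c#}. mset_bracket l b (add_mset (shift x c) (M - {#b#} - {#c#})))"
      by (simp add: ret sum_mset.distrib)
    also have "(\<Sum>c\<in>#M. \<Sum>b\<in>#M - {#c#}. mset_bracket l b (add_mset (shift x c) (M - {#b#} - {#c#}))) =
        (\<Sum>b\<in>#M. \<Sum>c\<in>#M - {#b#}. mset_bracket l b (add_mset (shift x c) (M - {#b#} - {#c#})))"
      by (rule sum_mset_remove_swap)
    also have "\<dots> = (\<Sum>b\<in>#M. lin (mset_bracket l b) (mset_deriv x (M - {#b#})))"
      by (simp add: mset_deriv_def lin_sum_mset)
    finally show ?thesis by (simp add: sum_mset.distrib)
  qed
  moreover have "?D (pair_ret (l, M)) = (\<Sum>b\<in>#M. ?D (mset_bracket l b (M - {#b#})))"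
    by (simp add: pair_ret_def additive_sum_mset[OF additive_lie_deriv[OF x]])
  moreover have "lin pair_ret (pair_deriv mset_deriv x (l, M)) =
      pair_ret (shift x l, M) + lin (\<lambda>N. pair_ret (l, N)) (mset_deriv x M)"
    by (simp add: pair_deriv_def lin_add lin_lin)
  ultimately have "?D (pair_ret (l, M)) - lin pair_ret (pair_deriv mset_deriv x (l, M)) \<in> ?K"
    by (simp add: pair_ret_def sum_mset_diff sum_mset.distrib algebra_simps)
  then show ?thesis by (subst add_closed_minus_commute) simp_all
qed

lemma pair_ret_in_component: "pair_ret (l, M) \<in> lie_component (Suc (size M))"
proof -
  have "mset_bracket l b (M - {#b#}) \<in> lie_component (Suc (size M))" if "b \<in># M" for b
  proof -
    have "2 + size (M - {#b#}) = Suc (size M)" using that by (metis add_2_eq_Suc insert_DiffM size_add_mset)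
    then show ?thesis using mset_bracket_in_component[of l b "M - {#b#}"] by simp
  qed
  then show ?thesis unfolding pair_ret_def by (auto intro: add_closed_sum_mset)
qed

text \<open>Multiplication by \<open>d\<close> factors through the torsion-free coinvariants of the pairs by
  \<open>pair_ret_metab_pairs\<close>.\<close>

lemma metab_torsion_exponent:
  assumes v: "v \<in> lie_component d" "2 \<le> d" and n: "zscale n v \<in> set_sum (deriv_span d) (metab_kernel d)" "n \<noteq> 0"
  shows "zscale (int d) v \<in> set_sum (deriv_span d) (metab_kernel d)"
proof -
  let ?R = "set_sum (deriv_span d) (metab_kernel d)"
  have R: "add_closed ?R" by (simp add: add_closed_set_sum)
  define \<phi> where "\<phi> q = (if Suc (size (snd q)) = d then pair_ret q else 0)"
    for q :: "('x, 'b) letter \<times> ('x, 'b) letter multiset"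
  obtain i k where ik: "zscale n v = i + k" "i \<in> deriv_span d" "k \<in> metab_kernel d"
    using n(1) unfolding set_sum_def by blast
  have "lin \<phi> (metab_pairs v) \<in> ?R"
  proof (rule torsion_through_pairs[where d = mset_deriv and n = n and k = k and c = d])
    show "lin \<phi> (pair_deriv mset_deriv x q) \<in> ?R" if x: "x \<in> X" for x q
    proof -
      obtain l M where q: "q = (l, M)" by (cases q)
      have size: "size N = size M" if "N \<in> Poly_Mapping.keys (mset_deriv x M)" for N
      proof -
        obtain w where w: "M = mset w" by (metis ex_mset)
        have "add_closed {f. Poly_Mapping.keys f \<subseteq> {N. size N = size M}}"
          by (auto simp: add_closed_def dest: subsetD[OF keys_diff])
        then have "lin (\<lambda>w'. frag_of (mset w')) (word_deriv x w) \<in> {f. Poly_Mapping.keys f \<subseteq> {N. size N = size M}}"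
          by (rule lin_closed) (auto simp: keys_frag_of w dest: keys_word_deriv)
        then show ?thesis using that by (auto simp: w lin_mset_word_deriv)
      qed
      have "lin \<phi> (pair_deriv mset_deriv x q) =
          \<phi> (shift x l, M) + lin (\<lambda>N. \<phi> (l, N)) (mset_deriv x M)"
        by (simp add: q pair_deriv_def lin_add lin_lin)
      also have "lin (\<lambda>N. \<phi> (l, N)) (mset_deriv x M) =
          lin (\<lambda>N. if Suc (size M) = d then pair_ret (l, N) else 0) (mset_deriv x M)"
        by (rule lin_cong) (auto simp: \<phi>_def dest: size)
      finally have eq: "lin \<phi> (pair_deriv mset_deriv x q) =
          (if Suc (size M) = d then lin pair_ret (pair_deriv mset_deriv x (l, M)) else 0)"
        by (simp add: pair_deriv_def lin_add lin_lin) (simp add: \<phi>_def)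
      show ?thesis
      proof (cases "Suc (size M) = d")
        case True
        have "lin pair_ret (pair_deriv mset_deriv x (l, M)) - lie_deriv (act x) (pair_ret (l, M)) \<in> ?R"
          using pair_ret_deriv[OF x, of l M] True set_sum_right[of "deriv_span d" "metab_kernel d"] by auto
        moreover have "lie_deriv (act x) (pair_ret (l, M)) \<in> ?R"
          using lie_deriv_in_deriv_span[OF x, of "pair_ret (l, M)" d] pair_ret_in_component[of l M] True
            set_sum_left[of "metab_kernel d" "deriv_span d"] by auto
        ultimately show ?thesis using eq True add_closed_swap[OF R] by auto
      qed (use eq R in \<open>simp add: add_closed_zero\<close>)
    qed
  qed (use ik n R in \<open>simp_all add: mset_deriv_commute additive_metab_pairs metab_pairs_lie_deriv metab_pairs_metab_kernel\<close>)
  also have "lin \<phi> (metab_pairs v) = lin pair_ret (metab_pairs v)"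
    unfolding metab_pairs_def lin_lin
    by (rule lin_words_of_length_cong[OF emb_in_words[OF v(1)]])
      (use v in \<open>auto simp: \<phi>_def metab_word_def split: list.split\<close>)
  finally show ?thesis
    using pair_ret_metab_pairs[OF v] set_sum_right[of "deriv_span d" "metab_kernel d"]
    by (auto simp: add_closed_swap[OF R, of "lin pair_ret (metab_pairs v)"])
qed

end

section \<open>The homogeneous component of prime degree\<close>

context lie_coordinates
begin

text \<open>Lie monomials of degree \<open>d\<close> in the images of the operators \<^term>\<open>cut j\<close> with
  \<open>2 \<le> j \<le> i\<close>, with exactly \<open>m\<close> factors from the image of \<^term>\<open>cut i\<close>.\<close>

inductive lie_mono :: "nat \<Rightarrow> nat \<Rightarrow> nat \<Rightarrow> 'a free_lie \<Rightarrow> bool" for i where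
  base: "2 \<le> j \<Longrightarrow> j \<le> i \<Longrightarrow> w \<in> lie_component j \<Longrightarrow>
    lie_mono i (if j = i then 1 else 0) j (lin (cut j) (emb w))"
| bracket: "lie_mono i m d u \<Longrightarrow> lie_mono i m' d' v \<Longrightarrow> lie_mono i (m + m') (d + d') (lie_bracket u v)"

lemma lin_cut_emb_in_component: "v \<in> lie_component d \<Longrightarrow> 0 < d \<Longrightarrow> lin (cut i) (emb v) \<in> lie_component d"
  by (intro lin_cut_in_lie_component emb_in_words)

lemma lie_mono_degree:
  "lie_mono i m d v \<Longrightarrow> v \<in> lie_component d \<and> 2 \<le> d \<and> 2 \<le> i \<and> m * i \<le> d"
proof (induction rule: lie_mono.induct)
  case (base j w)
  then show ?case by (auto intro: lin_cut_emb_in_component)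
next
  case (bracket m d u m' d' v)
  then show ?case by (auto simp: distrib_right intro: lie_component_bracket)
qed

lemma lie_mono_lower:
  assumes "lie_mono i m d v" "m = 0" shows "\<exists>m'. lie_mono (i - 1) m' d v"
  using assms
proof (induction rule: lie_mono.induct)
  case (base j w)
  then have "j \<le> i - 1" by (auto split: if_splits)
  from lie_mono.base[OF base(1) this base(3)] show ?case by blast
next
  case (bracket m d u m' d' v)
  then show ?case using lie_mono.bracket by (metis add_is_0)
qed

text \<open>In the expansion of a monomial into products of its factors, the operator \<^term>\<open>cut i\<close>
  annihilates the products whose last factor is shorter than \<open>i\<close>. It multiplies a last factor from
  its own image by a constant and brackets the other factors onto it, and the products that end in
  a fixed factor add up to the monomial.\<close>

lemma lin_cut_lie_mono:
  "lie_mono i m d v \<Longrightarrow> i \<le> d \<Longrightarrow> lin (cut i) (emb v) = zscale (fact (i - 2) * int i * int m) v"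
proof (induction rule: lie_mono.induct)
  case (base j w)
  let ?v = "lin (cut i) (emb w)" and ?u = "fact (i - 2) * int i"
  have j: "j = i" using base by simp
  then have k: "?v - zscale ?u w \<in> metab_kernel i"
    using cut_emb_congruence[of w i] base by simp
  then have "lin (cut i) (emb (?v - zscale ?u w)) = 0"
    using base j by (intro cut_emb_metab_kernel) auto
  then show ?case
    by (simp add: j additive.diff[OF additive_emb] additive_zscale[OF additive_emb] lin_diff lin_zscale)
next
  case (bracket m d u m' d' v)
  let ?c = "fact (i - 2) * int i"
  note du = lie_mono_degree[OF bracket.hyps(1)] and dv = lie_mono_degree[OF bracket.hyps(2)]
  have zero: "k = 0" if "k * i \<le> b" "\<not> i \<le> b" for k b :: nat
    using that by (cases k) auto
  have u: "(if i \<le> d then lie_bracket v (lin (cut i) (emb u)) else 0) = zscale (?c * int m) (lie_bracket v u)"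
    using bracket.IH(1) zero[of m d] du by (auto simp: lie_bracket_linear)
  have v: "(if i \<le> d' then lie_bracket u (lin (cut i) (emb v)) else 0) = zscale (?c * int m') (lie_bracket u v)"
    using bracket.IH(2) zero[of m' d'] dv by (auto simp: lie_bracket_linear)
  have "lin (cut i) (emb (lie_bracket u v)) =
      zscale (?c * int m') (lie_bracket u v) - zscale (?c * int m) (lie_bracket v u)"
    using lin_cut_emb_bracket[of u d i v d'] du dv by (simp add: u v)
  also have "\<dots> = zscale (?c * int (m + m')) (lie_bracket u v)"
    unfolding lie_bracket_minus_commute[of v u]
    by (simp add: distrib_left zscale.scale_left_distrib)
  finally show ?case .
qed

definition mono_span :: "nat \<Rightarrow> nat \<Rightarrow> nat \<Rightarrow> 'a free_lie set" where
  "mono_span i k d = additive_span {v. \<exists>m\<le>k. lie_mono i m d v}"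

lemma add_closed_mono_span [simp]: "add_closed (mono_span i k d)"
  by (simp add: mono_span_def)

lemma mono_span_subset: "mono_span i k d \<subseteq> lie_component d"
  unfolding mono_span_def by (rule additive_span_minimal) (use lie_mono_degree in auto)

lemma coprime_below_prime: "prime (p :: nat) \<Longrightarrow> 0 < k \<Longrightarrow> k < p \<Longrightarrow> coprime (int k) (int p)"
  by (metis coprime_commute coprime_int_iff nat_dvd_not_less prime_imp_coprime)

lemma coprime_fact_below_prime: "prime (p :: nat) \<Longrightarrow> k < p \<Longrightarrow> coprime (fact k :: int) (int p)"
  by (metis coprime_commute coprime_int_iff linorder_not_less of_nat_fact prime_dvd_fact_iff prime_imp_coprime)

text \<open>Subtracting from \<^term>\<open>cut i\<close> its largest eigenvalue lowers the maximal number of factors from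
  the image of \<^term>\<open>cut i\<close>, and once there are none, \<open>i\<close> can be lowered. The operators send torsion
  modulo \<open>J\<close> into \<open>J\<close>, and the nonzero eigenvalues are prime to \<open>p\<close>, which is an exponent of the torsion by
  the Dynkin identity.\<close>

lemma mono_span_torsion:
  assumes p: "prime p" and J: "add_closed J"
    and kill: "\<And>z n i. z \<in> lie_component p \<Longrightarrow> n \<noteq> 0 \<Longrightarrow> zscale n z \<in> J \<Longrightarrow> lin (cut i) (emb z) \<in> J"
    and "i < p" "k < p" "z \<in> mono_span i k p" "n \<noteq> 0" "zscale n z \<in> J"
  shows "z \<in> J"
  using assms(4-)
proof (induction i arbitrary: k z n)
  case 0
  have "{v. \<exists>m\<le>k. lie_mono 0 m p v} = {}" using lie_mono_degree[of 0] by force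
  then have "z \<in> additive_span {}" using 0(3) by (simp only: mono_span_def)
  then show ?case using additive_span_minimal[of "{}" J] J by auto
next
  case (Suc i)
  then show ?case
  proof (induction k arbitrary: z n)
    case 0
    have "mono_span (Suc i) 0 p \<subseteq> mono_span i (p - 1) p"
      unfolding mono_span_def
    proof (intro additive_span_mono subsetI CollectI)
      fix v assume "v \<in> {v. \<exists>m\<le>0. lie_mono (Suc i) m p v}"
      then obtain m' where m': "lie_mono i m' p v" using lie_mono_lower by force
      then have "m' * 2 \<le> p" using lie_mono_degree[OF m'] by (metis le_trans mult_le_mono2)
      then have "m' \<le> p - 1" using prime_gt_1_nat[OF p] by linarith
      with m' show "\<exists>m\<le>p - 1. lie_mono i m p v" by blast
    qed
    then show ?case using 0 prime_gt_1_nat[OF p] by (intro 0(1)[of "p - 1" z n]) auto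
  next
    case (Suc k)
    let ?i = "Suc i" and ?u = "fact (Suc i - 2) * int (Suc i)"
    let ?f = "\<lambda>z. lin (cut ?i) (emb z) - zscale (?u * int (Suc k)) z"
    have f: "additive ?f"
      by (intro additive_diff_fun additive_compose[OF additive_lin additive_emb] additive_zscale_fun)
        (simp add: additive_def)
    have z: "z \<in> lie_component p" using Suc.prems(4) mono_span_subset by blast
    have cut: "lin (cut ?i) (emb z) \<in> J" by (rule kill[OF z Suc.prems(5,6)])
    have "?f z \<in> mono_span ?i k p"
    proof (rule additive_image_span[OF f _ _ Suc.prems(4)[unfolded mono_span_def]])
      fix v assume "v \<in> {v. \<exists>m\<le>Suc k. lie_mono ?i m p v}"
      then obtain m where m: "m \<le> Suc k" "lie_mono ?i m p v" by blast
      have "?f v = zscale (?u * int m - ?u * int (Suc k)) v"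
        using lin_cut_lie_mono[OF m(2)] Suc.prems(2) by (simp add: zscale.scale_left_diff_distrib)
      also have "\<dots> \<in> mono_span ?i k p"
      proof (cases "m = Suc k")
        case False
        then have "m \<le> k" using m(1) by simp
        then have "v \<in> mono_span ?i k p"
          unfolding mono_span_def using m(2) by (intro additive_span.base CollectI exI[of _ m] conjI)
        then show ?thesis by (simp add: add_closed_zscale)
      qed (simp add: add_closed_zero)
      finally show "?f v \<in> mono_span ?i k p" .
    qed simp
    moreover have "zscale n (?f z) \<in> J"
    proof -
      have "zscale n (?f z) = zscale n (lin (cut ?i) (emb z)) - zscale (?u * int (Suc k)) (zscale n z)"
        by (simp add: zscale.scale_right_diff_distrib mult.commute)
      also have "\<dots> \<in> J" 
        by (rule add_closed_diff[OF J add_closed_zscale[OF J cut] add_closed_zscale[OF J Suc.prems(6)]])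
      finally show ?thesis .
    qed
    ultimately have "?f z \<in> J"
      using Suc.IH[of "?f z" n] Suc.prems by simp
    from add_closed_diff[OF J cut this] have "zscale (?u * int (Suc k)) z \<in> J" by simp
    moreover have "zscale (int p) z \<in> J"
      using kill[OF z Suc.prems(5,6), of "Suc 0"] by (simp add: dynkin[OF z])
    moreover have "coprime (?u * int (Suc k)) (int p)"
      using coprime_below_prime[OF p, of "Suc i"] coprime_below_prime[OF p, of "Suc k"]
        coprime_fact_below_prime[OF p, of "Suc i - 2"] Suc.prems by (simp del: of_nat_Suc)
    ultimately show ?case using add_closed_coprime[OF J] by blast
  qed
qed

text \<open>Localisation at \<open>p\<close>, expressed through multiples prime to \<open>p\<close>.\<close>

definition saturation :: "nat \<Rightarrow> 'a free_lie set \<Rightarrow> 'a free_lie set" where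
  "saturation p S = {v. \<exists>N. coprime N (int p) \<and> zscale N v \<in> S}"

lemma saturation_multiple: "coprime N (int p) \<Longrightarrow> zscale N v \<in> saturation p S \<Longrightarrow> v \<in> saturation p S"
proof -
  assume "coprime N (int p)" "zscale N v \<in> saturation p S"
  then obtain M where "coprime M (int p)" "zscale M (zscale N v) \<in> S" unfolding saturation_def by blast
  then show "v \<in> saturation p S"
    unfolding saturation_def using \<open>coprime N (int p)\<close> by (auto intro!: exI[of _ "M * N"])
qed

lemma saturation_superset: "S \<subseteq> saturation p S"
  unfolding saturation_def by (auto intro!: exI[of _ 1])

lemma add_closed_saturation: "add_closed S \<Longrightarrow> add_closed (saturation p S)"
  unfolding add_closed_def[of "saturation p S"]
proof (intro conjI ballI)
  assume S: "add_closed S"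
  then show "0 \<in> saturation p S" using saturation_superset add_closed_zero by blast
  fix v w assume "v \<in> saturation p S" "w \<in> saturation p S"
  then obtain N M where NM: "coprime N (int p)" "zscale N v \<in> S" "coprime M (int p)" "zscale M w \<in> S"
    unfolding saturation_def by blast
  have "zscale (N * M) (v - w) = zscale M (zscale N v) - zscale N (zscale M w)"
    by (simp add: zscale.scale_right_diff_distrib mult.commute)
  also have "\<dots> \<in> S"
    by (intro add_closed_diff[OF S]) (rule add_closed_zscale[OF S NM(2)], rule add_closed_zscale[OF S NM(4)])
  finally show "v - w \<in> saturation p S"
    unfolding saturation_def using NM by (auto intro!: exI[of _ "N * M"])
qed

abbreviation all_mono :: "nat \<Rightarrow> nat \<Rightarrow> 'a free_lie set" where
  "all_mono i d \<equiv> additive_span {v. \<exists>m. lie_mono i m d v}"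

lemma metab_kernel_saturated:
  assumes "\<And>i v. 2 \<le> i \<Longrightarrow> i + 2 \<le> d \<Longrightarrow> v \<in> lie_component i \<Longrightarrow> v \<in> saturation p (all_mono r i)"
  shows "metab_kernel d \<subseteq> saturation p (all_mono r d)"
proof (rule metab_kernel_minimal[OF add_closed_saturation])
  fix u v :: "'a free_lie" and i j
  assume uv: "u \<in> lie_component i" "v \<in> lie_component j" "2 \<le> i" "2 \<le> j" "i + j = d"
  then have "u \<in> saturation p (all_mono r i)" "v \<in> saturation p (all_mono r j)"
    using assms by auto
  then obtain N M where NM: "coprime N (int p)" "zscale N u \<in> all_mono r i"
    "coprime M (int p)" "zscale M v \<in> all_mono r j"
    unfolding saturation_def by blast
  have "lie_bracket (zscale N u) (zscale M v) \<in> all_mono r d"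
  proof (rule lie_bracket_span[OF _ _ NM(2,4)])
    fix s t assume "s \<in> {v. \<exists>m. lie_mono r m i v}" "t \<in> {v. \<exists>m. lie_mono r m j v}"
    then have "\<exists>m. lie_mono r m (i + j) (lie_bracket s t)" using lie_mono.bracket by blast
    then show "lie_bracket s t \<in> all_mono r d" using uv(5) by (intro additive_span.base) simp
  qed simp
  then have "zscale (N * M) (lie_bracket u v) \<in> all_mono r d"
    by (simp add: lie_bracket_linear mult.commute)
  then show "lie_bracket u v \<in> saturation p (all_mono r d)"
    unfolding saturation_def using NM by (auto intro!: exI[of _ "N * M"])
qed simp

text \<open>Modulo the second derived ideal, \<^term>\<open>cut d\<close> is multiplication by a number that is prime to
  \<open>p\<close> for \<open>d < p\<close>, and the second derived ideal is generated by brackets of elements of lower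
  degree.\<close>

lemma lie_component_saturated:
  assumes p: "prime p" shows "2 \<le> d \<Longrightarrow> d < p \<Longrightarrow> v \<in> lie_component d \<Longrightarrow> v \<in> saturation p (all_mono (p - 1) d)"
proof (induction d arbitrary: v rule: less_induct)
  case (less d)
  let ?S = "saturation p (all_mono (p - 1) d)" and ?u = "fact (d - 2) * int d"
  have S: "add_closed ?S" by (rule add_closed_saturation) simp
  have "lin (cut d) (emb v) - zscale ?u v \<in> ?S"
    using metab_kernel_saturated[of d p "p - 1"] less cut_emb_congruence[OF less.prems(3,1)] by auto
  moreover have "lin (cut d) (emb v) \<in> all_mono (p - 1) d"
  proof (intro additive_span.base CollectI)
    have "d \<le> p - 1" using less.prems(2) by linarith
    from lie_mono.base[OF less.prems(1) this less.prems(3)]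
    show "\<exists>m. lie_mono (p - 1) m d (lin (cut d) (emb v))" by blast
  qed
  then have "lin (cut d) (emb v) \<in> ?S" using saturation_superset by blast
  ultimately have "zscale ?u v \<in> ?S" using add_closed_swap[OF S] by blast
  moreover have "coprime ?u (int p)"
    using coprime_below_prime[OF p, of d] coprime_fact_below_prime[OF p, of "d - 2"] less.prems by simp
  ultimately show ?case by (rule saturation_multiple[rotated])
qed

text \<open>The factors of a bracket of two commutators of total degree \<open>p\<close> have degrees below \<open>p\<close>, so
  that the monomials generate after localisation and the descent applies.\<close>

lemma metab_kernel_torsion:
  assumes p: "prime p" and J: "add_closed J"
    and kill: "\<And>z n i. z \<in> lie_component p \<Longrightarrow> n \<noteq> 0 \<Longrightarrow> zscale n z \<in> J \<Longrightarrow> lin (cut i) (emb z) \<in> J"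
    and z: "z \<in> metab_kernel p" "n \<noteq> 0" "zscale n z \<in> J"
  shows "z \<in> J"
proof -
  have zp: "z \<in> lie_component p" using z(1) metab_kernel_subset_component by blast
  have "z \<in> saturation p (all_mono (p - 1) p)"
    using metab_kernel_saturated[of p p "p - 1"] lie_component_saturated[OF p] z(1) by fastforce
  then obtain N where N: "coprime N (int p)" "zscale N z \<in> all_mono (p - 1) p"
    unfolding saturation_def by blast
  have "all_mono (p - 1) p \<subseteq> mono_span (p - 1) (p - 1) p"
    unfolding mono_span_def
  proof (rule additive_span_mono, clarify)
    fix v m assume m: "lie_mono (p - 1) m p v"
    then have "m * 2 \<le> p" using lie_mono_degree[OF m] by (metis le_trans mult_le_mono2)
    then have "m \<le> p - 1" using prime_gt_1_nat[OF p] by linarith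
    with m show "\<exists>m\<le>p - 1. lie_mono (p - 1) m p v" by blast
  qed
  then have Nz: "zscale N z \<in> mono_span (p - 1) (p - 1) p" using N(2) by blast
  have "zscale n (zscale N z) = zscale N (zscale n z)" by (simp add: mult.commute)
  then have n: "zscale n (zscale N z) \<in> J" using add_closed_zscale[OF J z(3), of N] by simp
  have "p - 1 < p" using prime_gt_1_nat[OF p] by simp
  have "zscale N z \<in> J"
  proof (rule mono_span_torsion[OF p J _ \<open>p - 1 < p\<close> \<open>p - 1 < p\<close> Nz z(2) n])
    fix w m i assume "w \<in> lie_component p" "m \<noteq> 0" "zscale m w \<in> J"
    from kill[OF this] show "lin (cut i) (emb w) \<in> J" .
  qed
  moreover have "zscale (int p) z \<in> J"
    using kill[OF zp z(2,3), of "Suc 0"] by (simp add: dynkin[OF zp])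
  ultimately show ?thesis using add_closed_coprime[OF J N(1)] by blast
qed

text \<open>Torsion vanishes in the metabelian quotient. In the second derived ideal the descent with
  \<open>J = 0\<close> applies, as the operators factor through the free abelian group on the words.\<close>

theorem lie_component_torsion_free:
  fixes v :: "'a free_lie"
  assumes p: "prime p" and v: "v \<in> lie_component p" "zscale n v = 0" "n \<noteq> 0"
  shows "v = 0"
proof -
  have "v \<in> metab_kernel p"
    by (rule metab_torsion_free[where n = n]) (use v prime_ge_2_nat[OF p] in \<open>simp_all add: add_closed_zero\<close>)
  moreover have "lin (cut i) (emb z) \<in> {0}" if "n \<noteq> 0" "zscale n z \<in> {0}" for z n i
  proof -
    have "zscale n (emb z) = emb (zscale n z)" by (simp add: additive_zscale[OF additive_emb])
    then have "emb z = 0" using that by (simp add: additive.zero[OF additive_emb] zscale_frag_eq_0_iff)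
    then show ?thesis by simp
  qed
  moreover have "zscale n v \<in> {0}" using v(2) by simp
  ultimately have "v \<in> {0}"
    using metab_kernel_torsion[OF p add_closed_singleton_zero _ _ v(3)] by blast
  then show ?thesis by simp
qed

lemma lie_component_Int_second_derived:
  assumes p: "prime p"
  shows "lie_component p \<inter> (second_derived :: 'a free_lie set) = metab_kernel p"
proof
  show "metab_kernel p \<subseteq> lie_component p \<inter> (second_derived :: 'a free_lie set)"
    using metab_kernel_subset_component metab_kernel_subset_second_derived by blast
  show "lie_component p \<inter> (second_derived :: 'a free_lie set) \<subseteq> metab_kernel p"
  proof
    fix v :: "'a free_lie" assume v: "v \<in> lie_component p \<inter> second_derived"
    then obtain N k where k: "\<And>d. k d \<in> metab_kernel d" "v = (\<Sum>d<N. k d)"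
      using second_derived_eq_sum[of v] by blast
    \<comment> \<open>the Dynkin operator restricted to the words of length \<open>p\<close> separates the degrees\<close>
    define g where "g w = (if length w = p then cut (Suc 0) w else 0)" for w
    have g: "lin g (emb u) = (if d = p then zscale (int p) u else 0)" if u: "u \<in> lie_component d" for u d
    proof (cases "d = 0")
      case True
      then show ?thesis using u prime_gt_0_nat[OF p] by (auto simp: lie_component_0 additive.zero[OF additive_emb])
    next
      case False
      then have "lin g (emb u) = lin (\<lambda>w. if d = p then cut (Suc 0) w else 0) (emb u)"
        using u by (intro lin_words_of_length_cong[OF emb_in_words]) (auto simp: g_def)
      then show ?thesis using dynkin[OF u] by simp
    qed
    have "lin g (emb (k d)) = (if d = p then zscale (int p) (k d) else 0)" for d
      using g[of "k d" d] k(1)[of d] metab_kernel_subset_component[of d] by blast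
    then have "lin g (emb v) = (\<Sum>d<N. if d = p then zscale (int p) (k d) else 0)"
      by (simp only: k(2) additive.sum[OF additive_emb] lin_sum)
    also have "\<dots> = zscale (int p) (if p < N then k p else 0)" by simp
    finally have eq: "lin g (emb v) = zscale (int p) (if p < N then k p else 0)" .
    define u where "u = (if p < N then k p else 0)"
    have u: "u \<in> metab_kernel p" using k(1) by (simp add: u_def add_closed_zero)
    have "v - u = 0"
    proof (rule lie_component_torsion_free[OF p])
      show "v - u \<in> lie_component p"
        by (rule add_closed_diff[OF add_closed_lie_component _ subsetD[OF metab_kernel_subset_component u]])
          (use v in blast)
      show "zscale (int p) (v - u) = 0"
        using g[of v p] v eq by (simp add: zscale.scale_right_diff_distrib flip: u_def)
      show "int p \<noteq> 0" using prime_gt_0_nat[OF p] by simp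
    qed
    then show "v \<in> metab_kernel p" using u by simp
  qed
qed

text \<open>The descent for the subgroup \<open>J\<close> that is divided out in the coinvariants.\<close>

lemma torsion_in_metab_kernel:
  assumes p: "prime p" and v: "v \<in> set_sum (deriv_span p) (metab_kernel p)" "zscale n v \<in> deriv_span p" "n \<noteq> 0"
  shows "v \<in> deriv_span p"
proof -
  obtain i k where ik: "v = i + k" "i \<in> deriv_span p" "k \<in> metab_kernel p"
    using v(1) unfolding set_sum_def by blast
  have "zscale n k = zscale n v - zscale n i" by (simp add: ik zscale.scale_right_distrib)
  also have "\<dots> \<in> deriv_span p"
    using v(2) add_closed_zscale[OF _ ik(2)] by (intro add_closed_diff) simp_all
  finally have "k \<in> deriv_span p"
    using metab_kernel_torsion[OF p add_closed_deriv_span _ ik(3) v(3)] cut_torsion prime_gt_0_nat[OF p] by blast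
  then show ?thesis unfolding ik(1) by (intro add_closed_add ik(2)) simp_all
qed

lemma torsion_exponent:
  assumes "v \<in> lie_component d" "0 < d" "zscale n v \<in> deriv_span d" "n \<noteq> 0"
  shows "zscale (int d) v \<in> deriv_span d"
  using cut_torsion[OF assms(1,3,4,2), of "Suc 0"] by (simp add: dynkin[OF assms(1)])

end

section \<open>The map theta in prime degree\<close>

context lie_coordinates
begin

lemma additive_sym_ad_list:
  assumes i: "i \<notin> I" and n: "insert i I = {1..n}" and len: "length xs + length ys + 1 = n"
  shows "additive (\<lambda>f. sym_ad (\<lambda>j. lin le ((xs @ f # ys) ! (j - 1))) I (lin le ((xs @ f # ys) ! (i - 1))))"
proof -
  define k where "k = Suc (length xs)"
  define b where "b j = lin le ((xs @ 0 # ys) ! (j - 1))" for j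
  have fin: "finite I" by (metis finite_atLeastAtMost finite_insert n)
  have nth: "lin le ((xs @ f # ys) ! (j - 1)) = (b(k := lin le f)) j" if "0 < j" for f j
    using that by (auto simp: b_def k_def nth_append nth_Cons split: nat.split)
  have pos: "0 < i" "\<And>j. j \<in> I \<Longrightarrow> 0 < j"
  proof -
    show "0 < i" using n insertI1[of i I] by (auto simp del: insertI1)
    show "\<And>j. j \<in> I \<Longrightarrow> 0 < j" using n by (metis atLeastAtMost_iff insertI2 less_eq_Suc_le One_nat_def)
  qed
  have eq: "sym_ad (\<lambda>j. lin le ((xs @ f # ys) ! (j - 1))) I (lin le ((xs @ f # ys) ! (i - 1))) =
      sym_ad (b(k := lin le f)) I ((b(k := lin le f)) i)" for f
    using nth[OF pos(1)] sym_ad_cong[of I "\<lambda>j. lin le ((xs @ f # ys) ! (j - 1))" "b(k := lin le f)"] nth pos(2)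
    by auto
  have "k \<in> insert i I" unfolding n using len by (simp add: k_def)
  then consider "k = i" | "k \<in> I" "k \<noteq> i" using i by auto
  then show ?thesis
  proof cases
    case 1
    have "sym_ad (b(k := lin le f)) I = sym_ad b I" for f
      using i 1 by (intro ext sym_ad_cong) auto
    then show ?thesis unfolding eq using additive_compose[OF additive_sym_ad additive_lin] 1 by simp
  next
    case 2
    then show ?thesis
      unfolding eq using additive_compose[OF additive_sym_ad_arg[OF fin 2(1)] additive_lin] by simp
  qed
qed

text \<open>Both sides are additive in each entry. On letters, a left-normed product has only two words up
  to reordering all letters but the first: the operator turns them into the two sums of theta.\<close>

lemma lin_cut_emb_left_normed:
  assumes c: "2 \<le> c"
  shows "lin (cut c) (emb (left_normed (map a [1..<Suc c]))) = theta_sum c a"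
proof -
  define \<phi> where "\<phi> q = sym_word (fst q) (SOME w. mset w = snd q)"
    for q :: "('x, 'b) letter \<times> ('x, 'b) letter multiset"
  have \<phi>: "\<phi> (l, mset u) = sym_word l u" for l u
    unfolding \<phi>_def by (simp, rule sym_word_mset) (metis (mono_tags, lifting) someI)
  define G where "G fs = sym_ad (\<lambda>j. lin le (fs ! (j - 1))) (insert 2 {3..c}) (lin le (fs ! (1 - 1)))
      - sym_ad (\<lambda>j. lin le (fs ! (j - 1))) (insert 1 {3..c}) (lin le (fs ! (2 - 1)))" for fs
  have "lin \<phi> (pairs_of_list fs) - G fs \<in> {0}" if "length fs = c" for fs
  proof (rule multiadditive_closed[of c "\<lambda>fs. lin \<phi> (pairs_of_list fs) - G fs"])
    have "multiadditive c G"
      unfolding multiadditive_def G_def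
      by (intro allI impI additive_diff_fun additive_sym_ad_list[of _ _ c]) (use c in auto)
    then show "multiadditive c (\<lambda>fs. lin \<phi> (pairs_of_list fs) - G fs)"
      by (intro multiadditive_diff multiadditive_compose[OF additive_lin] multiadditive_pairs_of_list c)
    fix w :: "('x, 'b) letter list" assume "length w = c"
    then obtain k l u where w: "w = k # l # u" "length u + 2 = c"
      using c by (cases w; cases "tl w") auto
    let ?fs = "map frag_of (k # l # u)"
    have 1: "insert 2 {3..c} = (\<lambda>j. j + 2) ` {..<length (l # u)}"
    proof -
      have "j \<in> (\<lambda>j. j + 2) ` {..<length (l # u)}" if "2 \<le> j" "j \<le> c" for j
        using that w(2) by (intro image_eqI[of _ _ "j - 2"]) auto
      then show ?thesis using w(2) by auto
    qed
    have "sym_ad (\<lambda>j. lin le (?fs ! (j - 1))) (insert 2 {3..c}) (lin le (?fs ! (1 - 1))) =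
        sym_ad (\<lambda>j. lin le (?fs ! (j + 2 - 1))) {..<length (l # u)} (lin le (?fs ! (1 - 1)))"
      unfolding 1 by (rule sym_ad_reindex) (auto simp: inj_on_def)
    also have "\<dots> = sym_word k (l # u)"
      unfolding sym_word_def by (simp, rule sym_ad_cong) (auto simp: nth_Cons split: nat.split)
    finally have A: "sym_ad (\<lambda>j. lin le (?fs ! (j - 1))) (insert 2 {3..c}) (lin le (?fs ! (1 - 1))) = sym_word k (l # u)" .
    let ?h = "\<lambda>j. if j = 0 then 1 else j + 2 :: nat"
    have 2: "insert 1 {3..c} = ?h ` {..<length (k # u)}"
    proof -
      have "j \<in> ?h ` {..<length (k # u)}" if "3 \<le> j" "j \<le> c" for j
        using that w(2) by (intro image_eqI[of _ _ "j - 2"]) auto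
      moreover have "1 \<in> ?h ` {..<length (k # u)}" by (intro image_eqI[of _ _ 0]) auto
      ultimately show ?thesis using w(2) by auto
    qed
    have "sym_ad (\<lambda>j. lin le (?fs ! (j - 1))) (insert 1 {3..c}) (lin le (?fs ! (2 - 1))) =
        sym_ad (\<lambda>j. lin le (?fs ! (?h j - 1))) {..<length (k # u)} (lin le (?fs ! (2 - 1)))"
      unfolding 2 by (rule sym_ad_reindex) (auto simp: inj_on_def)
    also have "\<dots> = sym_word l (k # u)"
      unfolding sym_word_def by (simp, rule sym_ad_cong) (auto simp: nth_Cons split: nat.split)
    finally have B: "sym_ad (\<lambda>j. lin le (?fs ! (j - 1))) (insert 1 {3..c}) (lin le (?fs ! (2 - 1))) = sym_word l (k # u)" .
    show "lin \<phi> (pairs_of_list (map frag_of w)) - G (map frag_of w) \<in> {0}"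
      unfolding w(1) pairs_of_letters G_def A B lin_diff lin_frag_of
      using \<phi>[of k "l # u"] \<phi>[of l "k # u"] by simp
  qed (use that in simp_all)
  from this[of "map coord (map a [1..<Suc c])"]
  have "lin \<phi> (pairs_of_list (map coord (map a [1..<Suc c]))) = G (map coord (map a [1..<Suc c]))" by simp
  also have "\<dots> = theta_sum c a"
  proof -
    let ?fs = "map coord (map a [1..<Suc c])"
    have nth: "lin le (?fs ! (j - 1)) = lie_gen (a j)" if "1 \<le> j" "j \<le> c" for j
    proof -
      have "[1..<Suc c] ! (j - 1) = j" using that by (subst nth_upt) auto
      then show ?thesis using that by (simp add: lin_le_coord del: upt_Suc)
    qed
    have "sym_ad (\<lambda>j. lin le (?fs ! (j - 1))) I = sym_ad (\<lambda>j. lie_gen (a j)) I" if "I \<subseteq> {1..c}" for I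
      using that nth by (intro ext sym_ad_cong) auto
    then show ?thesis
      unfolding G_def theta_sum_eq_sym_ad[OF c] using c nth[of 1] nth[of 2] by (simp del: upt_Suc)
  qed
  finally have "lin \<phi> (metab_pairs (left_normed (map a [1..<Suc c]))) = theta_sum c a"
    using c by (subst metab_pairs_left_normed) simp_all
  moreover have "lin (cut c) (emb (left_normed (map a [1..<Suc c]))) =
      lin \<phi> (metab_pairs (left_normed (map a [1..<Suc c])))"
    unfolding metab_pairs_def lin_lin
  proof (rule lin_words_of_length_cong[OF emb_in_words])
    show "left_normed (map a [1..<Suc c]) \<in> lie_component c"
      using left_normed_in_lie_component[of "map a [1..<Suc c]"] by (simp del: upt_Suc)
    fix w :: "('x, 'b) letter list" assume "length w = c"
    then obtain l u where "w = l # u" "c = Suc (length u)" using c by (cases w) auto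
    then show "cut c w = lin \<phi> (metab_word w)" by (simp add: metab_word_def \<phi>)
  qed (use c in simp)
  ultimately show ?thesis by simp
qed

lemma theta_sum_divisible:
  assumes p: "prime p"
  shows "\<exists>y\<in>lie_component p. zscale (int p) y = theta_sum p a"
proof -
  have p2: "2 \<le> p" by (rule prime_ge_2_nat[OF p])
  let ?P = "\<lambda>S. lie_bracket (sym_ad (\<lambda>i. lie_gen (a i)) S (lie_gen (a 1)))
    (sym_ad (\<lambda>i. lie_gen (a i)) ({3..p} - S) (lie_gen (a 2)))"
  have card: "card {3..p} + 2 = p" using p2 by auto
  have "theta_sum p a = (\<Sum>S\<in>Pow {3..p}. zscale (int (p choose (card S + 1))) (?P S))"
    unfolding theta_sum_eq_sym_ad[OF p2]
    using sym_ad_antisymmetrised[of "{3..p}" 1 2 "\<lambda>i. lie_gen (a i)"] unfolding card by simp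
  also have "\<dots> = (\<Sum>S\<in>Pow {3..p}. zscale (int p) (zscale (int ((p choose (card S + 1)) div p)) (?P S)))"
  proof (rule sum.cong[OF HOL.refl])
    fix S assume "S \<in> Pow {3..p}"
    then have "card S \<le> card {3..p}" by (intro card_mono) auto
    then have "p dvd (p choose (card S + 1))" using card p2 by (intro dvd_choose_prime p) auto
    then have "int (p choose (card S + 1)) = int p * int ((p choose (card S + 1)) div p)"
      by (metis dvd_mult_div_cancel of_nat_mult)
    then show "zscale (int (p choose (card S + 1))) (?P S) =
        zscale (int p) (zscale (int ((p choose (card S + 1)) div p)) (?P S))" by simp
  qed
  also have "\<dots> = zscale (int p) (\<Sum>S\<in>Pow {3..p}. zscale (int ((p choose (card S + 1)) div p)) (?P S))"
    by (simp only: zscale.scale_sum_right)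
  finally have "zscale (int p) (\<Sum>S\<in>Pow {3..p}. zscale (int ((p choose (card S + 1)) div p)) (?P S)) = theta_sum p a" ..
  moreover have "(\<Sum>S\<in>Pow {3..p}. zscale (int ((p choose (card S + 1)) div p)) (?P S)) \<in> lie_component p"
  proof (intro add_closed_sum add_closed_zscale)
    fix S assume "S \<in> Pow {3..p}"
    then have S: "finite S" "S \<subseteq> {3..p}" "card S \<le> card {3..p}"
      using finite_subset[of S "{3..p}"] card_mono[of "{3..p}" S] by auto
    have "(Suc 0 + card S) + (Suc 0 + card ({3..p} - S)) = p"
      using S card card_Diff_subset[OF S(1,2)] by simp
    then show "?P S \<in> lie_component p"
      using lie_component_bracket[OF sym_ad_lie_component[OF lie_gen_in_lie_component, of a S "a 1"]
          sym_ad_lie_component[OF lie_gen_in_lie_component, of a "{3..p} - S" "a 2"]] by simp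
  qed simp_all
  ultimately show ?thesis by blast
qed

text \<open>The map theta on representatives in the free Lie ring. Its construction from an additive
  operator on words replaces the verification that the defining formula respects all relations.\<close>

definition theta_lift :: "nat \<Rightarrow> 'a free_lie \<Rightarrow> 'a free_lie" where
  "theta_lift p v = (THE y. y \<in> lie_component p \<and> zscale (int p) y = lin (cut p) (emb v))"

lemma zscale_cancel:
  assumes "prime p" "v \<in> lie_component p" "w \<in> lie_component p" "zscale n v = zscale n w" "n \<noteq> 0"
  shows "v = (w :: 'a free_lie)"
  using lie_component_torsion_free[OF assms(1), of "v - w" n] assms
  by (simp add: add_closed_diff zscale.scale_right_diff_distrib)

lemma theta_lift:
  assumes p: "prime p" and v: "v \<in> lie_component p"
  shows "theta_lift p v \<in> lie_component p"
    and "zscale (int p) (theta_lift p v) = lin (cut p) (emb v)"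
proof -
  let ?f = "\<lambda>v. lin (cut p) (emb v)"
  have p2: "2 \<le> p" by (rule prime_ge_2_nat[OF p])
  have "?f v \<in> zscale (int p) ` lie_component p"
  proof (rule additive_image_span[OF additive_compose[OF additive_lin additive_emb] _ _ v[unfolded lie_component_def]])
    show "add_closed (zscale (int p) ` lie_component p :: 'a free_lie set)"
      unfolding add_closed_def
    proof (intro conjI ballI)
      show "0 \<in> zscale (int p) ` (lie_component p :: 'a free_lie set)"
        by (rule image_eqI[of _ _ 0]) (simp_all add: add_closed_zero)
      fix v w assume "v \<in> zscale (int p) ` (lie_component p :: 'a free_lie set)" "w \<in> zscale (int p) ` (lie_component p :: 'a free_lie set)"
      then show "v - w \<in> zscale (int p) ` (lie_component p :: 'a free_lie set)"
        by (auto simp: add_closed_diff simp flip: zscale.scale_right_diff_distrib)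
    qed
    fix v assume "v \<in> {left_normed as |as :: 'a list. length as = p}"
    then obtain as :: "'a list" where as: "v = left_normed as" "length as = p" by blast
    have "as = map (\<lambda>i. as ! (i - 1)) [1..<Suc p]"
      by (rule nth_equalityI) (use as in \<open>auto simp del: upt_Suc\<close>)
    then have "?f v = theta_sum p (\<lambda>i. as ! (i - 1))"
      using lin_cut_emb_left_normed[OF p2, of "\<lambda>i. as ! (i - 1)"] by (simp add: as)
    then show "?f v \<in> zscale (int p) ` lie_component p"
      using theta_sum_divisible[OF p, of "\<lambda>i. as ! (i - 1)"] by (metis image_eqI)
  qed
  then obtain y where y: "y \<in> lie_component p" "zscale (int p) y = ?f v" by auto
  have "theta_lift p v \<in> lie_component p \<and> zscale (int p) (theta_lift p v) = ?f v"
    unfolding theta_lift_def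
  proof (rule theI[of _ y])
    fix x assume x: "x \<in> lie_component p \<and> zscale (int p) x = ?f v"
    then show "x = y"
      using zscale_cancel[OF p _ y(1), of x "int p"] y(2) prime_gt_0_nat[OF p] by simp
  qed (use y in simp)
  then show "theta_lift p v \<in> lie_component p" "zscale (int p) (theta_lift p v) = ?f v" by auto
qed

lemma theta_lift_eqI:
  assumes "prime p" "v \<in> lie_component p" "y \<in> lie_component p" "zscale (int p) y = lin (cut p) (emb v)"
  shows "theta_lift p v = y"
proof (rule zscale_cancel[OF assms(1) theta_lift(1)[OF assms(1,2)] assms(3)])
  show "zscale (int p) (theta_lift p v) = zscale (int p) y"
    by (simp only: theta_lift(2)[OF assms(1,2)] assms(4))
  show "int p \<noteq> 0" using prime_gt_0_nat[OF assms(1)] by simp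
qed

lemma theta_lift_add:
  assumes "prime p" "v \<in> lie_component p" "w \<in> lie_component p"
  shows "theta_lift p (v + w) = theta_lift p v + theta_lift p w"
  using assms theta_lift[OF assms(1)]
  by (intro theta_lift_eqI) (auto simp: add_closed_add zscale.scale_right_distrib additive.add[OF additive_emb] lin_add)

lemma theta_lift_metab_kernel:
  assumes "prime p" "v \<in> metab_kernel p" shows "theta_lift p v = 0"
  using assms metab_kernel_subset_component cut_emb_metab_kernel[OF assms(2) prime_ge_2_nat[OF assms(1)]]
  by (intro theta_lift_eqI) (auto simp: add_closed_zero)

lemma theta_lift_left_normed:
  assumes "prime p"
  shows "zscale (int p) (theta_lift p (left_normed (map a [1..<Suc p]))) = theta_sum p a"
  using theta_lift(2)[OF assms, of "left_normed (map a [1..<Suc p])"]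
    left_normed_in_lie_component[of "map a [1..<Suc p]"]
    lin_cut_emb_left_normed[OF prime_ge_2_nat[OF assms], of a] by (simp del: upt_Suc)

lemma theta_lift_lie_deriv:
  assumes p: "prime p" and x: "x \<in> X" and v: "v \<in> lie_component p"
  shows "theta_lift p (lie_deriv (act x) v) = lie_deriv (act x) (theta_lift p v)"
proof (rule theta_lift_eqI[OF p])
  have "zscale (int p) (lie_deriv (act x) (theta_lift p v)) = lie_deriv (act x) (lin (cut p) (emb v))"
    by (simp add: theta_lift(2)[OF p v] flip: additive_zscale[OF additive_lie_deriv[OF x]])
  also have "\<dots> = lin (cut p) (lin (word_deriv x) (emb v))"
    by (simp add: lin_lin lin_cut_word_deriv[OF x] additive_lin_comp[OF additive_lie_deriv[OF x]])
  finally show "zscale (int p) (lie_deriv (act x) (theta_lift p v)) = lin (cut p) (emb (lie_deriv (act x) v))"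
    by (simp add: emb_lie_deriv[OF x])
qed (use x v theta_lift[OF p v] lie_deriv_lie_component in auto)

text \<open>Division by \<open>p\<close> is possible in the congruence because the metabelian component is torsion free.\<close>

lemma theta_lift_congruence:
  assumes p: "prime p" and v: "v \<in> lie_component p"
  shows "theta_lift p v - zscale (fact (p - 2)) v \<in> metab_kernel p"
proof (rule metab_torsion_free[where n = "int p"])
  have "zscale (int p) (theta_lift p v - zscale (fact (p - 2)) v) =
      lin (cut p) (emb v) - zscale (fact (p - 2) * int p) v"
    by (simp add: zscale.scale_right_diff_distrib theta_lift(2)[OF p v] mult.commute)
  then show "zscale (int p) (theta_lift p v - zscale (fact (p - 2)) v) \<in> metab_kernel p"
    using cut_emb_congruence[OF v prime_ge_2_nat[OF p]] by simp
  show "theta_lift p v - zscale (fact (p - 2)) v \<in> lie_component p"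
    by (rule add_closed_diff[OF _ theta_lift(1)[OF p v] add_closed_zscale[OF _ v]]) simp_all
qed (use prime_ge_2_nat[OF p] in auto)

end

section \<open>Coordinates of a free module over the polynomial ring\<close>

lemma zvar_in_zpoly_ring: "x \<in> X \<Longrightarrow> zvar x \<in> carrier (zpoly_ring X)"
  by (simp add: zpoly_ring_def zvar_def)

lemma add_closed_zpoly_ring: "add_closed (carrier (zpoly_ring X))"
  by (auto simp: add_closed_def zpoly_ring_def dest!: subsetD[OF keys_diff])

lemma zvar_times_monomial: "zvar x * Poly_Mapping.single m 1 = Poly_Mapping.single (m + Poly_Mapping.single x 1) 1"
  by (simp add: zvar_def mult_single add.commute)

lemma keys_shift_subset: "x \<in> X \<Longrightarrow> Poly_Mapping.keys (m + Poly_Mapping.single x (1::nat)) \<subseteq> X \<longleftrightarrow> Poly_Mapping.keys m \<subseteq> X"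
proof -
  assume "x \<in> X"
  have "Poly_Mapping.keys (m + Poly_Mapping.single x (1::nat)) = insert x (Poly_Mapping.keys m)"
    by (auto simp: in_keys_iff lookup_add lookup_single when_def split: if_splits)
  then show ?thesis using \<open>x \<in> X\<close> by simp
qed

locale zpoly_module =
  fixes X :: "'x set" and s :: "'x zpoly \<Rightarrow> 'a::ab_group_add \<Rightarrow> 'a"
  assumes module: "Module.module (zpoly_ring X) (ab_module UNIV s)"
begin

abbreviation "R \<equiv> carrier (zpoly_ring X)"

lemma smult_simps:
  assumes "f \<in> R"
  shows "s f (v + w) = s f v + s f w"
    and "g \<in> R \<Longrightarrow> s (f + g) v = s f v + s g v"
    and "g \<in> R \<Longrightarrow> s (f * g) v = s f (s g v)"
    and "s 1 v = v"
  using module.smult_r_distr[OF module assms, of v w] module.smult_l_distr[OF module assms, of g v]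
    module.smult_assoc1[OF module assms, of g v] module.smult_one[OF module, of v]
  by (simp_all add: ab_module_def zpoly_ring_def)

lemma additive_smult: "f \<in> R \<Longrightarrow> additive (s f)"
  by (simp add: additive_def smult_simps(1))

lemma smult_diff: "f \<in> R \<Longrightarrow> g \<in> R \<Longrightarrow> s (f - g) v = s f v - s g v"
  using smult_simps(2)[of "f - g" g v] add_closed_diff[OF add_closed_zpoly_ring, of f X g] by simp

lemma smult_zero: "s 0 v = 0"
  using smult_diff[of 0 0 v] add_closed_zero[OF add_closed_zpoly_ring, of X] by simp

lemma act_commute: "x \<in> X \<Longrightarrow> y \<in> X \<Longrightarrow> s (zvar x) (s (zvar y) v) = s (zvar y) (s (zvar x) v)"
  by (metis mult.commute smult_simps(3) zvar_in_zpoly_ring)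

lemma finsum_ab_module:
  assumes "finite F" shows "finsum (ab_module UNIV s) f F = sum f F"
proof -
  interpret M: Module.module "zpoly_ring X" "ab_module UNIV s" by (rule module)
  show ?thesis
    using assms
  proof induction
    case (insert x F)
    have "f \<in> F \<rightarrow> carrier (ab_module UNIV s)" "f x \<in> carrier (ab_module UNIV s)"
      by (auto simp: ab_module_def)
    from M.finsum_insert[OF insert(1,2) this] show ?case
      by (simp add: insert) (simp add: ab_module_def)
  qed (simp, simp add: ab_module_def)
qed

end

text \<open>The products of a monomial in \<open>X\<close> with an element of a module basis form a \<open>\<int>\<close>-basis, on which
  the variables act by shifting the monomial.\<close>

theorem free_module_coordinates:
  fixes s :: "'x zpoly \<Rightarrow> 'a::ab_group_add \<Rightarrow> 'a"
  assumes X: "finite X" and free: "free_module (zpoly_ring X) (ab_module UNIV s)"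
  shows "\<exists>coord (e :: ('x, 'a) letter \<Rightarrow> 'a). lie_coordinates X (\<lambda>x. s (zvar x)) coord e"
proof -
  interpret zpoly_module X s using free by (simp add: zpoly_module_def free_module_def)
  obtain B where B: "module_basis (zpoly_ring X) (ab_module UNIV s) B"
    using free by (auto simp: free_module_def)
  define represents where "represents v k \<longleftrightarrow> k \<in> B \<rightarrow>\<^sub>E R \<and> finite {b \<in> B. k b \<noteq> 0} \<and>
    v = (\<Sum>b\<in>{b \<in> B. k b \<noteq> 0}. s (k b) b)" for v k
  have coeffs: "\<exists>!k. represents v k" for v
  proof -
    have fs: "(finite F \<and> v = finsum (ab_module UNIV s) f F) = (finite F \<and> v = sum f F)" for f F
      by (auto simp: finsum_ab_module)
    have rec: "v \<in> carrier (ab_module UNIV s)" "\<zero>\<^bsub>zpoly_ring X\<^esub> = 0"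
      "\<And>r v. r \<odot>\<^bsub>ab_module UNIV s\<^esub> v = s r v"
      by (simp_all add: ab_module_def zpoly_ring_def)
    from B[unfolded module_basis_def, THEN conjunct2, rule_format, OF rec(1)]
    show ?thesis unfolding rec(2,3) fs represents_def .
  qed
  have coeffs_unique: "k = k'" if "represents v k" "represents v k'" for k k' v
    using coeffs[of v] that by blast
  define good where "good = {c :: ('x, 'a) letter \<Rightarrow>\<^sub>0 int. Poly_Mapping.keys c \<subseteq> {q. Poly_Mapping.keys (fst q) \<subseteq> X \<and> snd q \<in> B}}"
  have good: "add_closed good" by (auto simp: good_def add_closed_def dest!: subsetD[OF keys_diff])
  define e where "e q = (if Poly_Mapping.keys (fst q) \<subseteq> X \<and> snd q \<in> B
    then s (Poly_Mapping.single (fst q) 1) (snd q) else 0)" for q :: "('x, 'a) letter"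
  have mono_R: "Poly_Mapping.single m k \<in> R" if "Poly_Mapping.keys m \<subseteq> X" for m k
    using that by (simp add: zpoly_ring_def)
  have s_lin: "s f b = lin (\<lambda>m. s (Poly_Mapping.single m 1) b) f" if f: "f \<in> R" for f b
  proof -
    have "Poly_Mapping.keys f \<subseteq> {m. Poly_Mapping.keys m \<subseteq> X}" using f by (auto simp: zpoly_ring_def)
    then have "f \<in> R \<and> s f b = lin (\<lambda>m. s (Poly_Mapping.single m 1) b) f"
    proof (induction rule: frag_induction)
      case (diff f g)
      then show ?case by (auto simp: smult_diff lin_diff add_closed_diff[OF add_closed_zpoly_ring])
    qed (use mono_R in \<open>simp_all add: add_closed_zero[OF add_closed_zpoly_ring] smult_zero\<close>)
    then show ?thesis by simp
  qed
  have surj: "\<exists>c\<in>good. lin e c = v" for v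
  proof -
    obtain k where k: "k \<in> B \<rightarrow>\<^sub>E R" "finite {b \<in> B. k b \<noteq> 0}" "v = (\<Sum>b\<in>{b \<in> B. k b \<noteq> 0}. s (k b) b)"
      using coeffs[of v] unfolding represents_def by blast
    let ?c = "\<Sum>b\<in>{b \<in> B. k b \<noteq> 0}. lin (\<lambda>m. frag_of (m, b)) (k b)"
    have kb: "\<forall>m\<in>Poly_Mapping.keys (k b). Poly_Mapping.keys m \<subseteq> X" if "b \<in> B" for b
      using that k(1) by (auto simp: zpoly_ring_def)
    have "?c \<in> good"
    proof (intro add_closed_sum[OF good] lin_closed[OF good])
      fix b m assume "b \<in> {b \<in> B. k b \<noteq> 0}" "m \<in> Poly_Mapping.keys (k b)"
      then show "frag_of (m, b) \<in> good" using kb[of b] by (auto simp: good_def keys_frag_of)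
    qed
    moreover have "lin e ?c = v"
      unfolding lin_sum lin_lin k(3)
    proof (rule sum.cong[OF HOL.refl])
      fix b assume b: "b \<in> {b \<in> B. k b \<noteq> 0}"
      have "lin (\<lambda>m. lin e (frag_of (m, b))) (k b) = lin (\<lambda>m. s (Poly_Mapping.single m 1) b) (k b)"
        by (rule lin_cong) (use b kb in \<open>auto simp: e_def\<close>)
      also have "\<dots> = s (k b) b" using b k(1) by (intro s_lin[symmetric]) auto
      finally show "lin (\<lambda>m. lin e (frag_of (m, b))) (k b) = s (k b) b" .
    qed
    ultimately show ?thesis by blast
  qed
  have inj: "c = c'" if "c \<in> good" "c' \<in> good" "lin e c = lin e c'" for c c'
  proof -
    \<comment> \<open>the polynomial coefficient of the basis element \<open>b\<close>\<close>
    define kf where "kf c b = lin (\<lambda>q. if snd q = b then frag_of (fst q) else 0) c"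
      for c :: "('x, 'a) letter \<Rightarrow>\<^sub>0 int" and b
    have lookup_kf: "Poly_Mapping.lookup (kf c b) m = Poly_Mapping.lookup c (m, b)" for c b m
    proof (rule additive_frag_eq[where f = c])
      show "additive (\<lambda>c. Poly_Mapping.lookup (kf c b) m)" "additive (\<lambda>c :: _ \<Rightarrow>\<^sub>0 int. Poly_Mapping.lookup c (m, b))"
        by (simp_all add: additive_def kf_def lin_add lookup_add)
      fix q
      show "Poly_Mapping.lookup (kf (frag_of q) b) m = Poly_Mapping.lookup (frag_of q) (m, b)"
        by (cases q) (auto simp: kf_def lookup_single when_def)
    qed
    have kf_R: "kf c b \<in> R" if "c \<in> good" for c b
      unfolding kf_def
      by (rule lin_closed[OF add_closed_zpoly_ring])
        (use that in \<open>auto simp: good_def mono_R add_closed_zero[OF add_closed_zpoly_ring]\<close>)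
    have kf: "represents (lin e c) (restrict (kf c) B)" if c: "c \<in> good" for c
      unfolding represents_def
    proof (intro conjI)
      let ?S = "snd ` Poly_Mapping.keys c"
      have SB: "?S \<subseteq> B" using c by (auto simp: good_def)
      have supp: "{b \<in> B. restrict (kf c) B b \<noteq> 0} \<subseteq> ?S"
      proof
        fix b assume "b \<in> {b \<in> B. restrict (kf c) B b \<noteq> 0}"
        then obtain m where "Poly_Mapping.lookup (kf c b) m \<noteq> 0"
          by (auto simp: poly_mapping_eq_iff fun_eq_iff)
        then show "b \<in> ?S" by (intro image_eqI[of _ _ "(m, b)"]) (auto simp: lookup_kf in_keys_iff)
      qed
      then show "finite {b \<in> B. restrict (kf c) B b \<noteq> 0}" by (rule finite_subset) simp
      show "restrict (kf c) B \<in> B \<rightarrow>\<^sub>E R" using kf_R[OF c] by auto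
      have "(\<Sum>b\<in>{b \<in> B. restrict (kf c) B b \<noteq> 0}. s (restrict (kf c) B b) b) = (\<Sum>b\<in>?S. s (kf c b) b)"
        by (rule sum.mono_neutral_cong_left) (use supp SB in \<open>auto simp: smult_zero\<close>)
      also have "\<dots> = (\<Sum>b\<in>?S. lin (\<lambda>q. if snd q = b then s (Poly_Mapping.single (fst q) 1) b else 0) c)"
      proof (rule sum.cong[OF HOL.refl])
        fix b
        have "s (kf c b) b = lin (\<lambda>m. s (Poly_Mapping.single m 1) b) (kf c b)" by (rule s_lin[OF kf_R[OF c]])
        also have "\<dots> = lin (\<lambda>q. if snd q = b then s (Poly_Mapping.single (fst q) 1) b else 0) c"
          unfolding kf_def lin_lin by (rule lin_cong) simp
        finally show "s (kf c b) b = lin (\<lambda>q. if snd q = b then s (Poly_Mapping.single (fst q) 1) b else 0) c" .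
      qed
      also have "\<dots> = lin (\<lambda>q. \<Sum>b\<in>?S. if snd q = b then s (Poly_Mapping.single (fst q) 1) b else 0) c"
        unfolding lin_def zscale.scale_sum_right by (rule sum.swap)
      also have "\<dots> = lin e c"
      proof (rule lin_cong)
        fix q assume q: "q \<in> Poly_Mapping.keys c"
        then have "snd q \<in> ?S" by simp
        then have "(\<Sum>b\<in>?S. if snd q = b then s (Poly_Mapping.single (fst q) 1) b else 0) =
            s (Poly_Mapping.single (fst q) 1) (snd q)"
          by (subst sum.delta') simp_all
        then show "(\<Sum>b\<in>?S. if snd q = b then s (Poly_Mapping.single (fst q) 1) b else 0) = e q"
          using q c by (auto simp: e_def good_def)
      qed
      finally show "lin e c = (\<Sum>b\<in>{b \<in> B. restrict (kf c) B b \<noteq> 0}. s (restrict (kf c) B b) b)" by simp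
    qed
    have "restrict (kf c) B = restrict (kf c') B"
      by (rule coeffs_unique[OF kf[OF that(1)] kf[OF that(2), folded that(3)]])
    then have "Poly_Mapping.lookup c (m, b) = Poly_Mapping.lookup c' (m, b)" if "b \<in> B" for m b
      using that by (metis lookup_kf restrict_apply)
    moreover have "Poly_Mapping.lookup c (m, b) = 0 \<and> Poly_Mapping.lookup c' (m, b) = 0" if "b \<notin> B" for m b
      using that \<open>c \<in> good\<close> \<open>c' \<in> good\<close> by (auto simp: good_def in_keys_iff subset_iff)
    ultimately show ?thesis by (metis poly_mapping_eqI surj_pair)
  qed
  define coord where "coord v = (THE c. c \<in> good \<and> lin e c = v)" for v
  have coord: "coord v \<in> good \<and> lin e (coord v) = v" for v
    unfolding coord_def by (rule theI') (use surj inj in blast)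
  have coord_eqI: "coord v = c" if "c \<in> good" "lin e c = v" for c v
    using inj[of "coord v" c] coord that by simp
  have e_shift: "e (shift x l) = s (zvar x) (e l)" if x: "x \<in> X" for x l
  proof (cases "Poly_Mapping.keys (fst l) \<subseteq> X \<and> snd l \<in> B")
    case True
    then show ?thesis
      using x keys_shift_subset[OF x, of "fst l"] smult_simps(3)[OF zvar_in_zpoly_ring[OF x] mono_R]
      by (simp add: e_def shift_def zvar_times_monomial[symmetric] del: One_nat_def)
  next
    case False
    then show ?thesis
      using keys_shift_subset[OF x, of "fst l"] additive.zero[OF additive_smult[OF zvar_in_zpoly_ring[OF x]]]
      by (auto simp: e_def shift_def)
  qed
  have "lie_coordinates X (\<lambda>x. s (zvar x)) coord e"
  proof (rule lie_coordinates.intro)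
    fix x and l :: "('x, 'a) letter" and a assume x: "x \<in> X"
    show "additive (s (zvar x))" by (rule additive_smult[OF zvar_in_zpoly_ring[OF x]])
    show "e (shift x l) = s (zvar x) (e l)" by (rule e_shift[OF x])
    show "coord (s (zvar x) a) = lin (\<lambda>l. frag_of (shift x l)) (coord a)"
    proof (rule coord_eqI)
      show "lin (\<lambda>l. frag_of (shift x l)) (coord a) \<in> good"
      proof (rule lin_closed[OF good])
        fix q assume "q \<in> Poly_Mapping.keys (coord a)"
        then have "Poly_Mapping.keys (fst q) \<subseteq> X" "snd q \<in> B" using coord[of a] by (auto simp: good_def)
        then show "frag_of (shift x q) \<in> good"
          using keys_shift_subset[OF x, of "fst q"] by (simp add: good_def keys_frag_of shift_def)
      qed
      show "lin e (lin (\<lambda>l. frag_of (shift x l)) (coord a)) = s (zvar x) a"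
        using additive_lin_comp[OF additive_smult[OF zvar_in_zpoly_ring[OF x]], of e "coord a"] coord[of a]
        by (simp add: lin_lin e_shift[OF x])
    qed
  next
    show "additive coord"
    proof
      fix v w show "coord (v + w) = coord v + coord w"
        by (rule coord_eqI) (use coord in \<open>simp_all add: add_closed_add[OF good] lin_add\<close>)
    qed
  qed (use X coord in simp_all)
  then show ?thesis by blast
qed

section \<open>The action of the polynomial ring on the Lie components\<close>

locale lie_zpoly = lie_coordinates X "\<lambda>x. s (zvar x)" coord e
  for X :: "'x set" and s :: "'x zpoly \<Rightarrow> 'a::ab_group_add \<Rightarrow> 'a"
    and coord :: "'a \<Rightarrow> ('x, 'b) letter \<Rightarrow>\<^sub>0 int" and e :: "('x, 'b) letter \<Rightarrow> 'a" +
  assumes act_commute: "x \<in> X \<Longrightarrow> y \<in> X \<Longrightarrow> s (zvar x) (s (zvar y) v) = s (zvar y) (s (zvar x) v)"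
begin

abbreviation D :: "'x \<Rightarrow> 'a free_lie \<Rightarrow> 'a free_lie" where "D x \<equiv> lie_deriv (s (zvar x))"

lemma D_commute: "x \<in> X \<Longrightarrow> y \<in> X \<Longrightarrow> D x (D y v) = D y (D x v)"
proof (induction v rule: free_lie_induct)
  case (gen a)
  then show ?case by (simp add: lie_deriv(1)[OF act_additive] act_commute)
next
  case (bracket v w)
  then show ?case
    by (simp add: lie_deriv_bracket additive.add[OF additive_lie_deriv] algebra_simps)
qed (simp_all add: additive.add[OF additive_lie_deriv] additive.minus[OF additive_lie_deriv]
    additive.zero[OF additive_lie_deriv])

lemma D_funpow_commute: "x \<in> X \<Longrightarrow> y \<in> X \<Longrightarrow> (D x ^^ m) ((D y ^^ n) v) = (D y ^^ n) ((D x ^^ m) v)"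
proof -
  assume xy: "x \<in> X" "y \<in> X"
  have 1: "D x ((D y ^^ n) v) = (D y ^^ n) (D x v)" for v
    by (induction n) (simp_all add: D_commute[OF xy])
  show ?thesis by (induction m) (simp_all add: 1)
qed

abbreviation monom_fold where
  "monom_fold m v F \<equiv> Finite_Set.fold (\<lambda>x. D x ^^ Poly_Mapping.lookup m x) v F"

lemma monom_fold_insert:
  assumes "F \<subseteq> X" "x \<in> X" "x \<notin> F"
  shows "monom_fold m v (insert x F) = (D x ^^ Poly_Mapping.lookup m x) (monom_fold m v F)"
proof -
  interpret comp_fun_commute_on X "\<lambda>x. D x ^^ Poly_Mapping.lookup m x"
    by unfold_locales (simp add: fun_eq_iff D_funpow_commute)
  show ?thesis using assms finite_subset[OF assms(1) finite_X] by (intro fold_insert) auto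
qed

lemma monom_fold:
  assumes F: "F \<subseteq> X" and S: "\<And>x v. x \<in> X \<Longrightarrow> v \<in> S \<Longrightarrow> D x v \<in> S"
  shows "additive (\<lambda>v. monom_fold m v F)"
    and "v \<in> S \<Longrightarrow> monom_fold m v F \<in> S"
    and "v \<in> lie_component d \<Longrightarrow> x \<in> F \<Longrightarrow> Poly_Mapping.lookup m x \<noteq> 0 \<Longrightarrow> monom_fold m v F \<in> deriv_span d"
proof -
  have fin: "finite F" using finite_subset[OF F finite_X] .
  have pow: "(D x ^^ n) v \<in> T" if "x \<in> X" "v \<in> T" "\<And>v. v \<in> T \<Longrightarrow> D x v \<in> T" for x n v T
    using that by (induction n) auto
  show "additive (\<lambda>v. monom_fold m v F)"
    using fin F
  proof induction
    case (insert x F)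
    then have "additive (\<lambda>v. (D x ^^ Poly_Mapping.lookup m x) (monom_fold m v F))"
      by (intro additive_compose[OF additive_funpow[OF additive_lie_deriv]]) auto
    then show ?case using insert by (simp add: monom_fold_insert)
  qed (simp add: additive_def)
  have mem: "v \<in> T \<Longrightarrow> monom_fold m v F \<in> T"
    if "\<And>x v. x \<in> X \<Longrightarrow> v \<in> T \<Longrightarrow> D x v \<in> T" "F \<subseteq> X" "finite F" for T v F
    using that(3,2)
  proof induction
    case (insert x F)
    then show ?case using pow[of x _ T] that(1) by (simp add: monom_fold_insert)
  qed simp
  show "v \<in> S \<Longrightarrow> monom_fold m v F \<in> S" by (rule mem[OF S F fin])
  assume v: "v \<in> lie_component d" and x: "x \<in> F" "Poly_Mapping.lookup m x \<noteq> 0"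
  obtain n where n: "Poly_Mapping.lookup m x = Suc n" using x(2) not0_implies_Suc by blast
  have "insert x (F - {x}) = F" using x by auto
  then have "monom_fold m v F = (D x ^^ Suc n) (monom_fold m v (F - {x}))"
    using monom_fold_insert[of "F - {x}" x m v] F x n by auto
  also have "\<dots> = D x ((D x ^^ n) (monom_fold m v (F - {x})))" by simp
  also have "\<dots> \<in> deriv_span d"
  proof (intro lie_deriv_in_deriv_span pow)
    show "monom_fold m v (F - {x}) \<in> lie_component d"
      by (rule mem) (use v F fin lie_deriv_lie_component in auto)
  qed (use x F lie_deriv_lie_component in auto)
  finally show "monom_fold m v F \<in> deriv_span d" .
qed

lemma zpoly_action_additive:
  assumes "r \<in> carrier (zpoly_ring X)" shows "additive (zpoly_action D r)"
proof -
  have "additive (\<lambda>v. zpoly_action D r v)"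
    unfolding zpoly_action_def monom_action_def
    by (intro additive_sum_fun additive_zscale_fun monom_fold(1)[of _ UNIV])
      (use assms in \<open>auto simp: zpoly_ring_def\<close>)
  then show ?thesis .
qed

lemma zpoly_action_closed:
  assumes "r \<in> carrier (zpoly_ring X)" "add_closed S" "\<And>x v. x \<in> X \<Longrightarrow> v \<in> S \<Longrightarrow> D x v \<in> S" "v \<in> S"
  shows "zpoly_action D r v \<in> S"
  unfolding zpoly_action_def monom_action_def
  by (intro add_closed_sum[OF assms(2)] add_closed_zscale[OF assms(2)] monom_fold(2)[of _ S])
    (use assms in \<open>auto simp: zpoly_ring_def\<close>)

lemma zpoly_action_trivial:
  assumes r: "r \<in> carrier (zpoly_ring X)" and v: "v \<in> lie_component d"
  shows "zpoly_action D r v - zscale (Poly_Mapping.lookup r 0) v \<in> deriv_span d"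
proof -
  let ?t = "\<lambda>m. zscale (Poly_Mapping.lookup r m) (monom_action D m v)"
  have "zpoly_action D r v = (\<Sum>m\<in>insert 0 (Poly_Mapping.keys r). ?t m)"
    unfolding zpoly_action_def by (rule sum.mono_neutral_left) (auto simp: in_keys_iff)
  also have "\<dots> = ?t 0 + (\<Sum>m\<in>Poly_Mapping.keys r - {0}. ?t m)"
    by (subst sum.insert_remove) auto
  also have "monom_action D 0 v = v" by (simp add: monom_action_def)
  finally have "zpoly_action D r v - zscale (Poly_Mapping.lookup r 0) v = (\<Sum>m\<in>Poly_Mapping.keys r - {0}. ?t m)"
    by simp
  also have "\<dots> \<in> deriv_span d"
  proof (intro add_closed_sum add_closed_zscale)
    fix m assume m: "m \<in> Poly_Mapping.keys r - {0}"
    then obtain x where "x \<in> Poly_Mapping.keys m" by (metis Diff_iff all_not_in_conv keys_eq_empty singletonI)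
    then show "monom_action D m v \<in> deriv_span d"
      unfolding monom_action_def using m r v
      by (intro monom_fold(3)[of _ UNIV _ _ x]) (auto simp: zpoly_ring_def in_keys_iff)
  qed simp_all
  finally show ?thesis .
qed

end

section \<open>Tensor products with the trivial module\<close>

lemma trivial_module_simps [simp]:
  "carrier trivial_module = UNIV" "(\<oplus>\<^bsub>trivial_module\<^esub>) = (+)"
  "r \<odot>\<^bsub>trivial_module\<^esub> w = Poly_Mapping.lookup r 0 * w"
  by (simp_all add: trivial_module_def ab_module_def)

lemma zscale_frag: "zscale k f = frag_cmul k f"
  by (simp add: poly_mapping_eq_iff fun_eq_iff)

lemma frag_extend_eq_lin: "frag_extend b f = lin b f"
  by (simp add: frag_extend_def lin_def zscale_frag)

lemma almost_additive_zscale: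
  fixes f :: "'a::ab_group_add \<Rightarrow> 'v::ab_group_add"
  assumes S: "add_closed S" and V: "add_closed V"
    and add: "\<And>u v. u \<in> V \<Longrightarrow> v \<in> V \<Longrightarrow> f (u + v) - (f u + f v) \<in> S" and v: "v \<in> V"
  shows "f (zscale k v) - zscale k (f v) \<in> S"
proof -
  have "f (0 + 0) - (f 0 + f 0) \<in> S" by (rule add) (use add_closed_zero[OF V] in simp_all)
  then have zero: "f 0 \<in> S" using add_closed_uminus[OF S, of "- f 0"] by simp
  have step: "f (zscale (i + 1) v) - zscale (i + 1) (f v) \<in> S \<longleftrightarrow> f (zscale i v) - zscale i (f v) \<in> S" for i
  proof -
    have "f (zscale i v + v) - (f (zscale i v) + f v) \<in> S" by (intro add add_closed_zscale V v)
    then have "(f (zscale (i + 1) v) - zscale (i + 1) (f v)) - (f (zscale i v) - zscale i (f v)) \<in> S"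
      by (simp add: zscale_succ algebra_simps)
    then show ?thesis using add_closed_swap[OF S] by blast
  qed
  show ?thesis
  proof (induction k rule: int_induct[of _ 0])
    case (step2 i)
    then show ?case using step[of "i - 1"] by simp
  qed (use zero step in simp_all)
qed

lemma tensor_relators_left: "c \<in> carrier M \<Longrightarrow> c' \<in> carrier M \<Longrightarrow>
    frag_of (c \<oplus>\<^bsub>M\<^esub> c', w) - frag_of (c, w) - frag_of (c', w)
      \<in> additive_span (tensor_relators (zpoly_ring X) M trivial_module)"
  by (rule additive_span.base, unfold tensor_relators_def trivial_module_simps) blast

lemma tensor_relators_right: "c \<in> carrier M \<Longrightarrow> frag_of (c, w + w') - frag_of (c, w) - frag_of (c, w')
      \<in> additive_span (tensor_relators (zpoly_ring X) M trivial_module)"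
  by (rule additive_span.base, unfold tensor_relators_def trivial_module_simps) blast

lemma tensor_relators_smult: "r \<in> carrier (zpoly_ring X) \<Longrightarrow> c \<in> carrier M \<Longrightarrow>
    frag_of (r \<odot>\<^bsub>M\<^esub> c, w) - frag_of (c, Poly_Mapping.lookup r 0 * w)
      \<in> additive_span (tensor_relators (zpoly_ring X) M trivial_module)"
  by (rule additive_span.base, unfold tensor_relators_def trivial_module_simps) blast

lemma tensor_relators_zvar:
  assumes "x \<in> X" "c \<in> carrier M"
  shows "frag_of (zvar x \<odot>\<^bsub>M\<^esub> c, 1) \<in> additive_span (tensor_relators (zpoly_ring X) M trivial_module)"
proof -
  let ?R = "additive_span (tensor_relators (zpoly_ring X) M trivial_module)"
  have "- frag_of (c, 0) \<in> ?R" using tensor_relators_right[OF assms(2), of 0 0 X] by simp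
  then have "frag_of (c, 0) \<in> ?R" using add_closed_uminus[OF add_closed_span] by fastforce
  moreover have "Poly_Mapping.lookup (zvar x) 0 = 0"
    by (auto simp: zvar_def lookup_single when_def poly_mapping_eq_iff fun_eq_iff)
  then have "frag_of (zvar x \<odot>\<^bsub>M\<^esub> c, 1) - frag_of (c, 0) \<in> ?R"
    using tensor_relators_smult[OF zvar_in_zpoly_ring[OF assms(1)] assms(2), of 1] by simp
  ultimately show ?thesis using add_closed_swap[OF add_closed_span] by blast
qed

lemma tensor_relators_idem:
  assumes "c \<in> carrier M" "c \<oplus>\<^bsub>M\<^esub> c = c"
  shows "frag_of (c, 1) \<in> additive_span (tensor_relators (zpoly_ring X) M trivial_module)"
proof -
  have "- frag_of (c, 1) \<in> additive_span (tensor_relators (zpoly_ring X) M trivial_module)"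
    using tensor_relators_left[OF assms(1,1), of 1 X] assms(2) by simp
  then show ?thesis using add_closed_uminus[OF add_closed_span] by fastforce
qed

text \<open>A presentation of a module \<open>M\<close> by a group \<open>L\<close> of representatives, with class map \<open>\<eta>\<close> and
  section \<open>\<sigma>\<close>. The subgroup \<open>Q\<close> of \<open>L\<close>, generated by \<open>S\<close>, is that of the
  representatives whose class vanishes in the coinvariants of \<open>M\<close>.\<close>

locale trivial_tensor =
  fixes X :: "'x set" and M :: "('x zpoly, 'c) module" and \<eta> :: "'v::ab_group_add \<Rightarrow> 'c"
    and \<sigma> :: "'c \<Rightarrow> 'v" and L Q S :: "'v set"
  assumes L: "add_closed L" and Q: "Q = additive_span S" and S_L: "S \<subseteq> L"
    and \<eta>_closed: "v \<in> L \<Longrightarrow> \<eta> v \<in> carrier M"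
    and \<sigma>_closed: "c \<in> carrier M \<Longrightarrow> \<sigma> c \<in> L"
    and \<eta>_\<sigma>: "c \<in> carrier M \<Longrightarrow> \<eta> (\<sigma> c) = c"
    and \<eta>_add: "v \<in> L \<Longrightarrow> w \<in> L \<Longrightarrow> \<eta> (v + w) = \<eta> v \<oplus>\<^bsub>M\<^esub> \<eta> w"
    and \<sigma>_\<eta>: "v \<in> L \<Longrightarrow> \<sigma> (\<eta> v) - v \<in> Q"
    and smult_closed: "r \<in> carrier (zpoly_ring X) \<Longrightarrow> c \<in> carrier M \<Longrightarrow> r \<odot>\<^bsub>M\<^esub> c \<in> carrier M"
    and \<sigma>_smult: "r \<in> carrier (zpoly_ring X) \<Longrightarrow> c \<in> carrier M \<Longrightarrow>
      \<sigma> (r \<odot>\<^bsub>M\<^esub> c) - zscale (Poly_Mapping.lookup r 0) (\<sigma> c) \<in> Q"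
    and gens: "v \<in> S \<Longrightarrow> frag_of (\<eta> v, 1) \<in> additive_span (tensor_relators (zpoly_ring X) M trivial_module)"
begin

abbreviation "F \<equiv> free_Abelian_group (carrier M \<times> (UNIV :: int set))"
abbreviation "relators \<equiv> tensor_relators (zpoly_ring X) M trivial_module"
abbreviation "TK \<equiv> tensor_kernel (zpoly_ring X) M trivial_module"
abbreviation "T \<equiv> tensor_group (zpoly_ring X) M trivial_module"
abbreviation cls :: "('c \<times> int \<Rightarrow>\<^sub>0 int) \<Rightarrow> ('c \<times> int \<Rightarrow>\<^sub>0 int) set" where "cls z \<equiv> TK #>\<^bsub>F\<^esub> z"

lemma tensor_kernel_eq: "TK = generate F relators" and tensor_group_eq: "T = F Mod TK"
  by (simp_all add: tensor_kernel_def tensor_group_def)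

lemma Q_closed: "add_closed Q" by (simp add: Q)

lemma M_add_closed: "c \<in> carrier M \<Longrightarrow> c' \<in> carrier M \<Longrightarrow> c \<oplus>\<^bsub>M\<^esub> c' \<in> carrier M"
  using \<eta>_add[of "\<sigma> c" "\<sigma> c'"] \<eta>_closed[of "\<sigma> c + \<sigma> c'"] add_closed_add[OF L] by (simp add: \<eta>_\<sigma> \<sigma>_closed)

lemma F_iff: "z \<in> carrier F \<longleftrightarrow> Poly_Mapping.keys z \<subseteq> carrier M \<times> UNIV"
  by simp

lemma F_closed: "add_closed (carrier F)"
  by (auto simp: add_closed_def dest!: subsetD[OF keys_diff])

lemma relators_F: "relators \<subseteq> carrier F"
proof -
  have "frag_of q - frag_of q' - frag_of q'' \<in> carrier F"
    if "q \<in> carrier M \<times> UNIV" "q' \<in> carrier M \<times> UNIV" "q'' \<in> carrier M \<times> UNIV" for q q' q'' :: "'c \<times> int"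
    by (intro add_closed_diff[OF F_closed]) (use that in \<open>simp_all add: keys_frag_of\<close>)
  moreover have "frag_of q - frag_of q' \<in> carrier F"
    if "q \<in> carrier M \<times> UNIV" "q' \<in> carrier M \<times> UNIV" for q q' :: "'c \<times> int"
    by (intro add_closed_diff[OF F_closed]) (use that in \<open>simp_all add: keys_frag_of\<close>)
  ultimately show ?thesis
    unfolding tensor_relators_def by (auto simp only: M_add_closed smult_closed mem_Sigma_iff UNIV_I trivial_module_simps)
qed

lemma F_ops: "x \<otimes>\<^bsub>F\<^esub> y = x + y" "\<one>\<^bsub>F\<^esub> = 0"
  by (simp_all add: free_Abelian_group_def)

lemma comm_group_F: "comm_group F"
  by (rule abelian_free_Abelian_group)

lemma group_F: "group F"
  using comm_group_F by (simp add: comm_group_def)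

lemma TK_eq: "TK = additive_span relators"
proof
  show "TK \<subseteq> additive_span relators"
  proof
    fix z assume "z \<in> TK"
    then show "z \<in> additive_span relators"
      unfolding tensor_kernel_eq
    proof induction
      case (inv h)
      then have "h \<in> carrier F" using relators_F by blast
      then have "inv\<^bsub>F\<^esub> h = - h" by simp
      then show ?case using inv by (simp only: additive_span.base additive_span.neg)
    qed (simp_all only: F_ops additive_span.base additive_span.zero additive_span.add)
  qed
  show "additive_span relators \<subseteq> TK"
  proof
    fix z assume "z \<in> additive_span relators"
    then show "z \<in> TK"
    proof induction
      case (neg v)
      have "v \<in> carrier F"
        using neg.IH subgroup.subset[OF group.generate_is_subgroup[OF group_F relators_F]]
        unfolding tensor_kernel_eq by blast
      then have "inv\<^bsub>F\<^esub> v = - v" by simp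
      then show ?case
        using group.generate_m_inv_closed[OF group_F relators_F] neg.IH unfolding tensor_kernel_eq by metis
    next
      case zero
      then show ?case using generate.one[of F relators] unfolding tensor_kernel_eq F_ops .
    next
      case (base v)
      then show ?case unfolding tensor_kernel_eq by (rule generate.incl)
    next
      case (add v w)
      then show ?case using generate.eng[of v F relators w] unfolding tensor_kernel_eq F_ops by blast
    qed
  qed
qed

lemma TK_closed: "add_closed TK" by (simp add: TK_eq)

lemma TK_subgroup: "subgroup TK F"
  unfolding tensor_kernel_eq by (rule group.generate_is_subgroup[OF group_F relators_F])

lemma TK_F: "TK \<subseteq> carrier F" by (rule subgroup.subset[OF TK_subgroup])

lemma TK_normal: "TK \<lhd> F" by (rule comm_group.subgroup_imp_normal[OF comm_group_F TK_subgroup])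

text \<open>The value of a formal sum under the isomorphism of \<open>M \<otimes> \<int>\<close> with the coinvariants.\<close>

definition ev :: "('c \<times> int \<Rightarrow>\<^sub>0 int) \<Rightarrow> 'v" where
  "ev = lin (\<lambda>q. zscale (snd q) (\<sigma> (fst q)))"

lemma additive_ev: "additive ev" unfolding ev_def by (rule additive_lin)

lemma ev_frag_of [simp]: "ev (frag_of (c, w)) = zscale w (\<sigma> c)" by (simp add: ev_def)

lemma ev_L: "z \<in> carrier F \<Longrightarrow> ev z \<in> L"
  unfolding ev_def F_iff by (rule lin_closed[OF L]) (auto intro!: add_closed_zscale[OF L] \<sigma>_closed)

lemma \<sigma>_add:
  assumes "c \<in> carrier M" "c' \<in> carrier M"
  shows "\<sigma> (c \<oplus>\<^bsub>M\<^esub> c') - \<sigma> c - \<sigma> c' \<in> Q"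
  using \<sigma>_\<eta>[of "\<sigma> c + \<sigma> c'"] assms add_closed_add[OF L] by (simp add: \<eta>_add \<sigma>_closed \<eta>_\<sigma> algebra_simps)

lemma ev_TK: assumes "z \<in> TK" shows "ev z \<in> Q"
proof (rule additive_image_span[OF additive_ev Q_closed _ assms[unfolded TK_eq]])
  fix z assume "z \<in> relators"
  then consider
      c c' w where "c \<in> carrier M" "c' \<in> carrier M" "z = frag_of (c \<oplus>\<^bsub>M\<^esub> c', w) - frag_of (c, w) - frag_of (c', w)"
    | c w w' where "z = frag_of (c, w + w') - frag_of (c, w) - frag_of (c, w')"
    | r c w where "r \<in> carrier (zpoly_ring X)" "c \<in> carrier M"
        "z = frag_of (r \<odot>\<^bsub>M\<^esub> c, w) - frag_of (c, Poly_Mapping.lookup r 0 * w)"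
    unfolding tensor_relators_def by auto
  then show "ev z \<in> Q"
  proof cases
    case 1
    then show ?thesis
      using add_closed_zscale[OF Q_closed \<sigma>_add[OF 1(1,2)], of w]
      by (simp add: additive.diff[OF additive_ev] zscale.scale_right_diff_distrib)
  next
    case 2
    then show ?thesis
      by (simp add: additive.diff[OF additive_ev] zscale.scale_left_distrib add_closed_zero[OF Q_closed])
  next
    case 3
    then show ?thesis
      using add_closed_zscale[OF Q_closed \<sigma>_smult[OF 3(1,2)], of w]
      by (simp add: additive.diff[OF additive_ev] zscale.scale_right_diff_distrib mult.commute)
  qed
qed

lemma relator_left: "c \<in> carrier M \<Longrightarrow> c' \<in> carrier M \<Longrightarrow>
    frag_of (c \<oplus>\<^bsub>M\<^esub> c', w) - frag_of (c, w) - frag_of (c', w) \<in> TK"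
  unfolding TK_eq by (rule tensor_relators_left)

lemma relator_right: "c \<in> carrier M \<Longrightarrow> frag_of (c, w + w') - frag_of (c, w) - frag_of (c, w') \<in> TK"
  unfolding TK_eq by (rule tensor_relators_right)

lemma class_additive:
  assumes "v \<in> L" "w \<in> L"
  shows "frag_of (\<eta> (v + w), 1) - (frag_of (\<eta> v, 1) + frag_of (\<eta> w, 1)) \<in> TK"
  using relator_left[of "\<eta> v" "\<eta> w" 1] assms by (simp add: \<eta>_add \<eta>_closed diff_diff_eq)

text \<open>Bilinearity moves the integers to the left factor, which leaves a single tensor with right
  factor 1.\<close>

lemma normal_form:
  assumes "z \<in> carrier F" shows "z - frag_of (\<eta> (ev z), 1) \<in> TK"
proof -
  have "Poly_Mapping.keys z \<subseteq> carrier M \<times> UNIV" using assms by simp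
  then show ?thesis
  proof (induction z rule: free_Abelian_group_induct[consumes 1, case_names zero diff one])
    case zero
    have "zscale 0 (frag_of (\<eta> 0, 1)) - frag_of (\<eta> (zscale 0 0), 1) \<in> TK"
      using almost_additive_zscale[OF TK_closed L class_additive add_closed_zero[OF L], of 0]
      by (subst add_closed_minus_commute[OF TK_closed]) simp
    then show ?case by (simp add: additive.zero[OF additive_ev])
  next
    case (diff z z')
    have "z \<in> carrier F" "z' \<in> carrier F" using diff by simp_all
    then have "ev z \<in> L" "ev z' \<in> L" by (auto intro!: ev_L simp del: carrier_free_Abelian_group_iff)
    then have "frag_of (\<eta> (ev z - ev z' + ev z'), 1) - (frag_of (\<eta> (ev z - ev z'), 1) + frag_of (\<eta> (ev z'), 1)) \<in> TK"
      by (intro class_additive add_closed_diff[OF L])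
    from add_closed_add[OF TK_closed add_closed_diff[OF TK_closed diff(3,4)] this]
    show ?case by (simp add: additive.diff[OF additive_ev] algebra_simps)
  next
    case (one q)
    then obtain c w where q: "q = (c, w)" "c \<in> carrier M" by (cases q) auto
    have "frag_of (c, zscale w (1::int)) - zscale w (frag_of (c, 1)) \<in> TK"
      using relator_right[OF q(2)]
      by (intro almost_additive_zscale[OF TK_closed, of UNIV "\<lambda>w. frag_of (c, w)"]) (simp_all add: add_closed_def diff_diff_eq)
    moreover have "frag_of (\<eta> (zscale w (\<sigma> c)), 1) - zscale w (frag_of (\<eta> (\<sigma> c), 1)) \<in> TK"
      by (rule almost_additive_zscale[OF TK_closed L class_additive \<sigma>_closed[OF q(2)]])
    ultimately show ?case
      using add_closed_diff[OF TK_closed] by (fastforce simp: q \<eta>_\<sigma> zscale_int_mult)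
  qed
qed

lemma TK_iff: assumes z: "z \<in> carrier F" shows "z \<in> TK \<longleftrightarrow> ev z \<in> Q"
proof
  assume "ev z \<in> Q"
  have "frag_of (\<eta> v, 1) \<in> TK \<and> v \<in> L" if "v \<in> additive_span S" for v
    using that
  proof induction
    case zero
    then show ?case using normal_form[of 0] add_closed_uminus[OF TK_closed, of "- frag_of (\<eta> 0, 1)"] add_closed_zero[OF L]
      by (simp add: additive.zero[OF additive_ev])
  next
    case (base v)
    then show ?case using gens S_L by (auto simp: TK_eq)
  next
    case (add v w)
    then show ?case
      using add_closed_swap[OF TK_closed class_additive[of v w]] add_closed_add[OF TK_closed] add_closed_add[OF L] by blast
  next
    case (neg v)
    then have "- v \<in> L" using add_closed_uminus[OF L] by blast
    have "frag_of (\<eta> (zscale (- 1) v), 1) - zscale (- 1) (frag_of (\<eta> v, 1)) \<in> TK"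
      by (rule almost_additive_zscale[OF TK_closed L class_additive conjunct2[OF neg.IH]])
    moreover have "zscale (- 1) (frag_of (\<eta> v, 1)) \<in> TK" using neg add_closed_zscale[OF TK_closed] by blast
    ultimately show ?case using add_closed_swap[OF TK_closed] \<open>- v \<in> L\<close> by fastforce
  qed
  then have "frag_of (\<eta> (ev z), 1) \<in> TK" using \<open>ev z \<in> Q\<close> unfolding Q by blast
  then show "z \<in> TK" using normal_form[OF z] add_closed_swap[OF TK_closed] by blast
qed (rule ev_TK)

lemma cls_eq: "cls z = {k + z |k. k \<in> TK}"
  by (auto simp: r_coset_def F_ops simp del: mult_free_Abelian_group)

lemma cls_self: "z \<in> cls z"
  using add_closed_zero[OF TK_closed] unfolding cls_eq by (intro CollectI exI[of _ 0]) simp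

lemma cls_eq_iff: "cls z = cls z' \<longleftrightarrow> z - z' \<in> TK"
proof
  assume "cls z = cls z'"
  moreover note cls_self[of z]
  ultimately show "z - z' \<in> TK" by (auto simp: cls_eq)
next
  assume *: "z - z' \<in> TK"
  have "k + z = (k + (z - z')) + z'" "k + z' = (k - (z - z')) + z" for k by simp_all
  moreover have "k \<in> TK \<Longrightarrow> k + (z - z') \<in> TK \<and> k - (z - z') \<in> TK" for k
    using * add_closed_add[OF TK_closed] add_closed_diff[OF TK_closed] by blast
  ultimately show "cls z = cls z'" unfolding cls_eq by blast
qed

lemma carrier_T: "carrier T = cls ` carrier F"
  by (simp add: tensor_group_eq carrier_FactGroup del: carrier_free_Abelian_group_iff)

lemma comm_group_T: "comm_group T"
  unfolding tensor_group_eq by (rule comm_group.abelian_FactGroup[OF comm_group_F TK_subgroup])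

lemma mult_cls: "z \<in> carrier F \<Longrightarrow> z' \<in> carrier F \<Longrightarrow> cls z \<otimes>\<^bsub>T\<^esub> cls z' = cls (z + z')"
  using normal.rcos_sum[OF TK_normal, of z z'] by (simp only: tensor_group_eq mult_FactGroup F_ops)

lemma one_T: "\<one>\<^bsub>T\<^esub> = TK"
  by (simp add: tensor_group_eq)

lemma cls_pow: "z \<in> carrier F \<Longrightarrow> cls z [^]\<^bsub>T\<^esub> (n::nat) = cls (zscale (int n) z)"
  using normal.FactGroup_pow[OF TK_normal, of z n] by (simp add: tensor_group_eq zscale_frag)

lemma torsion_carrier:
  "carrier (torsion_subgroup T) = cls ` {z \<in> carrier F. \<exists>n>0. zscale (int n) (ev z) \<in> Q}"
proof -
  have "cls z [^]\<^bsub>T\<^esub> n = \<one>\<^bsub>T\<^esub> \<longleftrightarrow> zscale (int n) (ev z) \<in> Q" if z: "z \<in> carrier F" for z n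
  proof -
    have "TK = cls 0" by (simp add: cls_eq)
    then have "cls z [^]\<^bsub>T\<^esub> n = \<one>\<^bsub>T\<^esub> \<longleftrightarrow> zscale (int n) z \<in> TK"
      using cls_eq_iff[of "zscale (int n) z" 0] by (simp add: cls_pow[OF z] one_T)
    also have "\<dots> \<longleftrightarrow> zscale (int n) (ev z) \<in> Q"
      using TK_iff[OF add_closed_zscale[OF F_closed z]] by (simp add: additive_zscale[OF additive_ev])
    finally show ?thesis .
  qed
  note tors = this
  show ?thesis
  proof (intro equalityI subsetI)
    fix x assume "x \<in> carrier (torsion_subgroup T)"
    then obtain z n where "x = cls z" "z \<in> carrier F" "0 < n" "cls z [^]\<^bsub>T\<^esub> (n::nat) = \<one>\<^bsub>T\<^esub>"
      unfolding torsion_subgroup_def carrier_T by auto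
    then show "x \<in> cls ` {z \<in> carrier F. \<exists>n>0. zscale (int n) (ev z) \<in> Q}" using tors by blast
  next
    fix x assume "x \<in> cls ` {z \<in> carrier F. \<exists>n>0. zscale (int n) (ev z) \<in> Q}"
    then obtain z n where "x = cls z" "z \<in> carrier F" "0 < n" "zscale (int n) (ev z) \<in> Q" by blast
    then show "x \<in> carrier (torsion_subgroup T)"
      using tors[of z n] unfolding torsion_subgroup_def by (auto simp: carrier_T)
  qed
qed

lemma group_torsion: "group (torsion_subgroup T)"
proof -
  interpret T: comm_group T by (rule comm_group_T)
  have "subgroup {x \<in> carrier T. \<exists>n::nat. 0 < n \<and> x [^]\<^bsub>T\<^esub> n = \<one>\<^bsub>T\<^esub>} T"
  proof (rule T.subgroupI)
    show "{x \<in> carrier T. \<exists>n::nat. 0 < n \<and> x [^]\<^bsub>T\<^esub> n = \<one>\<^bsub>T\<^esub>} \<noteq> {}"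
      using T.one_closed T.nat_pow_one by blast
    fix a assume "a \<in> {x \<in> carrier T. \<exists>n::nat. 0 < n \<and> x [^]\<^bsub>T\<^esub> n = \<one>\<^bsub>T\<^esub>}"
    then obtain n :: nat where a: "a \<in> carrier T" "0 < n" "a [^]\<^bsub>T\<^esub> n = \<one>\<^bsub>T\<^esub>" by blast
    then have "inv\<^bsub>T\<^esub> a [^]\<^bsub>T\<^esub> n = \<one>\<^bsub>T\<^esub>" by (simp add: T.nat_pow_inv)
    then show "inv\<^bsub>T\<^esub> a \<in> {x \<in> carrier T. \<exists>n::nat. 0 < n \<and> x [^]\<^bsub>T\<^esub> n = \<one>\<^bsub>T\<^esub>}" using a by blast
    fix b assume "b \<in> {x \<in> carrier T. \<exists>n::nat. 0 < n \<and> x [^]\<^bsub>T\<^esub> n = \<one>\<^bsub>T\<^esub>}"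
    then obtain m :: nat where b: "b \<in> carrier T" "0 < m" "b [^]\<^bsub>T\<^esub> m = \<one>\<^bsub>T\<^esub>" by blast
    have "a [^]\<^bsub>T\<^esub> (n * m) = \<one>\<^bsub>T\<^esub>"
      by (simp flip: T.nat_pow_pow[OF a(1)] add: a(3))
    moreover have "b [^]\<^bsub>T\<^esub> (n * m) = \<one>\<^bsub>T\<^esub>"
      unfolding mult.commute[of n m] by (simp flip: T.nat_pow_pow[OF b(1)] add: b(3))
    ultimately have "(a \<otimes>\<^bsub>T\<^esub> b) [^]\<^bsub>T\<^esub> (n * m) = \<one>\<^bsub>T\<^esub>" using a b by (simp add: T.nat_pow_distrib)
    then show "a \<otimes>\<^bsub>T\<^esub> b \<in> {x \<in> carrier T. \<exists>n::nat. 0 < n \<and> x [^]\<^bsub>T\<^esub> n = \<one>\<^bsub>T\<^esub>}"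
      using a b by (auto intro!: exI[of _ "n * m"])
  qed auto
  then show ?thesis unfolding torsion_subgroup_def by (rule subgroup.subgroup_is_group) (rule T.is_group)
qed

end

text \<open>An isomorphism of the torsion subgroups, in terms of representatives: \<open>\<theta>\<close> is the map on
  representatives induced by the module map \<open>f\<close>.\<close>

lemma torsion_iso:
  assumes M: "trivial_tensor X M \<eta> \<sigma> L Q S" and N: "trivial_tensor X N j j L' Q' S'"
    and j: "\<And>v. j v = v"
    and f: "\<And>c. c \<in> carrier M \<Longrightarrow> f c = \<theta> (\<sigma> c)"
    and \<theta>: "\<And>v. v \<in> L \<Longrightarrow> \<theta> v \<in> L'" "\<And>v w. v \<in> L \<Longrightarrow> w \<in> L \<Longrightarrow> \<theta> (v + w) = \<theta> v + \<theta> w"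
    and \<theta>_Q: "\<And>v. v \<in> Q \<Longrightarrow> \<theta> v \<in> Q'"
    and inj: "\<And>v n. v \<in> L \<Longrightarrow> 0 < (n::nat) \<Longrightarrow> zscale (int n) v \<in> Q \<Longrightarrow> \<theta> v \<in> Q' \<Longrightarrow> v \<in> Q"
    and surj: "\<And>w n. w \<in> L' \<Longrightarrow> 0 < (n::nat) \<Longrightarrow> zscale (int n) w \<in> Q' \<Longrightarrow>
      \<exists>v\<in>L. \<theta> v - w \<in> Q' \<and> zscale (int n) v \<in> Q"
  shows "tensor_map (zpoly_ring X) N trivial_module f id \<in>
    iso (torsion_subgroup (tensor_group (zpoly_ring X) M trivial_module))
        (torsion_subgroup (tensor_group (zpoly_ring X) N trivial_module))"
proof -
  interpret M: trivial_tensor X M \<eta> \<sigma> L Q S by (rule M)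
  interpret N: trivial_tensor X N j j L' Q' S' by (rule N)
  define G where "G = lin (\<lambda>q. frag_of (f (fst q), snd q :: int))"
  have G: "additive G" unfolding G_def by (rule additive_lin)
  have L'N: "v \<in> L' \<Longrightarrow> v \<in> carrier N" "c \<in> carrier N \<Longrightarrow> c \<in> L'" for v c
    using N.\<eta>_closed[of v] N.\<sigma>_closed[of c] by (simp_all add: j)
  have G_F: "G z \<in> carrier N.F" if "z \<in> carrier M.F" for z
    unfolding G_def
  proof (rule lin_closed[OF N.F_closed])
    fix q assume "q \<in> Poly_Mapping.keys z"
    then have c: "fst q \<in> carrier M" using that by auto
    have "f (fst q) \<in> carrier N" unfolding f[OF c] by (rule L'N(1)[OF \<theta>(1)[OF M.\<sigma>_closed[OF c]]])
    then show "frag_of (f (fst q), snd q) \<in> carrier N.F" by (simp add: keys_frag_of)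
  qed
  have \<theta>_zscale: "\<theta> (zscale k v) = zscale k (\<theta> v)" if "v \<in> L" for k v
    using almost_additive_zscale[OF add_closed_singleton_zero M.L, of \<theta> v k] \<theta>(2) that by simp
  have \<theta>_diff: "\<theta> (v - w) = \<theta> v - \<theta> w" if "v \<in> L" "w \<in> L" for v w
    using \<theta>(2)[of "v - w" w] that add_closed_diff[OF M.L] by simp
  have N_ev: "N.ev (frag_of (c, w)) = zscale w c" for c w
    unfolding N.ev_frag_of by (simp only: j)
  have ev_G: "N.ev (G z) = \<theta> (M.ev z)" if "z \<in> carrier M.F" for z
  proof -
    have "Poly_Mapping.keys z \<subseteq> carrier M \<times> UNIV" using that by simp
    then show ?thesis
    proof (induction z rule: free_Abelian_group_induct[consumes 1, case_names zero diff one])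
      case zero
      then show ?case
        using \<theta>_zscale[OF add_closed_zero[OF M.L], of 0]
        by (simp add: additive.zero[OF G] additive.zero[OF M.additive_ev] additive.zero[OF N.additive_ev])
    next
      case (diff z z')
      then have "M.ev z \<in> L" "M.ev z' \<in> L" by (auto intro!: M.ev_L)
      then show ?case
        using diff by (simp add: additive.diff[OF G] additive.diff[OF M.additive_ev] additive.diff[OF N.additive_ev] \<theta>_diff)
    next
      case (one q)
      then show ?case by (cases q) (auto simp: G_def f N_ev \<theta>_zscale M.\<sigma>_closed simp del: N.ev_frag_of)
    qed
  qed
  let ?t = "tensor_map (zpoly_ring X) N trivial_module f id"
  have t_cls: "?t (M.cls z) = N.cls (G z)" if z: "z \<in> carrier M.F" for z
  proof -
    have const: "N.cls (G z') = N.cls (G z)" if "z' \<in> M.cls z" for z'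
    proof -
      obtain k where k: "z' = k + z" "k \<in> M.TK" using \<open>z' \<in> M.cls z\<close> by (auto simp: M.cls_eq)
      then have "k \<in> carrier M.F" using M.TK_F by blast
      then have "N.ev (G k) \<in> Q'" "G k \<in> carrier N.F" using ev_G G_F \<theta>_Q M.ev_TK k by simp_all
      then have "G k \<in> N.TK" using N.TK_iff by blast
      then show ?thesis by (simp add: N.cls_eq_iff k additive.add[OF G])
    qed
    have fe: "frag_extend (\<lambda>(v, w). frag_of (f v, id w)) = G"
      by (rule ext) (simp add: frag_extend_eq_lin G_def case_prod_unfold)
    have "?t (M.cls z) = (\<Union>z'\<in>M.cls z. N.cls (G z'))"
      by (simp only: tensor_map_def trivial_module_simps fe)
    also have "\<dots> = N.cls (G z)" using M.cls_self[of z] const by (intro UN_constant_eq ballI)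
    finally show ?thesis .
  qed
  have G_add: "G (z + z') = G z + G z'" for z z' by (rule additive.add[OF G])
  let ?A = "{z \<in> carrier M.F. \<exists>n>0. zscale (int n) (M.ev z) \<in> Q}"
  let ?B = "{z \<in> carrier N.F. \<exists>n>0. zscale (int n) (N.ev z) \<in> Q'}"
  have G_A: "G z \<in> ?B" if z: "z \<in> ?A" for z
  proof -
    obtain n where n: "0 < n" "zscale (int n) (M.ev z) \<in> Q" using z by blast
    have "zscale (int n) (N.ev (G z)) = \<theta> (zscale (int n) (M.ev z))"
      using z by (simp add: ev_G \<theta>_zscale M.ev_L)
    then show ?thesis using \<theta>_Q[OF n(2)] n(1) z G_F by auto
  qed
  have sum_F: "z + z' \<in> carrier M.F" if "z \<in> carrier M.F" "z' \<in> carrier M.F" for z z'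
    using add_closed_add[OF M.F_closed] that by blast
  have t_torsion: "?t x \<in> carrier (torsion_subgroup N.T)" if x: "x \<in> carrier (torsion_subgroup M.T)" for x
  proof -
    obtain z where z: "x = M.cls z" "z \<in> ?A" using x unfolding M.torsion_carrier by blast
    then have "z \<in> carrier M.F" by blast
    then have "?t x = N.cls (G z)" unfolding z(1) by (rule t_cls)
    then show ?thesis unfolding N.torsion_carrier using G_A[OF z(2)] by (rule image_eqI)
  qed
  show ?thesis
    unfolding iso_iff
  proof (intro conjI)
    show "?t \<in> hom (torsion_subgroup M.T) (torsion_subgroup N.T)"
    proof (rule homI)
      fix x assume "x \<in> carrier (torsion_subgroup M.T)"
      then obtain z where z: "x = M.cls z" "z \<in> ?A" unfolding M.torsion_carrier by blast
      show "?t x \<in> carrier (torsion_subgroup N.T)" by (rule t_torsion) fact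
      fix y assume "y \<in> carrier (torsion_subgroup M.T)"
      then obtain z' where z': "y = M.cls z'" "z' \<in> ?A" unfolding M.torsion_carrier by blast
      have zz: "z \<in> carrier M.F" "z' \<in> carrier M.F" using z(2) z'(2) by blast+
      have "?t (x \<otimes>\<^bsub>M.T\<^esub> y) = ?t x \<otimes>\<^bsub>N.T\<^esub> ?t y"
        unfolding z z' M.mult_cls[OF zz] t_cls[OF sum_F[OF zz]] t_cls[OF zz(1)] t_cls[OF zz(2)] G_add
        using N.mult_cls[OF G_F[OF zz(1)] G_F[OF zz(2)]] by simp
      then show "?t (x \<otimes>\<^bsub>torsion_subgroup M.T\<^esub> y) = ?t x \<otimes>\<^bsub>torsion_subgroup N.T\<^esub> ?t y"
        by (simp add: torsion_subgroup_def)
    qed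
    show "?t ` carrier (torsion_subgroup M.T) = carrier (torsion_subgroup N.T)"
    proof
      show "?t ` carrier (torsion_subgroup M.T) \<subseteq> carrier (torsion_subgroup N.T)"
        using t_torsion by blast
      show "carrier (torsion_subgroup N.T) \<subseteq> ?t ` carrier (torsion_subgroup M.T)"
      proof
        fix x assume "x \<in> carrier (torsion_subgroup N.T)"
        then obtain y where y: "x = N.cls y" "y \<in> ?B" unfolding N.torsion_carrier by blast
        then obtain n where n: "0 < n" "zscale (int n) (N.ev y) \<in> Q'" by blast
        have yF: "y \<in> carrier N.F" using y by blast
        obtain v where v: "v \<in> L" "\<theta> v - N.ev y \<in> Q'" "zscale (int n) v \<in> Q"
          using surj[OF N.ev_L[OF yF] n] by blast
        let ?z = "frag_of (\<eta> v, 1) :: _ \<Rightarrow>\<^sub>0 int"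
        have zF: "?z \<in> carrier M.F" using M.\<eta>_closed[OF v(1)] by (simp add: keys_frag_of)
        have ev: "M.ev ?z - v \<in> Q" using M.\<sigma>_\<eta>[OF v(1)] by simp
        have "zscale (int n) (M.ev ?z) - zscale (int n) v \<in> Q"
          using add_closed_zscale[OF M.Q_closed ev, of "int n"] by (simp add: zscale.scale_right_diff_distrib)
        then have "zscale (int n) (M.ev ?z) \<in> Q" using v(3) add_closed_swap[OF M.Q_closed] by blast
        then have zA: "?z \<in> ?A" using zF n(1) by blast
        have "\<theta> (M.ev ?z) - \<theta> v \<in> Q'"
          using \<theta>_Q[OF ev] \<theta>_diff[OF M.ev_L[OF zF] v(1)] by simp
        then have "N.ev (G ?z) - N.ev y \<in> Q'"
          unfolding ev_G[OF zF] using add_closed_trans[OF N.Q_closed _ v(2)] by blast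
        then have "N.ev (G ?z - y) \<in> Q'" by (simp add: additive.diff[OF N.additive_ev])
        moreover have "G ?z - y \<in> carrier N.F" by (rule add_closed_diff[OF N.F_closed G_F[OF zF] yF])
        ultimately have "?t (M.cls ?z) = x"
          unfolding t_cls[OF zF] y(1) N.cls_eq_iff by (simp only: N.TK_iff)
        then show "x \<in> ?t ` carrier (torsion_subgroup M.T)"
          unfolding M.torsion_carrier using zA by blast
      qed
    qed
    show "inj_on ?t (carrier (torsion_subgroup M.T))"
    proof (rule inj_onI)
      fix x y assume xy: "x \<in> carrier (torsion_subgroup M.T)" "y \<in> carrier (torsion_subgroup M.T)" "?t x = ?t y"
      then obtain z z' where z: "x = M.cls z" "z \<in> ?A" "y = M.cls z'" "z' \<in> ?A"
        unfolding M.torsion_carrier by blast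
      then have zz: "z \<in> carrier M.F" "z' \<in> carrier M.F" by blast+
      obtain n m where nm: "0 < n" "zscale (int n) (M.ev z) \<in> Q" "0 < m" "zscale (int m) (M.ev z') \<in> Q"
        using z by blast
      have dF: "z - z' \<in> carrier M.F" by (rule add_closed_diff[OF M.F_closed zz])
      have "zscale (int (n * m)) (M.ev (z - z')) =
          zscale (int m) (zscale (int n) (M.ev z)) - zscale (int n) (zscale (int m) (M.ev z'))"
        by (simp add: additive.diff[OF M.additive_ev] zscale.scale_right_diff_distrib mult.commute)
      also have "\<dots> \<in> Q"
        by (rule add_closed_diff[OF M.Q_closed add_closed_zscale[OF M.Q_closed nm(2)] add_closed_zscale[OF M.Q_closed nm(4)]])
      finally have tors: "zscale (int (n * m)) (M.ev (z - z')) \<in> Q" .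
      have "G z - G z' \<in> N.TK"
        using xy(3) by (simp only: z t_cls zz N.cls_eq_iff)
      then have "N.ev (G (z - z')) \<in> Q'" using N.ev_TK by (simp add: additive.diff[OF G])
      then have "M.ev (z - z') \<in> Q"
        using inj[OF M.ev_L[OF dF] _ tors] nm ev_G[OF dF] by simp
      then show "x = y" by (simp only: z M.cls_eq_iff M.TK_iff[OF dF])
    qed
  qed
qed

section \<open>Torsion of the coinvariants in prime degree\<close>

lemma additive_span_Un: "add_closed T \<Longrightarrow> additive_span (S \<union> T) = set_sum (additive_span S) T"
proof
  assume T: "add_closed T"
  show "additive_span (S \<union> T) \<subseteq> set_sum (additive_span S) T"
  proof (rule additive_span_minimal[OF _ add_closed_set_sum[OF add_closed_span T]])
    show "S \<union> T \<subseteq> set_sum (additive_span S) T"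
      using set_sum_left[OF T, of "additive_span S"] set_sum_right[OF add_closed_span, of T S] additive_span.base[of _ S] by blast
  qed
  show "set_sum (additive_span S) T \<subseteq> additive_span (S \<union> T)"
    by (rule set_sum_minimal) (auto intro: additive_span.base additive_span_mono[THEN subsetD])
qed

context lie_zpoly
begin

context
  fixes p :: nat
  assumes p: "prime p"
begin

lemma lie_module_simps:
  "carrier (lie_module s p) = lie_component p" "(\<oplus>\<^bsub>lie_module s p\<^esub>) = (+)"
  "r \<odot>\<^bsub>lie_module s p\<^esub> v = zpoly_action D r v"
  by (simp_all add: lie_module_def ab_module_def)

lemma metab_class_eq: "metab_class s p v = {k + v |k. k \<in> metab_kernel p}"
  unfolding metab_class_def lie_component_Int_second_derived[OF p]
  by (auto simp: a_r_coset_def' lie_module_simps)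

lemma metab_class_eq_iff: "metab_class s p v = metab_class s p w \<longleftrightarrow> v - w \<in> metab_kernel p"
proof
  assume "metab_class s p v = metab_class s p w"
  moreover have "v \<in> metab_class s p v"
    using add_closed_zero[OF add_closed_metab_kernel] unfolding metab_class_eq by force
  ultimately show "v - w \<in> metab_kernel p" by (auto simp: metab_class_eq)
next
  assume *: "v - w \<in> metab_kernel p"
  have "k + v = (k + (v - w)) + w" "k + w = (k - (v - w)) + v" for k by simp_all
  moreover have "k \<in> metab_kernel p \<Longrightarrow> k + (v - w) \<in> metab_kernel p \<and> k - (v - w) \<in> metab_kernel p" for k
    using * by (simp add: add_closed_add add_closed_diff)
  ultimately show "metab_class s p v = metab_class s p w" unfolding metab_class_eq by blast
qed

lemma carrier_metab: "carrier (metab_module s p) = metab_class s p ` lie_component p"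
  by (auto simp: metab_module_def quotient_module_def A_RCOSETS_def' metab_class_def lie_module_simps)

lemma metab_add: "metab_class s p v \<oplus>\<^bsub>metab_module s p\<^esub> metab_class s p w = metab_class s p (v + w)"
proof -
  have "metab_class s p v \<oplus>\<^bsub>metab_module s p\<^esub> metab_class s p w =
      {a + b |a b. a \<in> metab_class s p v \<and> b \<in> metab_class s p w}"
    by (auto simp: metab_module_def quotient_module_def set_add_def' lie_module_simps)
  also have "\<dots> = metab_class s p (v + w)"
  proof -
    have 1: "(k + v) + (l + w) \<in> metab_class s p (v + w)" if "k \<in> metab_kernel p" "l \<in> metab_kernel p" for k l
      unfolding metab_class_eq
      using add_closed_add[OF add_closed_metab_kernel that] by (intro CollectI exI[of _ "k + l"]) (simp add: algebra_simps)
    have 2: "\<exists>a b. k + (v + w) = a + b \<and> a \<in> metab_class s p v \<and> b \<in> metab_class s p w" if "k \<in> metab_kernel p" for k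
    proof (rule exI[of _ "k + v"], rule exI[of _ w], intro conjI)
      show "k + (v + w) = (k + v) + w" by (simp add: add.assoc)
      show "k + v \<in> metab_class s p v" unfolding metab_class_eq using that by blast
      have "w = 0 + w" by simp
      then show "w \<in> metab_class s p w"
        unfolding metab_class_eq using add_closed_zero[OF add_closed_metab_kernel[of p]] by blast
    qed
    show ?thesis
    proof (intro equalityI subsetI)
      fix u assume "u \<in> {a + b |a b. a \<in> metab_class s p v \<and> b \<in> metab_class s p w}"
      then obtain k l where "u = (k + v) + (l + w)" "k \<in> metab_kernel p" "l \<in> metab_kernel p"
        unfolding metab_class_eq by blast
      then show "u \<in> metab_class s p (v + w)" using 1 by blast
    next
      fix u assume "u \<in> metab_class s p (v + w)"
      then obtain k where "u = k + (v + w)" "k \<in> metab_kernel p" unfolding metab_class_eq by blast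
      then show "u \<in> {a + b |a b. a \<in> metab_class s p v \<and> b \<in> metab_class s p w}" using 2 by blast
    qed
  qed
  finally show ?thesis .
qed

lemma metab_smult:
  assumes r: "r \<in> carrier (zpoly_ring X)"
  shows "r \<odot>\<^bsub>metab_module s p\<^esub> metab_class s p v = metab_class s p (zpoly_action D r v)"
proof -
  have eq: "r \<odot>\<^bsub>metab_module s p\<^esub> C = (\<Union>u\<in>C. metab_class s p (zpoly_action D r u))" for C
    by (simp add: metab_module_def quotient_module_def metab_class_def lie_module_simps)
  have "metab_class s p (zpoly_action D r u) = metab_class s p (zpoly_action D r v)"
    if u: "u \<in> metab_class s p v" for u
  proof -
    obtain k where k: "u = k + v" "k \<in> metab_kernel p" using u by (auto simp: metab_class_eq)
    have "zpoly_action D r k \<in> metab_kernel p"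
      by (rule zpoly_action_closed[OF r]) (simp_all add: k metab_kernel_lie_deriv)
    then show ?thesis
      by (simp add: metab_class_eq_iff k additive.add[OF zpoly_action_additive[OF r]])
  qed
  moreover have "v \<in> metab_class s p v"
    using add_closed_zero[OF add_closed_metab_kernel] unfolding metab_class_eq by force
  ultimately show ?thesis unfolding eq by (intro UN_constant_eq ballI)
qed

definition metab_rep :: "'a free_lie set \<Rightarrow> 'a free_lie" where
  "metab_rep C = (SOME v. v \<in> lie_component p \<and> metab_class s p v = C)"

lemma metab_rep:
  assumes "C \<in> carrier (metab_module s p)"
  shows "metab_rep C \<in> lie_component p" "metab_class s p (metab_rep C) = C"
proof -
  have "\<exists>v. v \<in> lie_component p \<and> metab_class s p v = C" using assms by (auto simp: carrier_metab)
  from someI_ex[OF this] show "metab_rep C \<in> lie_component p" "metab_class s p (metab_rep C) = C"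
    by (simp_all add: metab_rep_def)
qed

lemma metab_rep_class: "v \<in> lie_component p \<Longrightarrow> metab_rep (metab_class s p v) - v \<in> metab_kernel p"
  using metab_rep(2)[of "metab_class s p v"] by (simp only: metab_class_eq_iff carrier_metab imageI)

lemma theta_eq:
  assumes v: "v \<in> lie_component p"
  shows "theta s p (metab_class s p v) = theta_lift p v"
proof -
  let ?P = "\<lambda>\<phi>. \<phi> \<in> extensional (carrier (metab_module s p)) \<and>
     \<phi> \<in> hom (add_monoid (metab_module s p)) (add_monoid (lie_module s p)) \<and>
     (\<forall>a. zscale (int p) (\<phi> (metab_class s p (left_normed (map a [1..<Suc p])))) = theta_sum p a)"
  define \<phi> where "\<phi> = restrict (\<lambda>C. theta_lift p (metab_rep C)) (carrier (metab_module s p))"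
  have \<phi>: "\<phi> (metab_class s p v) = theta_lift p v" if v: "v \<in> lie_component p" for v
  proof -
    let ?k = "metab_rep (metab_class s p v) - v"
    have k: "?k \<in> metab_kernel p" by (rule metab_rep_class[OF v])
    then have "theta_lift p (?k + v) = theta_lift p ?k + theta_lift p v"
      using metab_kernel_subset_component by (intro theta_lift_add[OF p _ v]) blast
    then show ?thesis using v by (simp add: \<phi>_def carrier_metab theta_lift_metab_kernel[OF p k])
  qed
  have ln: "left_normed (map a [1..<Suc p]) \<in> lie_component p" for a :: "nat \<Rightarrow> 'a"
    using left_normed_in_lie_component[of "map a [1..<Suc p]"] by (simp del: upt_Suc)
  have P: "?P \<phi>"
  proof (intro conjI allI)
    show "\<phi> \<in> extensional (carrier (metab_module s p))" by (simp add: \<phi>_def)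
    show "\<phi> \<in> hom (add_monoid (metab_module s p)) (add_monoid (lie_module s p))"
    proof (rule homI)
      fix C assume "C \<in> carrier (add_monoid (metab_module s p))"
      then obtain v where v: "C = metab_class s p v" "v \<in> lie_component p" by (auto simp: carrier_metab)
      then show "\<phi> C \<in> carrier (add_monoid (lie_module s p))"
        by (simp add: \<phi> lie_module_simps theta_lift(1)[OF p])
      fix C' assume "C' \<in> carrier (add_monoid (metab_module s p))"
      then obtain w where w: "C' = metab_class s p w" "w \<in> lie_component p" by (auto simp: carrier_metab)
      show "\<phi> (C \<otimes>\<^bsub>add_monoid (metab_module s p)\<^esub> C') = \<phi> C \<otimes>\<^bsub>add_monoid (lie_module s p)\<^esub> \<phi> C'"
        using v w by (simp add: metab_add \<phi> lie_module_simps theta_lift_add[OF p] add_closed_add)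
    qed
    fix a :: "nat \<Rightarrow> 'a"
    show "zscale (int p) (\<phi> (metab_class s p (left_normed (map a [1..<Suc p])))) = theta_sum p a"
      unfolding \<phi>[OF ln] by (rule theta_lift_left_normed[OF p])
  qed
  have "\<psi> = \<phi>" if \<psi>: "?P \<psi>" for \<psi>
  proof (rule extensionalityI)
    show "\<psi> \<in> extensional (carrier (metab_module s p))" "\<phi> \<in> extensional (carrier (metab_module s p))"
      using \<psi> P by blast+
    have \<psi>_closed: "\<psi> (metab_class s p v) \<in> lie_component p" if "v \<in> lie_component p" for v
      using \<psi> that by (auto simp: hom_def carrier_metab lie_module_simps)
    have \<psi>_add: "\<psi> (metab_class s p (v + w)) = \<psi> (metab_class s p v) + \<psi> (metab_class s p w)"
      if "v \<in> lie_component p" "w \<in> lie_component p" for v w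
    proof -
      have "\<psi> (metab_class s p v \<oplus>\<^bsub>metab_module s p\<^esub> metab_class s p w) =
          \<psi> (metab_class s p v) \<oplus>\<^bsub>lie_module s p\<^esub> \<psi> (metab_class s p w)"
        using \<psi> that by (simp add: hom_def carrier_metab)
      then show ?thesis by (simp add: metab_add lie_module_simps)
    qed
    have "lie_component p \<subseteq> {v \<in> lie_component p. \<psi> (metab_class s p v) = theta_lift p v}"
    proof (rule lie_component_minimal)
      show "add_closed {v \<in> lie_component p. \<psi> (metab_class s p v) = theta_lift p v}"
        unfolding add_closed_def
      proof (intro conjI ballI)
        have "theta_lift p 0 = 0" by (rule theta_lift_metab_kernel[OF p]) (simp add: add_closed_zero)
        then show "0 \<in> {v \<in> lie_component p. \<psi> (metab_class s p v) = theta_lift p v}"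
          using \<psi>_add[of 0 0] by (simp add: add_closed_zero)
        fix v w assume vw: "v \<in> {v \<in> lie_component p. \<psi> (metab_class s p v) = theta_lift p v}"
          "w \<in> {v \<in> lie_component p. \<psi> (metab_class s p v) = theta_lift p v}"
        then have d: "v - w \<in> lie_component p" by (simp add: add_closed_diff)
        show "v - w \<in> {v \<in> lie_component p. \<psi> (metab_class s p v) = theta_lift p v}"
          using \<psi>_add[OF d, of w] theta_lift_add[OF p d, of w] vw d by simp
      qed
      fix as :: "'a list" assume as: "length as = p"
      have eq: "as = map (\<lambda>i. as ! (i - 1)) [1..<Suc p]"
        by (rule nth_equalityI) (use as in \<open>auto simp del: upt_Suc\<close>)
      let ?v = "left_normed (map (\<lambda>i. as ! (i - 1)) [1..<Suc p])"
      have "\<psi> (metab_class s p ?v) = theta_lift p ?v"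
      proof (rule zscale_cancel[OF p \<psi>_closed[OF ln] theta_lift(1)[OF p ln]])
        show "zscale (int p) (\<psi> (metab_class s p ?v)) = zscale (int p) (theta_lift p ?v)"
          using \<psi> by (simp only: theta_lift_left_normed[OF p])
        show "int p \<noteq> 0" using prime_gt_0_nat[OF p] by simp
      qed
      then show "left_normed as \<in> {v \<in> lie_component p. \<psi> (metab_class s p v) = theta_lift p v}"
        using ln[of "\<lambda>i. as ! (i - 1)"] unfolding eq[symmetric] by blast
    qed
    then show "\<psi> C = \<phi> C" if "C \<in> carrier (metab_module s p)" for C
      using that \<phi> by (auto simp: carrier_metab)
  qed
  then have "theta s p = \<phi>" unfolding theta_def using P by (intro the_equality) blast+
  then show ?thesis by (simp add: \<phi>[OF v])
qed

lemma tensor_lie: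
  "trivial_tensor X (lie_module s p) id id (lie_component p) (deriv_span p)
     {D x v |x v. x \<in> X \<and> v \<in> lie_component p}"
proof (rule trivial_tensor.intro)
  show "{D x v |x v. x \<in> X \<and> v \<in> lie_component p} \<subseteq> lie_component p"
    using lie_deriv_lie_component by blast
  fix r v assume r: "r \<in> carrier (zpoly_ring X)" and v: "v \<in> carrier (lie_module s p)"
  show "r \<odot>\<^bsub>lie_module s p\<^esub> v \<in> carrier (lie_module s p)"
    using zpoly_action_closed[OF r, of "lie_component p" v] v lie_deriv_lie_component by (simp add: lie_module_simps)
  show "id (r \<odot>\<^bsub>lie_module s p\<^esub> v) - zscale (Poly_Mapping.lookup r 0) (id v) \<in> deriv_span p"
    using zpoly_action_trivial[OF r, of v p] v by (simp add: lie_module_simps)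
next
  let ?R = "additive_span (tensor_relators (zpoly_ring X) (lie_module s p) trivial_module)"
  fix u assume "u \<in> {D x v |x v. x \<in> X \<and> v \<in> lie_component p}"
  then obtain x v where u: "u = D x v" "x \<in> X" "v \<in> lie_component p" by blast
  show "frag_of (id u, 1) \<in> ?R"
    using tensor_relators_zvar[OF u(2), of v "lie_module s p"] u(3)
    by (simp add: lie_module_simps zpoly_action_zvar u(1))
qed (simp_all add: lie_module_simps deriv_span_def add_closed_zero)

lemma tensor_metab:
  "trivial_tensor X (metab_module s p) (metab_class s p) metab_rep (lie_component p)
     (set_sum (deriv_span p) (metab_kernel p))
     ({D x v |x v. x \<in> X \<and> v \<in> lie_component p} \<union> metab_kernel p)"
proof (rule trivial_tensor.intro)
  let ?Q = "set_sum (deriv_span p) (metab_kernel p)"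
  have Q: "add_closed ?Q" by (simp add: add_closed_set_sum)
  have KQ: "metab_kernel p \<subseteq> ?Q" "deriv_span p \<subseteq> ?Q" by (simp_all add: set_sum_right set_sum_left)
  show "{D x v |x v. x \<in> X \<and> v \<in> lie_component p} \<union> metab_kernel p \<subseteq> lie_component p"
    using lie_deriv_lie_component metab_kernel_subset_component by blast
  show "?Q = additive_span ({D x v |x v. x \<in> X \<and> v \<in> lie_component p} \<union> metab_kernel p)"
    by (simp add: additive_span_Un deriv_span_def)
  show "metab_rep (metab_class s p v) - v \<in> ?Q" if "v \<in> lie_component p" for v
    using metab_rep_class[OF that] KQ by blast
  fix r C assume r: "r \<in> carrier (zpoly_ring X)" and C: "C \<in> carrier (metab_module s p)"
  obtain v where v: "C = metab_class s p v" "v \<in> lie_component p" using C by (auto simp: carrier_metab)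
  have rv: "zpoly_action D r v \<in> lie_component p"
    using zpoly_action_closed[OF r, of "lie_component p" v] v lie_deriv_lie_component by simp
  then show "r \<odot>\<^bsub>metab_module s p\<^esub> C \<in> carrier (metab_module s p)"
    by (simp add: v metab_smult[OF r] carrier_metab)
  let ?n = "Poly_Mapping.lookup r 0"
  have "metab_rep (metab_class s p (zpoly_action D r v)) - zpoly_action D r v \<in> ?Q"
    using metab_rep_class[OF rv] KQ by blast
  moreover have "zpoly_action D r v - zscale ?n v \<in> ?Q" using zpoly_action_trivial[OF r v(2)] KQ by blast
  moreover have "zscale ?n v - zscale ?n (metab_rep C) \<in> ?Q"
  proof -
    have "v - metab_rep C \<in> ?Q"
      using metab_rep_class[OF v(2)] KQ unfolding v(1) by (subst add_closed_minus_commute[OF Q]) blast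
    from add_closed_zscale[OF Q this] show ?thesis by (simp add: zscale.scale_right_diff_distrib)
  qed
  ultimately show "metab_rep (r \<odot>\<^bsub>metab_module s p\<^esub> C) - zscale ?n (metab_rep C) \<in> ?Q"
    using add_closed_trans[OF Q] unfolding v(1) metab_smult[OF r] by blast
next
  let ?R = "additive_span (tensor_relators (zpoly_ring X) (metab_module s p) trivial_module)"
  have mem: "metab_class s p v \<in> carrier (metab_module s p)" if "v \<in> lie_component p" for v
    using that by (simp add: carrier_metab)
  fix u assume "u \<in> {D x v |x v. x \<in> X \<and> v \<in> lie_component p} \<union> metab_kernel p"
  then show "frag_of (metab_class s p u, 1) \<in> ?R"
  proof
    assume "u \<in> {D x v |x v. x \<in> X \<and> v \<in> lie_component p}"
    then obtain x v where u: "u = D x v" "x \<in> X" "v \<in> lie_component p" by blast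
    let ?C = "metab_class s p v"
    have C: "?C \<in> carrier (metab_module s p)" by (rule mem[OF u(3)])
    show ?thesis
      using tensor_relators_zvar[OF u(2) C] by (simp add: metab_smult[OF zvar_in_zpoly_ring[OF u(2)]] zpoly_action_zvar u(1))
  next
    assume u: "u \<in> metab_kernel p"
    then have "metab_class s p u = metab_class s p 0" by (simp add: metab_class_eq_iff)
    moreover have "metab_class s p 0 \<in> carrier (metab_module s p)" by (rule mem) (simp add: add_closed_zero)
    ultimately show ?thesis by (simp add: tensor_relators_idem metab_add)
  qed
qed (simp_all add: carrier_metab metab_rep metab_add)

text \<open>Wilson's theorem. Theta followed by the projection to the metabelian quotient is multiplication
  by this number, and therefore the identity on elements of order \<open>p\<close>.\<close>

lemma fact_p_minus_2: "\<exists>t. fact (p - 2) = 1 + int p * t"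
proof -
  have p2: "2 \<le> p" by (rule prime_ge_2_nat[OF p])
  have "[fact (p - 1) = - 1] (mod int p)" using wilson_theorem[OF p] .
  then obtain t where t: "fact (p - 1) = - 1 + int p * t"
    by (metis cong_iff_lin cong_sym_eq mult.commute)
  have "fact (p - 1) = int (p - 1) * fact (p - 2)"
    using p2 fact_reduce[of "p - 1", where 'a = int] by (simp add: numeral_2_eq_2)
  also have "\<dots> = int p * fact (p - 2) - fact (p - 2)" using p2 by (simp add: of_nat_diff algebra_simps)
  finally have "fact (p - 2) = 1 + int p * (fact (p - 2) - t)" using t by (simp add: algebra_simps)
  then show ?thesis by blast
qed

lemma theta_lift_deriv_span: "v \<in> set_sum (deriv_span p) (metab_kernel p) \<Longrightarrow> theta_lift p v \<in> deriv_span p"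
proof -
  have diff: "theta_lift p (v - w) = theta_lift p v - theta_lift p w"
    if "v \<in> lie_component p" "w \<in> lie_component p" for v w
    using theta_lift_add[OF p add_closed_diff[OF _ that] that(2)] by simp
  have "deriv_span p \<subseteq> {v \<in> lie_component p. theta_lift p v \<in> deriv_span p}"
    unfolding deriv_span_def[of p]
  proof (rule additive_span_minimal)
    show "add_closed {v \<in> lie_component p. theta_lift p v \<in> additive_span {D x v |x v. x \<in> X \<and> v \<in> lie_component p}}"
      unfolding add_closed_def
      using theta_lift_metab_kernel[OF p, of 0] by (auto simp: diff add_closed_diff add_closed_zero)
    show "{D x v |x v. x \<in> X \<and> v \<in> lie_component p} \<subseteq>
        {v \<in> lie_component p. theta_lift p v \<in> additive_span {D x v |x v. x \<in> X \<and> v \<in> lie_component p}}"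
      using theta_lift_lie_deriv[OF p] theta_lift(1)[OF p] lie_deriv_lie_component lie_deriv_in_deriv_span
      by (auto simp flip: deriv_span_def)
  qed
  moreover assume "v \<in> set_sum (deriv_span p) (metab_kernel p)"
  then obtain i k where "v = i + k" "i \<in> deriv_span p" "k \<in> metab_kernel p" unfolding set_sum_def by blast
  moreover have "i \<in> lie_component p" "k \<in> lie_component p"
    using calculation metab_kernel_subset_component[of p] by blast+
  ultimately show ?thesis
    using theta_lift_add[OF p, of i k] theta_lift_metab_kernel[OF p, of k] by auto
qed

lemma torsion_isomorphism:
  "tensor_map (zpoly_ring X) (lie_module s p) trivial_module (theta s p) id \<in>
    iso (torsion_subgroup (tensor_group (zpoly_ring X) (metab_module s p) trivial_module))
        (torsion_subgroup (tensor_group (zpoly_ring X) (lie_module s p) trivial_module))"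
proof (rule torsion_iso[OF tensor_metab tensor_lie id_apply, where \<theta> = "theta_lift p"])
  let ?Q = "set_sum (deriv_span p) (metab_kernel p)"
  have Q: "add_closed ?Q" by (simp add: add_closed_set_sum)
  have KQ: "metab_kernel p \<subseteq> ?Q" "deriv_span p \<subseteq> ?Q" by (simp_all add: set_sum_right set_sum_left)
  obtain t where t: "fact (p - 2) = 1 + int p * t" using fact_p_minus_2 by blast
  have cong: "theta_lift p v - v \<in> ?Q" if v: "v \<in> lie_component p" and pv: "zscale (int p) v \<in> ?Q" for v
  proof -
    have "(theta_lift p v - zscale (fact (p - 2)) v) + zscale t (zscale (int p) v) \<in> ?Q"
      using theta_lift_congruence[OF p v] KQ add_closed_zscale[OF Q pv] by (intro add_closed_add[OF Q]) blast+
    then show ?thesis by (simp add: t zscale.scale_left_distrib mult.commute)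
  qed
  show "theta s p c = theta_lift p (metab_rep c)" if "c \<in> carrier (metab_module s p)" for c
    using theta_eq[OF metab_rep(1)[OF that]] metab_rep(2)[OF that] by simp
  show "theta_lift p v \<in> lie_component p" if "v \<in> lie_component p" for v by (rule theta_lift(1)[OF p that])
  show "theta_lift p (v + w) = theta_lift p v + theta_lift p w"
    if "v \<in> lie_component p" "w \<in> lie_component p" for v w by (rule theta_lift_add[OF p that])
  show "theta_lift p v \<in> deriv_span p" if "v \<in> ?Q" for v by (rule theta_lift_deriv_span[OF that])
  show "v \<in> ?Q" if "v \<in> lie_component p" "0 < n" "zscale (int n) v \<in> ?Q" "theta_lift p v \<in> deriv_span p" for v and n :: nat
  proof -
    have "zscale (int p) v \<in> ?Q"
      using metab_torsion_exponent[OF that(1) prime_ge_2_nat[OF p] that(3)] that(2) by simp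
    from cong[OF that(1) this] show ?thesis using that(4) KQ add_closed_swap[OF Q] by blast
  qed
  show "\<exists>v\<in>lie_component p. theta_lift p v - w \<in> deriv_span p \<and> zscale (int n) v \<in> ?Q"
    if w: "w \<in> lie_component p" "0 < n" "zscale (int n) w \<in> deriv_span p" for w and n :: nat
  proof (intro bexI[OF _ w(1)] conjI)
    show "zscale (int n) w \<in> ?Q" using w(3) KQ by blast
    have "zscale (int p) w \<in> deriv_span p"
      using torsion_exponent[OF w(1) prime_gt_0_nat[OF p] w(3)] w(2) by simp
    then have "theta_lift p w - w \<in> ?Q" using cong[OF w(1)] KQ by blast
    moreover have "zscale (int n) (theta_lift p w - w) \<in> deriv_span p"
    proof -
      have "zscale (int n) (theta_lift p w) = theta_lift p (zscale (int n) w)"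
        using almost_additive_zscale[OF add_closed_singleton_zero add_closed_lie_component[of p], of "theta_lift p" w "int n"]
          theta_lift_add[OF p] w(1) by simp
      also have "\<dots> \<in> deriv_span p" using w(3) KQ theta_lift_deriv_span by blast
      finally show ?thesis using w(3) by (simp add: zscale.scale_right_diff_distrib add_closed_diff)
    qed
    ultimately show "theta_lift p w - w \<in> deriv_span p"
      using torsion_in_metab_kernel[OF p, of "theta_lift p w - w" "int n"] w(2) by simp
  qed
qed

lemma torsion_isomorphic:
  "torsion_subgroup (tensor_group (zpoly_ring X) (lie_module s p) trivial_module) \<cong>
   torsion_subgroup (tensor_group (zpoly_ring X) (metab_module s p) trivial_module)"
  using group.iso_sym[OF trivial_tensor.group_torsion[OF tensor_metab]] torsion_isomorphism
  unfolding is_iso_def by blast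

end

end

theorem proposition3p3:
  fixes X :: "'x set"
    and s :: "'x zpoly \<Rightarrow> 'a::ab_group_add \<Rightarrow> 'a"
    and p :: nat
  assumes "finite X"
    and "free_module (zpoly_ring X) (ab_module UNIV s)"
    and "prime p"
  shows "torsion_subgroup (tensor_group (zpoly_ring X) (lie_module s p) trivial_module) \<cong>
         torsion_subgroup (tensor_group (zpoly_ring X) (metab_module s p) trivial_module) \<and>
         tensor_map (zpoly_ring X) (lie_module s p) trivial_module (theta s p) id \<in>
         iso (torsion_subgroup (tensor_group (zpoly_ring X) (metab_module s p) trivial_module))
             (torsion_subgroup (tensor_group (zpoly_ring X) (lie_module s p) trivial_module))"
proof -
  obtain coord and e :: "('x, 'a) letter \<Rightarrow> 'a" where ce: "lie_coordinates X (\<lambda>x. s (zvar x)) coord e"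
    using free_module_coordinates[OF assms(1,2)] by blast
  interpret U: zpoly_module X s using assms(2) by (simp add: zpoly_module_def free_module_def)
  interpret lie_zpoly X s coord e
    using ce by (rule lie_zpoly.intro) (simp add: lie_zpoly_axioms_def U.act_commute)
  show ?thesis using torsion_isomorphic[OF assms(3)] torsion_isomorphism[OF assms(3)] by blast
qed

end
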